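(* Let $1\leq\rho<\infty$, let $(\mu^k)_{k\in\mathbb N}$ be a sequence in $\mathcal P_\rho(\mathbb R^d)$, $(\nu^k)_{k\in\mathbb N}$ a sequence in $\mathcal P_1(\mathbb R^d)$, and let $\theta\colon\mathbb R^d\to\mathbb R$ be convex and such that for some constant $c>0$ $$\theta(x)\leq c(1+|x|^\rho)\qquad\forall x\in\mathbb R^d.$$ If $\mu^k\to\mu$ in $\mathcal W_\rho$ and $\nu^k\to\nu$ in $\mathcal W_1$, then $\lim_k V_\theta(\mu^k,\nu^k)=V_\theta(\mu,\nu)$. If additionally $\theta$ is strictly convex, then: (1) the (unique) minimizers converge: $\arg\min_{\eta\leq_c\nu^k}W_\theta(\mu^k,\eta)\to\arg\min_{\eta\leq_c\nu}W_\theta(\mu,\eta)$ in $\mathcal W_1$; (2) in the case $\mu^k=\mu$ for all $k$, let $T^k$ be the ($\mu$-a.s. unique) map with $T^k(\mu)\leq_c\nu^k$ and $V_\theta(\mu,\nu^k)=W_\theta(\mu,T^k(\mu))=\int\theta(x-T^k(x))\,\mu(dx)$, and let $T$ be the ($\mu$-a.s. unique) map with $T(\mu)\leq_c\nu$ and $V_\theta(\mu,\nu)=W_\theta(\mu,T(\mu))=\int\theta(x-T(x))\,\mu(dx)$. Then $T^k$ converges to $T$ in $\mu$-probability.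
   Context: $\mathcal P_\rho(\mathbb R^d)$ is the set of Borel probability measures on $\mathbb R^d$ with finite $\rho$-th moment, and $\mathcal W_\rho$ denotes the topology on it induced by the $\rho$-Wasserstein distance. $T(\mu)$ is the push-forward of $\mu$ under $T$. $\eta\leq_c\nu$ (convex order) means $\int\phi\,d\eta\leq\int\phi\,d\nu$ for all convex $\phi\colon\mathbb R^d\to\mathbb R$. $\Pi(\mu,\eta)$ is the set of couplings of $\mu$ and $\eta$; $W_\theta(\mu,\eta):=\inf_{\pi\in\Pi(\mu,\eta)}\int\theta(x-y)\,\pi(dx,dy)$, and $V_\theta(\mu,\nu):=\inf_{\eta\leq_c\nu}W_\theta(\mu,\eta)$. *)

theory Defs
  imports "HOL-Probability.Probability"
begin

definition prob_moment :: "real \<Rightarrow> 'a::euclidean_space measure set" where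
  "prob_moment \<rho> =
     {M. prob_space M \<and> sets M = sets borel \<and> integrable M (\<lambda>x. norm x powr \<rho>)}"

text \<open>
  The integral of a measurable function with values in \<open>[-\<infinity>, \<infinity>]\<close>. The Bochner integral cannot be
  used, since it is 0 on non-integrable functions, whereas the costs and the integrals of
  convex functions below can be \<open>\<infinity>\<close>. The indeterminate case (both parts infinite) does not
  occur in this development: a convex function has an affine minorant, and all measures have
  finite first moment.
\<close>

definition ext_integral :: "'b measure \<Rightarrow> ('b \<Rightarrow> real) \<Rightarrow> ereal" where
  "ext_integral M f =
     enn2ereal (\<integral>\<^sup>+ x. ennreal (f x) \<partial>M) - enn2ereal (\<integral>\<^sup>+ x. ennreal (- f x) \<partial>M)"

definition convex_order ::
    "'a::euclidean_space measure \<Rightarrow> 'a measure \<Rightarrow> bool" (infix "\<le>\<^sub>c" 50) where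
  "\<eta> \<le>\<^sub>c \<nu> \<longleftrightarrow> \<eta> \<in> prob_moment 1 \<and> \<nu> \<in> prob_moment 1 \<and>
     (\<forall>\<phi>. convex_on UNIV \<phi> \<longrightarrow> ext_integral \<eta> \<phi> \<le> ext_integral \<nu> \<phi>)"

definition couplings ::
    "'a::euclidean_space measure \<Rightarrow> 'a measure \<Rightarrow> ('a \<times> 'a) measure set" where
  "couplings \<mu> \<eta> =
     {\<pi>. sets \<pi> = sets borel \<and> distr \<pi> borel fst = \<mu> \<and> distr \<pi> borel snd = \<eta>}"

definition transport_cost ::
    "('a::euclidean_space \<Rightarrow> real) \<Rightarrow> 'a measure \<Rightarrow> 'a measure \<Rightarrow> ereal" where
  "transport_cost \<theta> \<mu> \<eta> =
     (INF \<pi> \<in> couplings \<mu> \<eta>. ext_integral \<pi> (\<lambda>(x, y). \<theta> (x - y)))"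

definition weak_transport_cost ::
    "('a::euclidean_space \<Rightarrow> real) \<Rightarrow> 'a measure \<Rightarrow> 'a measure \<Rightarrow> ereal" where
  "weak_transport_cost \<theta> \<mu> \<nu> = (INF \<eta> \<in> {\<eta>. \<eta> \<le>\<^sub>c \<nu>}. transport_cost \<theta> \<mu> \<eta>)"

text \<open>
  Used only on \<open>prob_moment \<rho>\<close>, where the infimum is finite, so that \<open>real_of_ereal\<close>
  loses nothing.
\<close>

definition wasserstein_dist ::
    "real \<Rightarrow> 'a::euclidean_space measure \<Rightarrow> 'a measure \<Rightarrow> real" where
  "wasserstein_dist \<rho> \<mu> \<nu> =
     real_of_ereal (transport_cost (\<lambda>z. norm z powr \<rho>) \<mu> \<nu>) powr (1 / \<rho>)"

definition wasserstein_tendsto ::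
    "real \<Rightarrow> (nat \<Rightarrow> 'a::euclidean_space measure) \<Rightarrow> 'a measure \<Rightarrow> bool" where
  "wasserstein_tendsto \<rho> \<mu>s \<mu> \<longleftrightarrow>
     (\<forall>k. \<mu>s k \<in> prob_moment \<rho>) \<and> \<mu> \<in> prob_moment \<rho> \<and>
     (\<lambda>k. wasserstein_dist \<rho> (\<mu>s k) \<mu>) \<longlonglongrightarrow> 0"

definition strictly_convex :: "('a::real_vector \<Rightarrow> real) \<Rightarrow> bool" where
  "strictly_convex f \<longleftrightarrow>
     (\<forall>x y t. x \<noteq> y \<longrightarrow> 0 < t \<longrightarrow> t < 1 \<longrightarrow>
        f ((1 - t) *\<^sub>R x + t *\<^sub>R y) < (1 - t) * f x + t * f y)"

definition optimal_map ::
    "('a::euclidean_space \<Rightarrow> real) \<Rightarrow> 'a measure \<Rightarrow> 'a measure \<Rightarrow> ('a \<Rightarrow> 'a) \<Rightarrow> bool" where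
  "optimal_map \<theta> \<mu> \<nu> T \<longleftrightarrow>
     T \<in> borel_measurable borel \<and> distr \<mu> borel T \<le>\<^sub>c \<nu> \<and>
     weak_transport_cost \<theta> \<mu> \<nu> = transport_cost \<theta> \<mu> (distr \<mu> borel T) \<and>
     transport_cost \<theta> \<mu> (distr \<mu> borel T) = ext_integral \<mu> (\<lambda>x. \<theta> (x - T x))"

definition ex_AE_unique :: "'b measure \<Rightarrow> (('b \<Rightarrow> 'c) \<Rightarrow> bool) \<Rightarrow> bool" where
  "ex_AE_unique M P \<longleftrightarrow>
     (\<exists>T. P T) \<and> (\<forall>T T'. P T \<longrightarrow> P T' \<longrightarrow> (AE x in M. T x = T' x))"

definition tendsto_in_prob ::
    "'b measure \<Rightarrow> (nat \<Rightarrow> 'b \<Rightarrow> 'c::metric_space) \<Rightarrow> ('b \<Rightarrow> 'c) \<Rightarrow> bool" where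
  "tendsto_in_prob M Ts T \<longleftrightarrow>
     (\<forall>\<epsilon>>0. (\<lambda>k. measure M {x \<in> space M. dist (Ts k x) (T x) > \<epsilon>}) \<longlonglongrightarrow> 0)"

end

theory Submission
  imports Defs
begin

text \<open>
  Since the cost is convex, replacing a coupling by its barycentric projection lowers the cost and
  preserves the order constraint, so \<open>V\<close> is an infimum over maps \<open>T\<close> with \<open>T(\<mu>) \<le>\<^sub>c \<nu>\<close>. The key step
  turns a map that is nearly optimal for \<open>(\<mu>, \<nu>)\<close> into one that is nearly optimal for nearby data
  \<open>(\<mu>', \<nu>')\<close>, with an error that only depends on moduli of uniform integrability: average \<open>T\<close> over
  finitely many cells of mass bounded below; realise the resulting finitely supported law by
  martingale weights on \<open>\<nu>\<close> (an approximate Strassen theorem, obtained from the first order condition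
  for a least squares problem); and push these weights along a coupling of \<open>\<nu>\<close> and \<open>\<nu>'\<close>. Applied in
  both directions this gives convergence of the values without any compactness of sets of measures.

  If the cost is strictly convex, the midpoint of two nearly optimal competitors is a competitor, so
  the two must be close in probability. This one estimate yields existence of an optimal map (nearly
  optimal maps are Cauchy in probability), its uniqueness, the uniqueness of the minimizing measure,
  and the convergence of minimizers and optimal maps.
\<close>

section \<open>Convex functions and the convex order\<close>

text \<open>The first obstacle is a mismatch of growth: \<open>\<theta>\<close> may grow like the
  power \<rho>, while \<nu> has only a first moment, so the cost of a map \<open>T\<close> need not
  react continuously to a small mean perturbation of \<open>T\<close>. After averaging, the map
  takes values in a fixed ball, and the growth is charged to \<mu> alone. Second, moving an averaged
  value y_i towards \<nu>' costs the transport error divided by the mass of its cell, hence the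
  lower bound on masses. Third, the lower bound for the values starts from the k-th data and
  perturbs towards the limit, so the admissible distance \<delta> must be fixed before the data;
  this is why all constants are functions of the moduli. An approximate Strassen theorem is enough
  because its error, like the transport, only displaces the finitely many values y_i a little.
  Competitors are pairs of random variables on an arbitrary space, because maps defined for
  different first marginals can only be compared on a coupling.\<close>

lemma convex_subgradient:
  fixes \<phi> :: "'a::euclidean_space \<Rightarrow> real"
  assumes "convex_on UNIV \<phi>"
  obtains g where "\<And>y. \<phi> x + g \<bullet> (y - x) \<le> \<phi> y"
proof -
  \<comment> \<open>A hyperplane separates the open ray below \<open>(x, \<phi> x)\<close> from the
    epigraph. It is not vertical, since a vertical one would make a nonzero linear form bounded
    below on the whole space; its slope is the subgradient.\<close>
  define S where "S = {x} \<times> {..<\<phi> x}"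
  define E where "E = epigraph UNIV \<phi>"
  have "convex S" "convex E" "S \<noteq> {}" "E \<noteq> {}" "S \<inter> E = {}"
    using assms by (auto simp: S_def E_def convex_Times convex_epigraphI) (auto simp: epigraph_def intro: lt_ex)
  then obtain a b where a: "a \<noteq> 0" "\<And>p. p \<in> S \<Longrightarrow> a \<bullet> p \<le> b" "\<And>p. p \<in> E \<Longrightarrow> b \<le> a \<bullet> p"
    using separating_hyperplane_sets[of S E] by metis
  obtain u v where uv: "a = (u, v)" by force
  have S: "u \<bullet> x + v * t \<le> b" if "t < \<phi> x" for t
    using a(2)[of "(x, t)"] that by (simp add: S_def uv)
  have E: "b \<le> u \<bullet> y + v * \<phi> y" for y
    using a(3)[of "(y, \<phi> y)"] by (simp add: E_def uv epigraph_def)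
  have "v \<ge> 0" using S[of "\<phi> x - 1"] E[of x] by (simp add: algebra_simps)
  moreover have "v \<noteq> 0"
  proof
    assume v: "v = 0"
    have "u \<bullet> x \<le> u \<bullet> y" for y
      using S[of "\<phi> x - 1"] E[of y] v by simp
    from this[of "x - u"] have "u \<bullet> u \<le> 0" by (simp add: inner_diff_right)
    moreover have "u \<noteq> 0" using a(1) uv v by (simp add: zero_prod_def)
    then have "0 < u \<bullet> u" by simp
    ultimately show False by linarith
  qed
  ultimately have v: "v > 0" by simp
  have le: "u \<bullet> x + v * \<phi> x \<le> b"
  proof (rule field_le_epsilon)
    fix e :: real assume "e > 0"
    then show "u \<bullet> x + v * \<phi> x \<le> b + e"
      using S[of "\<phi> x - e / v"] v by (simp add: right_diff_distrib)
  qed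
  have "\<phi> x + (- (1 / v) *\<^sub>R u) \<bullet> (y - x) \<le> \<phi> y" for y
    using E[of y] le v by (simp add: field_simps inner_diff_right)
  then show ?thesis using that by blast
qed

lemma convex_affine_minorant:
  fixes \<phi> :: "'a::euclidean_space \<Rightarrow> real"
  assumes "convex_on UNIV \<phi>"
  obtains \<alpha> \<beta> where "\<And>y. \<alpha> + \<beta> \<bullet> y \<le> \<phi> y"
  using convex_subgradient[OF assms, of 0] by (metis diff_zero)

text \<open>From below the growth is linear, whatever the growth from above; this keeps negative
  parts integrable under first moments.\<close>

lemma convex_lower_bound:
  fixes \<phi> :: "'a::euclidean_space \<Rightarrow> real"
  assumes "convex_on UNIV \<phi>"
  obtains a where "a \<ge> 0" "\<And>y. - \<phi> y \<le> a * (1 + norm y)"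
proof -
  obtain \<alpha> \<beta> where ab: "\<And>y. \<alpha> + \<beta> \<bullet> y \<le> \<phi> y" using convex_affine_minorant[OF assms] by blast
  have "- \<phi> y \<le> (\<bar>\<alpha>\<bar> + norm \<beta>) * (1 + norm y)" for y
  proof -
    have "- \<phi> y \<le> \<bar>\<alpha>\<bar> + norm \<beta> * norm y"
      using ab[of y] Cauchy_Schwarz_ineq2[of \<beta> y] by linarith
    also have "\<dots> \<le> (\<bar>\<alpha>\<bar> + norm \<beta>) * (1 + norm y)" by (simp add: algebra_simps)
    finally show ?thesis .
  qed
  then show ?thesis using that[of "\<bar>\<alpha>\<bar> + norm \<beta>"] by simp
qed

lemma convex_continuous_UNIV:
  fixes \<phi> :: "'a::euclidean_space \<Rightarrow> real"
  shows "convex_on UNIV \<phi> \<Longrightarrow> continuous_on UNIV \<phi>"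
  by (rule convex_on_continuous) auto

lemma convex_borel_measurable:
  fixes \<phi> :: "'a::euclidean_space \<Rightarrow> real"
  shows "convex_on UNIV \<phi> \<Longrightarrow> \<phi> \<in> borel_measurable borel"
  by (intro borel_measurable_continuous_onI convex_continuous_UNIV)

lemma convex_on_max:
  assumes "convex_on S f" "convex_on S g"
  shows "convex_on S (\<lambda>x. max (f x) (g x :: real))"
proof (rule convex_onI)
  fix t x y assume t: "0 < (t::real)" "t < 1" and S: "x \<in> S" "y \<in> S"
  have "f ((1 - t) *\<^sub>R x + t *\<^sub>R y) \<le> (1 - t) * f x + t * f y"
    "g ((1 - t) *\<^sub>R x + t *\<^sub>R y) \<le> (1 - t) * g x + t * g y"
    using assms t S by (auto intro!: convex_onD)
  moreover have "(1 - t) * f x + t * f y \<le> (1 - t) * max (f x) (g x) + t * max (f y) (g y)"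
    "(1 - t) * g x + t * g y \<le> (1 - t) * max (f x) (g x) + t * max (f y) (g y)"
    using t by (auto intro!: add_mono mult_left_mono)
  ultimately show "max (f ((1 - t) *\<^sub>R x + t *\<^sub>R y)) (g ((1 - t) *\<^sub>R x + t *\<^sub>R y))
      \<le> (1 - t) * max (f x) (g x) + t * max (f y) (g y)" by linarith
qed (use assms convex_on_imp_convex in auto)

text \<open>These are the test functions on which the approximate Strassen theorem relies.\<close>

lemma convex_on_Max_affine:
  fixes L :: "'i \<Rightarrow> 'a::real_inner"
  assumes "finite I" "I \<noteq> {}"
  shows "convex_on UNIV (\<lambda>x. Max ((\<lambda>i. \<alpha> i + L i \<bullet> x) ` I))"
  using assms
proof (induction rule: finite_ne_induct)
  case (singleton i)
  then show ?case by (auto intro!: convex_onI simp: algebra_simps inner_add_right)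
next
  case (insert i I)
  have "convex_on UNIV (\<lambda>x. max (\<alpha> i + L i \<bullet> x) (Max ((\<lambda>i. \<alpha> i + L i \<bullet> x) ` I)))"
    by (rule convex_on_max[OF _ insert(4)]) (auto intro!: convex_onI simp: algebra_simps inner_add_right)
  then show ?case using insert by simp
qed

text \<open>As a convex test function, the excess over a level lets moduli of uniform integrability
  pass down the convex order.\<close>

lemma convex_on_norm_excess: "convex_on UNIV (\<lambda>x::'a::real_normed_vector. max 0 (norm x - B))"
  using convex_on_dist[of UNIV "0::'a"]
  by (intro convex_on_max convex_on_diff) (auto simp: convex_on_const concave_on_def)

lemma convex_on_midpoint:
  assumes "convex_on UNIV \<phi>"
  shows "\<phi> ((1/2) *\<^sub>R (x + y)) \<le> (\<phi> x + \<phi> y) / 2"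
  using convex_onD[OF assms, of "1/2" x y] by (simp add: algebra_simps)

section \<open>Integrals with values in the extended reals, and first moments\<close>

lemma integrable_of_neg_part:
  fixes f :: "'b \<Rightarrow> real"
  assumes [measurable]: "f \<in> borel_measurable M"
    and "(\<integral>\<^sup>+ x. ennreal (- f x) \<partial>M) < \<infinity>" "(\<integral>\<^sup>+ x. ennreal (f x) \<partial>M) < \<infinity>"
  shows "integrable M f"
  using assms by (simp add: real_integrable_def less_top)

lemma neg_part_finite:
  fixes f g :: "'b \<Rightarrow> real"
  assumes "integrable M g" "\<And>x. x \<in> space M \<Longrightarrow> g x \<le> f x"
  shows "(\<integral>\<^sup>+ x. ennreal (- f x) \<partial>M) < \<infinity>"
proof -
  have "(\<integral>\<^sup>+ x. ennreal (- f x) \<partial>M) \<le> (\<integral>\<^sup>+ x. ennreal (- g x) \<partial>M)"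
    using assms(2) by (intro nn_integral_mono) (auto intro!: ennreal_leI)
  also have "\<dots> < \<infinity>" using assms(1) by (simp add: real_integrable_def less_top)
  finally show ?thesis .
qed

lemma ext_integral_integrable:
  assumes "integrable M f"
  shows "ext_integral M f = ereal (\<integral>x. f x \<partial>M)"
proof -
  have "(\<integral>\<^sup>+ x. ennreal (f x) \<partial>M) < \<infinity>" "(\<integral>\<^sup>+ x. ennreal (- f x) \<partial>M) < \<infinity>"
    using assms by (simp_all add: real_integrable_def less_top)
  then obtain p q where p: "(\<integral>\<^sup>+ x. ennreal (f x) \<partial>M) = ennreal p" "p \<ge> 0"
    and q: "(\<integral>\<^sup>+ x. ennreal (- f x) \<partial>M) = ennreal q" "q \<ge> 0"
    by (metis ennreal_cases infinity_ennreal_def less_irrefl)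
  show ?thesis
    unfolding ext_integral_def real_lebesgue_integral_def[OF assms] p(1) q(1) using p(2) q(2) by simp
qed

text \<open>Once the negative part is finite, failure of integrability can only come from an
  infinite positive part, so the indeterminate difference is excluded.\<close>

lemma ext_integral_not_integrable:
  assumes "f \<in> borel_measurable M" "(\<integral>\<^sup>+ x. ennreal (- f x) \<partial>M) < \<infinity>" "\<not> integrable M f"
  shows "ext_integral M f = \<infinity>"
proof -
  have *: "(\<integral>\<^sup>+ x. ennreal (f x) \<partial>M) = top"
    using integrable_of_neg_part[OF assms(1,2)] assms(3) by (auto simp: less_top[symmetric])
  obtain q where q: "(\<integral>\<^sup>+ x. ennreal (- f x) \<partial>M) = ennreal q" "q \<ge> 0"
    using assms(2) by (metis ennreal_cases infinity_ennreal_def less_irrefl)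
  then show ?thesis
    unfolding ext_integral_def * q(1) by simp
qed

lemma prob_moment_1_iff:
  "M \<in> prob_moment 1 \<longleftrightarrow> prob_space M \<and> sets M = sets borel \<and> integrable M (\<lambda>x. x)"
proof -
  have "integrable M (\<lambda>x. norm x) = integrable M (\<lambda>x::'a. x)" if "sets M = sets borel"
  proof (rule integrable_norm_iff)
    show "(\<lambda>x. x) \<in> borel_measurable M" using that measurable_ident_sets by blast
  qed
  then show ?thesis by (auto simp: prob_moment_def)
qed

lemma le_1_powr:
  fixes t :: real
  assumes "t \<ge> 0" "\<rho> \<ge> 1"
  shows "t \<le> 1 + t powr \<rho>"
proof (cases "t \<le> 1")
  case False
  then show ?thesis using powr_mono[of 1 \<rho> t] assms by simp
qed (use powr_ge_zero[of t \<rho>] in linarith)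

lemma prob_moment_1:
  assumes "M \<in> prob_moment \<rho>" "\<rho> \<ge> 1"
  shows "M \<in> prob_moment 1"
proof -
  have M: "prob_space M" "sets M = sets borel" "integrable M (\<lambda>x. norm x powr \<rho>)"
    using assms by (auto simp: prob_moment_def)
  interpret prob_space M by fact
  have "integrable M (\<lambda>x. x)"
  proof (rule Bochner_Integration.integrable_bound)
    show "integrable M (\<lambda>x. 1 + norm x powr \<rho>)" using M by auto
    show "(\<lambda>x. x) \<in> borel_measurable M" using M(2) measurable_ident_sets by blast
    show "AE x in M. norm x \<le> norm (1 + norm x powr \<rho>)"
      using le_1_powr[OF norm_ge_zero assms(2)] by (intro AE_I2) (simp add: order_trans[OF _ abs_ge_self])
  qed
  then show ?thesis using M by (simp add: prob_moment_1_iff)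
qed

lemma convex_neg_part_finite:
  fixes \<phi> :: "'a::euclidean_space \<Rightarrow> real"
  assumes "convex_on UNIV \<phi>" "finite_measure M" "integrable M X"
  shows "(\<integral>\<^sup>+ x. ennreal (- \<phi> (X x)) \<partial>M) < \<infinity>"
proof -
  obtain \<alpha> \<beta> where ab: "\<And>y. \<alpha> + \<beta> \<bullet> y \<le> \<phi> y" using convex_affine_minorant[OF assms(1)] by blast
  interpret finite_measure M by fact
  show ?thesis
    by (rule neg_part_finite[of _ "\<lambda>x. \<alpha> + \<beta> \<bullet> X x"]) (use ab assms(3) in auto)
qed

text \<open>For a nonnegative integrand the subtracted part of \<open>ext_integral\<close> vanishes,
  so the order becomes an inequality between nonnegative integrals, and integrability never has to
  be discussed.\<close>

lemma convex_order_nn: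
  assumes "\<eta> \<le>\<^sub>c \<nu>" "convex_on UNIV \<phi>" "\<And>x. 0 \<le> \<phi> x"
  shows "(\<integral>\<^sup>+ x. ennreal (\<phi> x) \<partial>\<eta>) \<le> (\<integral>\<^sup>+ x. ennreal (\<phi> x) \<partial>\<nu>)"
proof -
  have "ext_integral \<eta> \<phi> \<le> ext_integral \<nu> \<phi>" using assms by (simp add: convex_order_def)
  moreover have "ennreal (- \<phi> x) = 0" for x using assms(3) by (simp add: ennreal_neg)
  ultimately have "enn2ereal (\<integral>\<^sup>+ x. ennreal (\<phi> x) \<partial>\<eta>) - 0 \<le> enn2ereal (\<integral>\<^sup>+ x. ennreal (\<phi> x) \<partial>\<nu>) - 0"
    unfolding ext_integral_def by (simp only: nn_integral_const mult_zero_left zero_ennreal.rep_eq)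
  then show ?thesis by (simp add: less_eq_ennreal.rep_eq)
qed

lemma convex_order_integral:
  assumes "\<eta> \<le>\<^sub>c \<nu>" "convex_on UNIV \<phi>" "integrable \<nu> \<phi>"
  shows "integrable \<eta> \<phi>" "(\<integral>x. \<phi> x \<partial>\<eta>) \<le> (\<integral>x. \<phi> x \<partial>\<nu>)"
proof -
  have \<eta>: "prob_space \<eta>" "sets \<eta> = sets borel" "integrable \<eta> (\<lambda>x. x)"
    using assms(1) by (auto simp: convex_order_def prob_moment_1_iff)
  have le: "ext_integral \<eta> \<phi> \<le> ext_integral \<nu> \<phi>" using assms by (simp add: convex_order_def)
  interpret prob_space \<eta> by fact
  have m: "\<phi> \<in> borel_measurable \<eta>"
    using convex_borel_measurable[OF assms(2)] measurable_cong_sets[OF \<eta>(2) refl] by blast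
  show *: "integrable \<eta> \<phi>"
    using ext_integral_not_integrable[OF m convex_neg_part_finite[OF assms(2) _ \<eta>(3)]] le
    by (force simp: ext_integral_integrable[OF assms(3)] finite_measure_axioms)
  show "(\<integral>x. \<phi> x \<partial>\<eta>) \<le> (\<integral>x. \<phi> x \<partial>\<nu>)"
    using le by (simp add: ext_integral_integrable[OF assms(3)] ext_integral_integrable[OF *])
qed

text \<open>Bounding \<open>\<phi>\<close> from below by \<open>- n\<close> and shifting it makes it nonnegative.\<close>

lemma convex_orderI:
  fixes \<eta> \<nu> :: "'a::euclidean_space measure"
  assumes \<eta>: "\<eta> \<in> prob_moment 1" and \<nu>: "\<nu> \<in> prob_moment 1"
    and le: "\<And>\<phi>. convex_on UNIV \<phi> \<Longrightarrow> (\<And>x. 0 \<le> \<phi> x) \<Longrightarrow>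
      (\<integral>\<^sup>+ x. ennreal (\<phi> x) \<partial>\<eta>) \<le> (\<integral>\<^sup>+ x. ennreal (\<phi> x) \<partial>\<nu>)"
  shows "\<eta> \<le>\<^sub>c \<nu>"
  unfolding convex_order_def
proof (intro conjI allI impI)
  fix \<phi> :: "'a \<Rightarrow> real" assume \<phi>: "convex_on UNIV \<phi>"
  interpret \<eta>: prob_space \<eta> using \<eta> by (simp add: prob_moment_1_iff)
  interpret \<nu>: prob_space \<nu> using \<nu> by (simp add: prob_moment_1_iff)
  have [measurable_cong]: "sets \<eta> = sets borel" "sets \<nu> = sets borel"
    using \<eta> \<nu> by (simp_all add: prob_moment_1_iff)
  have i: "integrable \<eta> (\<lambda>x. x)" "integrable \<nu> (\<lambda>x. x)" using \<eta> \<nu> by (simp_all add: prob_moment_1_iff)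
  have [measurable]: "\<phi> \<in> borel_measurable borel" using convex_borel_measurable[OF \<phi>] .
  show "ext_integral \<eta> \<phi> \<le> ext_integral \<nu> \<phi>"
  proof (cases "integrable \<nu> \<phi>")
    case False
    then show ?thesis
      using ext_integral_not_integrable[OF _ convex_neg_part_finite[OF \<phi> _ i(2)]]
      by (simp add: \<nu>.finite_measure_axioms)
  next
    case True
    have *: "integrable \<eta> (\<lambda>x. max (\<phi> x) (- real n)) \<and>
        (\<integral>x. max (\<phi> x) (- real n) \<partial>\<eta>) \<le> (\<integral>x. max (\<phi> x) (- real n) \<partial>\<nu>)" for n
    proof -
      define \<psi> where "\<psi> x = max (\<phi> x) (- real n) + real n" for x
      have [measurable]: "\<psi> \<in> borel_measurable borel" unfolding \<psi>_def by measurable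
      have c: "convex_on UNIV \<psi>"
        unfolding \<psi>_def using \<phi> by (intro convex_on_add convex_on_max) (auto simp: convex_on_const)
      have p: "\<psi> x \<ge> 0" for x by (auto simp: \<psi>_def)
      have i\<nu>: "integrable \<nu> \<psi>" unfolding \<psi>_def using True by auto
      have "(\<integral>\<^sup>+ x. ennreal (\<psi> x) \<partial>\<eta>) \<le> ennreal (\<integral>x. \<psi> x \<partial>\<nu>)"
        using le[OF c p] nn_integral_eq_integral[OF i\<nu>] p by simp
      moreover from this have i\<eta>: "integrable \<eta> \<psi>"
        using p by (intro integrableI_nonneg) (auto simp: less_top[symmetric] top_unique)
      ultimately have "(\<integral>x. \<psi> x \<partial>\<eta>) \<le> (\<integral>x. \<psi> x \<partial>\<nu>)"
        using nn_integral_eq_integral[OF i\<eta>] p by (simp add: integral_nonneg_AE)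
      moreover have m: "integrable \<eta> (\<lambda>x. max (\<phi> x) (- real n))"
        using Bochner_Integration.integrable_diff[OF i\<eta>, of "\<lambda>_. real n"] by (simp add: \<psi>_def)
      ultimately show ?thesis
        using True by (simp add: \<psi>_def \<eta>.prob_space \<nu>.prob_space)
    qed
    have i\<eta>: "integrable \<eta> \<phi>"
    proof (rule integrable_of_neg_part)
      show "(\<integral>\<^sup>+ x. ennreal (- \<phi> x) \<partial>\<eta>) < \<infinity>"
        using convex_neg_part_finite[OF \<phi> _ i(1)] by (simp add: \<eta>.finite_measure_axioms)
      have "(\<integral>\<^sup>+ x. ennreal (\<phi> x) \<partial>\<eta>) \<le> (\<integral>\<^sup>+ x. ennreal (max (\<phi> x) 0) \<partial>\<eta>)"
        by (intro nn_integral_mono ennreal_leI) auto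
      also have "\<dots> < \<infinity>"
        using *[of 0] by (simp add: real_integrable_def less_top)
      finally show "(\<integral>\<^sup>+ x. ennreal (\<phi> x) \<partial>\<eta>) < \<infinity>" .
    qed auto
    have "(\<lambda>n. \<integral>x. max (\<phi> x) (- real n) \<partial>\<nu>) \<longlonglongrightarrow> (\<integral>x. \<phi> x \<partial>\<nu>)"
    proof (rule integral_dominated_convergence[where w="\<lambda>x. \<bar>\<phi> x\<bar>"])
      show "AE x in \<nu>. (\<lambda>n. max (\<phi> x) (- real n)) \<longlonglongrightarrow> \<phi> x"
      proof (intro AE_I2 tendsto_eventually)
        fix x
        obtain N where "- \<phi> x \<le> real N" using real_arch_simple by blast
        then show "\<forall>\<^sub>F n in sequentially. max (\<phi> x) (- real n) = \<phi> x"
          by (intro eventually_sequentiallyI[of N]) auto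
      qed
    qed (use True in auto)
    \<comment> \<open>No limit is taken under \<eta>: there \<phi> is simply dominated by its
      truncations.\<close>
    moreover have "(\<integral>x. \<phi> x \<partial>\<eta>) \<le> (\<integral>x. max (\<phi> x) (- real n) \<partial>\<nu>)" for n
    proof -
      have "(\<integral>x. \<phi> x \<partial>\<eta>) \<le> (\<integral>x. max (\<phi> x) (- real n) \<partial>\<eta>)"
        using i\<eta> * by (intro integral_mono) auto
      then show ?thesis using *[of n] by linarith
    qed
    ultimately have "(\<integral>x. \<phi> x \<partial>\<eta>) \<le> (\<integral>x. \<phi> x \<partial>\<nu>)"
      by (intro LIMSEQ_le_const) auto
    then show ?thesis by (simp add: ext_integral_integrable True i\<eta>)
  qed
qed (use assms in auto)

section \<open>The convex order for laws of random variables\<close>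

lemma prob_moment_distr:
  fixes X :: "'b \<Rightarrow> 'a::euclidean_space"
  assumes "prob_space M" "integrable M X"
  shows "distr M borel X \<in> prob_moment 1"
  using assms by (auto simp: prob_moment_1_iff integrable_distr_eq intro!: prob_space.prob_space_distr)

text \<open>Stated for a random variable on any space, since competitors live on couplings as well
  as on the base space.\<close>

lemma convex_order_distrI:
  fixes X :: "'b \<Rightarrow> 'a::euclidean_space"
  assumes "prob_space M" "integrable M X" "\<nu> \<in> prob_moment 1"
    and "\<And>\<phi>. convex_on UNIV \<phi> \<Longrightarrow> (\<And>x. 0 \<le> \<phi> x) \<Longrightarrow>
      (\<integral>\<^sup>+ x. ennreal (\<phi> (X x)) \<partial>M) \<le> (\<integral>\<^sup>+ x. ennreal (\<phi> x) \<partial>\<nu>)"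
  shows "distr M borel X \<le>\<^sub>c \<nu>"
  using assms prob_moment_distr[OF assms(1,2)]
  by (intro convex_orderI) (auto simp: nn_integral_distr convex_borel_measurable borel_measurable_integrable)

lemma convex_order_distrD:
  fixes X :: "'b \<Rightarrow> 'a::euclidean_space"
  assumes "distr M borel X \<le>\<^sub>c \<nu>" "X \<in> borel_measurable M"
  shows "prob_space M" "integrable M X" "\<nu> \<in> prob_moment 1"
    and "convex_on UNIV \<phi> \<Longrightarrow> (\<And>x. 0 \<le> \<phi> x) \<Longrightarrow>
      (\<integral>\<^sup>+ x. ennreal (\<phi> (X x)) \<partial>M) \<le> (\<integral>\<^sup>+ x. ennreal (\<phi> x) \<partial>\<nu>)"
    and "convex_on UNIV \<phi> \<Longrightarrow> integrable \<nu> \<phi> \<Longrightarrow> integrable M (\<lambda>x. \<phi> (X x))"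
    and "convex_on UNIV \<phi> \<Longrightarrow> integrable \<nu> \<phi> \<Longrightarrow> (\<integral>x. \<phi> (X x) \<partial>M) \<le> (\<integral>x. \<phi> x \<partial>\<nu>)"
proof -
  show "prob_space M"
    using assms by (auto simp: convex_order_def prob_moment_1_iff dest: prob_space_distrD)
  show "integrable M X" "\<nu> \<in> prob_moment 1"
    using assms by (auto simp: convex_order_def prob_moment_1_iff integrable_distr_eq)
  show "(\<integral>\<^sup>+ x. ennreal (\<phi> (X x)) \<partial>M) \<le> (\<integral>\<^sup>+ x. ennreal (\<phi> x) \<partial>\<nu>)"
    if "convex_on UNIV \<phi>" "\<And>x. 0 \<le> \<phi> x"
    using convex_order_nn[OF assms(1) that] assms(2) convex_borel_measurable[OF that(1)]
    by (subst (asm) nn_integral_distr) auto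
  show "integrable M (\<lambda>x. \<phi> (X x))" "(\<integral>x. \<phi> (X x) \<partial>M) \<le> (\<integral>x. \<phi> x \<partial>\<nu>)"
    if "convex_on UNIV \<phi>" "integrable \<nu> \<phi>"
    using convex_order_integral[OF assms(1) that] assms(2)
    by (simp_all add: integrable_distr_eq integral_distr convex_borel_measurable[OF that(1)])
qed

section \<open>Jensen's inequality and barycenters\<close>

text \<open>Integrate the supporting affine function at the weighted mean against \<open>h\<close>;
  its linear part cancels there. A weight of mass \<open>p\<close> instead of a probability measure
  fits both the cells of a map and the martingale weights.\<close>

lemma jensen_weighted:
  fixes v :: "'b \<Rightarrow> 'a::euclidean_space" and \<phi> :: "'a \<Rightarrow> real"
  assumes \<phi>: "convex_on UNIV \<phi>" and h: "integrable M h" "\<And>x. 0 \<le> h x" "(\<integral>x. h x \<partial>M) = p" "0 < p"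
    and v: "integrable M (\<lambda>x. h x *\<^sub>R v x)" and i: "integrable M (\<lambda>x. h x * \<phi> (v x))"
  shows "p * \<phi> ((1 / p) *\<^sub>R (\<integral>x. h x *\<^sub>R v x \<partial>M)) \<le> (\<integral>x. h x * \<phi> (v x) \<partial>M)"
proof -
  define m where "m = (1 / p) *\<^sub>R (\<integral>x. h x *\<^sub>R v x \<partial>M)"
  obtain g where g: "\<And>y. \<phi> m + g \<bullet> (y - m) \<le> \<phi> y" using convex_subgradient[OF \<phi>] by blast
  have i2: "integrable M (\<lambda>x. (\<phi> m - g \<bullet> m) * h x + g \<bullet> (h x *\<^sub>R v x))"
    using h(1) v by (intro Bochner_Integration.integrable_add integrable_inner_right) auto
  have "(\<integral>x. (\<phi> m - g \<bullet> m) * h x + g \<bullet> (h x *\<^sub>R v x) \<partial>M) = (\<phi> m - g \<bullet> m) * p + g \<bullet> (\<integral>x. h x *\<^sub>R v x \<partial>M)"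
    using h v by (subst Bochner_Integration.integral_add) (auto simp del: inner_scaleR_right)
  also have "\<dots> = p * \<phi> m"
    using h(4) by (simp add: m_def field_simps)
  finally have "p * \<phi> m = (\<integral>x. (\<phi> m - g \<bullet> m) * h x + g \<bullet> (h x *\<^sub>R v x) \<partial>M)" by simp
  also have "\<dots> \<le> (\<integral>x. h x * \<phi> (v x) \<partial>M)"
  proof (rule integral_mono[OF i2 i])
    fix x
    show "(\<phi> m - g \<bullet> m) * h x + g \<bullet> (h x *\<^sub>R v x) \<le> h x * \<phi> (v x)"
      using mult_left_mono[OF g[of "v x"] h(2)[of x]] by (simp add: algebra_simps)
  qed
  finally show ?thesis by (simp add: m_def)
qed

text \<open>An infinite right side is trivial, and a finite one gives the integrability that the
  real version asks for.\<close>

lemma jensen_weighted_nn: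
  fixes v :: "'b \<Rightarrow> 'a::euclidean_space" and \<phi> :: "'a \<Rightarrow> real"
  assumes \<phi>: "convex_on UNIV \<phi>" "\<And>x. 0 \<le> \<phi> x"
    and h: "integrable M h" "\<And>x. 0 \<le> h x" "(\<integral>x. h x \<partial>M) = p" "0 < p"
    and v: "integrable M (\<lambda>x. h x *\<^sub>R v x)" "v \<in> borel_measurable M"
  shows "ennreal (p * \<phi> ((1 / p) *\<^sub>R (\<integral>x. h x *\<^sub>R v x \<partial>M))) \<le> (\<integral>\<^sup>+x. ennreal (h x * \<phi> (v x)) \<partial>M)"
proof (cases "(\<integral>\<^sup>+x. ennreal (h x * \<phi> (v x)) \<partial>M) = \<infinity>")
  case False
  have [measurable]: "\<phi> \<in> borel_measurable borel" "h \<in> borel_measurable M" "v \<in> borel_measurable M"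
    using convex_borel_measurable[OF \<phi>(1)] h v by auto
  have i: "integrable M (\<lambda>x. h x * \<phi> (v x))"
    using False by (intro integrableI_nonneg) (auto simp: \<phi> h less_top)
  show ?thesis
    using jensen_weighted[OF \<phi>(1) h v(1) i] nn_integral_eq_integral[OF i] \<phi>(2) h(2) by (simp add: ennreal_leI)
qed simp

text \<open>Almost sure comparison is available for countably many affine minorants only. Reflection
  makes a dense set sufficient: the subgradient at \<open>d\<close>, tested at
  \<open>2 d - v\<close>, bounds its affine function at \<open>v\<close> from below by
  \<open>2 \<phi> d - \<phi> (2 d - v)\<close>, which is continuous in \<open>d\<close> and equals
  \<open>\<phi> v\<close> at \<open>d = v\<close>. This replaces a local bound on the
  subgradients.\<close>

lemma convex_le_of_dense_subgradients:
  fixes \<phi> :: "'a::euclidean_space \<Rightarrow> real"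
  assumes \<phi>: "convex_on UNIV \<phi>" and D: "\<And>X. open X \<Longrightarrow> X \<noteq> {} \<Longrightarrow> \<exists>d\<in>D. d \<in> X"
    and g: "\<And>d y. \<phi> d + g d \<bullet> (y - d) \<le> \<phi> y"
    and le: "\<And>d. d \<in> D \<Longrightarrow> \<phi> d + g d \<bullet> (v - d) \<le> t"
  shows "\<phi> v \<le> t"
proof (rule ccontr)
  assume "\<not> \<phi> v \<le> t"
  define X where "X = {w. t < 2 * \<phi> w - \<phi> (2 *\<^sub>R w - v)}"
  have "continuous_on UNIV (\<lambda>w. 2 * \<phi> w - \<phi> (2 *\<^sub>R w - v))"
    using convex_continuous_UNIV[OF \<phi>]
    by (intro continuous_intros) (auto intro!: continuous_on_compose2[of UNIV \<phi>] continuous_intros)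
  then have "open X" unfolding X_def by (intro open_Collect_less) auto
  moreover have "v \<in> X" using \<open>\<not> \<phi> v \<le> t\<close> by (simp add: X_def scaleR_2)
  ultimately obtain d where d: "d \<in> D" "d \<in> X" using D[of X] by blast
  have "\<phi> d + g d \<bullet> (2 *\<^sub>R d - v - d) \<le> \<phi> (2 *\<^sub>R d - v)" by (rule g)
  then have "\<phi> d - g d \<bullet> (v - d) \<le> \<phi> (2 *\<^sub>R d - v)" by (simp add: scaleR_2 inner_diff_right)
  then show False using le[OF d(1)] d(2) by (simp add: X_def)
qed

text \<open>\<open>T\<close> is the conditional mean of the second coordinate given the first. The
  form \<open>h (fst p) + s *\<^sub>R snd p\<close> serves two uses: \<open>h\<close> the identity
  with \<open>s = -1\<close> for the cost, and \<open>h = 0\<close> with \<open>s = 1\<close> for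
  the convex order.\<close>

lemma barycenter:
  fixes \<pi> :: "('a::euclidean_space \<times> 'a) measure"
  assumes "prob_space \<pi>" and sets_\<pi>: "sets \<pi> = sets borel" and y: "integrable \<pi> snd"
  obtains T :: "'a \<Rightarrow> 'a" where "T \<in> borel_measurable borel" "integrable \<pi> (\<lambda>p. T (fst p))"
    "\<And>\<phi> h s. convex_on UNIV \<phi> \<Longrightarrow> h \<in> borel_measurable borel \<Longrightarrow> integrable \<pi> (\<lambda>p. h (fst p)) \<Longrightarrow>
       integrable \<pi> (\<lambda>p. \<phi> (h (fst p) + s *\<^sub>R snd p)) \<Longrightarrow>
       integrable \<pi> (\<lambda>p. \<phi> (h (fst p) + s *\<^sub>R T (fst p))) \<and>
       (\<integral>p. \<phi> (h (fst p) + s *\<^sub>R T (fst p)) \<partial>\<pi>) \<le> (\<integral>p. \<phi> (h (fst p) + s *\<^sub>R snd p) \<partial>\<pi>)"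
proof -
  interpret prob_space \<pi> by fact
  note [measurable_cong] = sets_\<pi>
  have sp: "space \<pi> = UNIV" using sets_eq_imp_space_eq[OF sets_\<pi>] by simp
  define F :: "('a \<times> 'a) measure" where "F = vimage_algebra UNIV fst (borel :: 'a measure)"
  have sF: "space F = UNIV" by (simp add: F_def)
  have setsF: "sets F = {fst -` A | A. A \<in> sets borel}"
    unfolding F_def by (subst sets_vimage_algebra2) auto
  have "fst -` A \<in> sets (borel :: ('a \<times> 'a) measure)" if "A \<in> sets borel" for A :: "'a set"
    using measurable_sets[OF borel_measurable_continuous_onI[OF continuous_on_fst[OF continuous_on_id]] that] by simp
  then have sub: "subalgebra \<pi> F"
    unfolding subalgebra_def sF sp setsF sets_\<pi> by auto
  interpret F: sigma_finite_subalgebra \<pi> F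
    using sub finite_measure_axioms
    by (intro finite_measure_subalgebra_is_sigma_finite) (simp add: finite_measure_subalgebra_def finite_measure_subalgebra_axioms_def)
  have fstF[measurable]: "fst \<in> measurable F borel"
    unfolding F_def by (rule measurable_vimage_algebra1) auto
  \<comment> \<open>Sets in \<open>F\<close> are cylinders over the first factor, so level sets of
    an \<open>F\<close>-measurable function are invariant in the second coordinate; 0 is an
    arbitrary representative.\<close>
  have const: "f p = f (fst p, 0)" if "f \<in> borel_measurable F" for f :: "'a \<times> 'a \<Rightarrow> real" and p
  proof -
    have "f -` {f p} \<inter> space F \<in> sets F" using that by measurable
    then obtain A where "f -` {f p} = fst -` A" unfolding setsF sF by auto
    moreover have "p \<in> f -` {f p}" by simp
    ultimately have "(fst p, 0) \<in> f -` {f p}" by simp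
    then show ?thesis by simp
  qed
  \<comment> \<open>Conditional expectations are taken coordinatewise and reassembled in
    \<open>T\<close>.\<close>
  define G where "G b = real_cond_exp \<pi> F (\<lambda>p. snd p \<bullet> b)" for b
  have G[measurable]: "G b \<in> borel_measurable F" for b by (simp add: G_def)
  have ib: "integrable \<pi> (\<lambda>p. snd p \<bullet> b)" for b using y by auto
  have iG: "integrable \<pi> (G b)" for b unfolding G_def using ib by (rule F.real_cond_exp_int)
  define T where "T x = (\<Sum>b\<in>Basis. G b (x, 0) *\<^sub>R b)" for x :: 'a
  have Tfst: "T (fst p) = (\<Sum>b\<in>Basis. G b p *\<^sub>R b)" for p :: "'a \<times> 'a"
    unfolding T_def by (subst const[OF G, symmetric]) simp
  have GM: "G b \<in> borel_measurable borel" for b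
    using measurable_from_subalg[OF sub G] by measurable
  have Tm[measurable]: "T \<in> borel_measurable borel"
    unfolding T_def using measurable_compose[OF _ GM, of "\<lambda>x. (x, 0)" borel]
    by (intro borel_measurable_sum borel_measurable_scaleR) auto
  have iT: "integrable \<pi> (\<lambda>p. T (fst p))"
    unfolding Tfst using iG by auto
  show ?thesis
  proof (rule that[OF Tm iT])
    fix \<phi> :: "'a \<Rightarrow> real" and h :: "'a \<Rightarrow> 'a" and s :: real
    assume \<phi>: "convex_on UNIV \<phi>" and h[measurable]: "h \<in> borel_measurable borel" "integrable \<pi> (\<lambda>p. h (fst p))"
      and i: "integrable \<pi> (\<lambda>p. \<phi> (h (fst p) + s *\<^sub>R snd p))"
    have [measurable]: "\<phi> \<in> borel_measurable borel" using convex_borel_measurable[OF \<phi>] .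
    define W where "W p = h (fst p) + s *\<^sub>R snd p" for p
    define V where "V p = h (fst p) + s *\<^sub>R T (fst p)" for p :: "'a \<times> 'a"
    have iW: "integrable \<pi> W" unfolding W_def using h(2) y by auto
    have iV: "integrable \<pi> V" unfolding V_def using h(2) iT by auto
    \<comment> \<open>Affine functions commute with the conditional expectation: the part depending
      on the first coordinate is \<open>F\<close>-measurable, the rest is a finite combination of
      the \<open>G b\<close>.\<close>
    have cond: "AE p in \<pi>. real_cond_exp \<pi> F (\<lambda>p. c + \<beta> \<bullet> W p) p = c + \<beta> \<bullet> V p" for c \<beta>
    proof -
      define u where "u p = c + \<beta> \<bullet> h (fst p)" for p :: "'a \<times> 'a"
      define w where "w b p = (s * (\<beta> \<bullet> b)) * (snd p \<bullet> b)" for b and p :: "'a \<times> 'a"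
      have iu: "integrable \<pi> u" unfolding u_def using h(2) by auto
      have iw: "integrable \<pi> (w b)" for b unfolding w_def using ib by auto
      have [measurable]: "u \<in> borel_measurable F" unfolding u_def by measurable
      have "AE p in \<pi>. real_cond_exp \<pi> F u p = u p"
        using iu by (rule F.real_cond_exp_F_meas) measurable
      moreover have "AE p in \<pi>. real_cond_exp \<pi> F (\<lambda>p. u p + (\<Sum>b\<in>Basis. w b p)) p
          = real_cond_exp \<pi> F u p + real_cond_exp \<pi> F (\<lambda>p. \<Sum>b\<in>Basis. w b p) p"
        using iu iw by (intro F.real_cond_exp_add) auto
      moreover have "AE p in \<pi>. real_cond_exp \<pi> F (\<lambda>p. \<Sum>b\<in>Basis. w b p) p = (\<Sum>b\<in>Basis. real_cond_exp \<pi> F (w b) p)"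
        using iw by (rule F.real_cond_exp_sum)
      moreover have "AE p in \<pi>. \<forall>b\<in>Basis. real_cond_exp \<pi> F (w b) p = s * (\<beta> \<bullet> b) * G b p"
        unfolding w_def G_def using F.real_cond_exp_cmult[OF ib] by (intro AE_finite_allI) auto
      ultimately have "AE p in \<pi>. real_cond_exp \<pi> F (\<lambda>p. u p + (\<Sum>b\<in>Basis. w b p)) p
          = u p + (\<Sum>b\<in>Basis. s * (\<beta> \<bullet> b) * G b p)"
        by eventually_elim simp
      moreover have "u p + (\<Sum>b\<in>Basis. w b p) = c + \<beta> \<bullet> W p" for p
        unfolding u_def w_def W_def
        by (simp add: inner_add_right euclidean_inner[of \<beta> "snd p"] sum_distrib_left mult.assoc)
      moreover have "u p + (\<Sum>b\<in>Basis. s * (\<beta> \<bullet> b) * G b p) = c + \<beta> \<bullet> V p" for p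
        unfolding u_def V_def Tfst
        by (simp add: inner_add_right inner_sum_right sum_distrib_left mult_ac)
      ultimately show ?thesis by simp
    qed
    define R where "R = real_cond_exp \<pi> F (\<lambda>p. \<phi> (W p))"
    have iR: "integrable \<pi> R" "(\<integral>p. R p \<partial>\<pi>) = (\<integral>p. \<phi> (W p) \<partial>\<pi>)"
      unfolding R_def using i by (auto simp: W_def)
    have "\<forall>d. \<exists>g. \<forall>y. \<phi> d + g \<bullet> (y - d) \<le> \<phi> y"
      using convex_subgradient[OF \<phi>] by blast
    then obtain g where g: "\<And>d y. \<phi> d + g d \<bullet> (y - d) \<le> \<phi> y" by metis
    obtain D :: "'a set" where D: "countable D" "\<And>X. open X \<Longrightarrow> X \<noteq> {} \<Longrightarrow> \<exists>d\<in>D. d \<in> X"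
      using countable_dense_exists by blast
    \<comment> \<open>Conditional Jensen for a single supporting affine function. The exceptional
      null set depends on \<open>d\<close>, hence the countable dense set \<open>D\<close>.\<close>
    have "AE p in \<pi>. \<phi> d + g d \<bullet> (V p - d) \<le> R p" for d
    proof -
      have "AE p in \<pi>. real_cond_exp \<pi> F (\<lambda>p. (\<phi> d - g d \<bullet> d) + g d \<bullet> W p) p \<le> R p"
        unfolding R_def
      proof (intro F.real_cond_exp_mono AE_I2)
        show "\<phi> d - g d \<bullet> d + g d \<bullet> W p \<le> \<phi> (W p)" for p
          using g[of d "W p"] by (simp add: inner_diff_right)
        show "integrable \<pi> (\<lambda>p. \<phi> d - g d \<bullet> d + g d \<bullet> W p)" using iW by auto
        show "integrable \<pi> (\<lambda>p. \<phi> (W p))" using i by (simp add: W_def)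
      qed
      with cond[of "\<phi> d - g d \<bullet> d" "g d"] show ?thesis
        by eventually_elim (simp add: inner_diff_right algebra_simps)
    qed
    then have "AE p in \<pi>. \<forall>d\<in>D. \<phi> d + g d \<bullet> (V p - d) \<le> R p"
      using D(1) by (simp add: AE_ball_countable)
    then have le: "AE p in \<pi>. \<phi> (V p) \<le> R p"
      by eventually_elim (rule convex_le_of_dense_subgradients[OF \<phi> D(2) g], auto)
    \<comment> \<open>The bound is \<open>R\<close> from above and the affine minorant at 0 from
      below.\<close>
    have i\<phi>: "integrable \<pi> (\<lambda>p. \<phi> (V p))"
    proof (rule Bochner_Integration.integrable_bound)
      show "integrable \<pi> (\<lambda>p. \<bar>R p\<bar> + \<bar>\<phi> 0\<bar> + \<bar>g 0 \<bullet> V p\<bar>)" using iR iV by auto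
      show "(\<lambda>p. \<phi> (V p)) \<in> borel_measurable \<pi>"
        by (rule measurable_compose[OF borel_measurable_integrable[OF iV]]) measurable
      show "AE p in \<pi>. norm (\<phi> (V p)) \<le> norm (\<bar>R p\<bar> + \<bar>\<phi> 0\<bar> + \<bar>g 0 \<bullet> V p\<bar>)"
        using le
      proof eventually_elim
        case (elim p)
        then show ?case using g[of 0 "V p"] by simp
      qed
    qed
    show "integrable \<pi> (\<lambda>p. \<phi> (h (fst p) + s *\<^sub>R T (fst p))) \<and>
       (\<integral>p. \<phi> (h (fst p) + s *\<^sub>R T (fst p)) \<partial>\<pi>) \<le> (\<integral>p. \<phi> (h (fst p) + s *\<^sub>R snd p) \<partial>\<pi>)"
      using i\<phi> integral_mono_AE[OF i\<phi> iR(1) le] iR(2) by (simp add: V_def W_def)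
  qed
qed

section \<open>An approximate form of Strassen's theorem\<close>

text \<open>Least squares over partitions of unity \<open>g\<close>: the integral of
  \<open>g i\<close> against \<open>(1, z)\<close> collects the mass and the first moment of the
  i-th piece, to be matched with \<open>p i\<close> and \<open>p i *\<^sub>R y i\<close>. In place
  of an exact minimizer, \<open>g0\<close> is optimal up to the square of \<delta> and is compared
  with a step of length \<delta> towards the selection that minimizes the linearised
  functional.\<close>

lemma approx_strassen_aux:
  fixes y :: "nat \<Rightarrow> 'a::euclidean_space" and p :: "nat \<Rightarrow> real"
  assumes I: "finite I" "I \<noteq> {}" and \<nu>: "\<nu> \<in> prob_moment 1" and p: "\<And>i. i \<in> I \<Longrightarrow> 0 \<le> p i"
    and le: "\<And>\<alpha> \<beta>. (\<Sum>i\<in>I. p i * Max ((\<lambda>j. \<alpha> j + \<beta> j \<bullet> y i) ` I)) \<le> (\<integral>z. Max ((\<lambda>j. \<alpha> j + \<beta> j \<bullet> z) ` I) \<partial>\<nu>)"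
    and "\<epsilon> > 0"
  shows "\<exists>g :: nat \<Rightarrow> 'a \<Rightarrow> real. (\<forall>i. g i \<in> borel_measurable borel) \<and> (\<forall>i z. 0 \<le> g i z) \<and> (\<forall>z. (\<Sum>i\<in>I. g i z) = 1) \<and>
    (\<Sum>i\<in>I. (norm ((\<integral>z. g i z *\<^sub>R (1::real, z) \<partial>\<nu>) - p i *\<^sub>R (1, y i)))\<^sup>2) \<le> \<epsilon>"
proof -
  interpret prob_space \<nu> using \<nu> by (simp add: prob_moment_1_iff)
  have [measurable_cong]: "sets \<nu> = sets borel" using \<nu> by (simp add: prob_moment_1_iff)
  have iz: "integrable \<nu> (\<lambda>z. (1::real, z))"
  proof (rule Bochner_Integration.integrable_bound)
    show "integrable \<nu> (\<lambda>z. 1 + norm z)" using \<nu> by (auto simp: prob_moment_1_iff)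
    show "AE z in \<nu>. norm (1::real, z) \<le> norm (1 + norm z)"
      using norm_Pair_le[of "1::real"] by auto
  qed measurable
  define K where "K = (\<integral>z. norm (1::real, z) \<partial>\<nu>)"
  define G where "G = {g :: nat \<Rightarrow> 'a \<Rightarrow> real. (\<forall>i. g i \<in> borel_measurable borel) \<and> (\<forall>i z. 0 \<le> g i z) \<and> (\<forall>z. (\<Sum>i\<in>I. g i z) = (1::real))}"
  define L where "L g i = (\<integral>z. g i z *\<^sub>R (1::real, z) \<partial>\<nu>)" for g :: "nat \<Rightarrow> 'a \<Rightarrow> real" and i
  define t where "t i = p i *\<^sub>R (1::real, y i)" for i
  define F where "F g = (\<Sum>i\<in>I. (norm (L g i - t i))\<^sup>2)" for g
  have G1: "g i z \<le> 1" if "g \<in> G" "i \<in> I" for g i z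
    using that member_le_sum[of i I "\<lambda>i. g i z"] I(1) by (auto simp: G_def)
  have iG: "integrable \<nu> (\<lambda>z. g i z *\<^sub>R (1::real, z))" if "g \<in> G" "i \<in> I" for g i
  proof (rule Bochner_Integration.integrable_bound[OF integrable_norm[OF iz]])
    have [measurable]: "g i \<in> borel_measurable borel" using that by (simp add: G_def)
    show "(\<lambda>z. g i z *\<^sub>R (1::real, z)) \<in> borel_measurable \<nu>" by measurable
    show "AE z in \<nu>. norm (g i z *\<^sub>R (1::real, z)) \<le> norm (norm (1::real, z))"
      using that G1[OF that] by (auto simp: G_def simp del: scaleR_Pair intro!: mult_left_le_one_le)
  qed
  have LK: "norm (L g i) \<le> K" if "g \<in> G" "i \<in> I" for g i
  proof -
    have "norm (L g i) \<le> (\<integral>z. norm (g i z *\<^sub>R (1::real, z)) \<partial>\<nu>)" unfolding L_def by (rule integral_norm_bound)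
    also have "\<dots> \<le> K" unfolding K_def
      using that G1[OF that] iz iG[OF that]
      by (intro integral_mono integrable_norm) (auto simp: G_def simp del: scaleR_Pair intro!: mult_left_le_one_le)
    finally show ?thesis .
  qed
  \<comment> \<open>In the quadratic expansion along the step, \<open>4 * K\<^sup>2\<close> bounds
    each squared displacement, and the extra 1 pays for the gap between \<open>F g0\<close> and the
    infimum.\<close>
  define D where "D = 1 + real (card I) * (4 * K\<^sup>2)"
  have D: "D > 0" by (simp add: D_def add_pos_nonneg)
  define \<delta> where "\<delta> = min (1/2) (\<epsilon> / D)"
  have \<delta>: "0 < \<delta>" "\<delta> < 1" "\<delta> * D \<le> \<epsilon>"
    using \<open>\<epsilon> > 0\<close> D by (auto simp: \<delta>_def field_simps min_def)
  have "(\<lambda>i z. 1 / real (card I)) \<in> G" using I by (simp add: G_def)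
  then have ne: "F ` G \<noteq> {}" by auto
  have bdd: "bdd_below (F ` G)" by (intro bdd_belowI[of _ 0]) (auto simp: F_def intro!: sum_nonneg)
  have "Inf (F ` G) < Inf (F ` G) + \<delta>\<^sup>2" using \<delta>(1) by simp
  then obtain v where "v \<in> F ` G" "v < Inf (F ` G) + \<delta>\<^sup>2"
    using cInf_lessD[OF ne] by metis
  then obtain g0 where g0: "g0 \<in> G" "F g0 < Inf (F ` G) + \<delta>\<^sup>2" by (metis imageE)
  define r where "r i = L g0 i - t i" for i
  \<comment> \<open>The extreme direction: at \<open>z\<close> all weight goes to an index with the
    least \<open>r j \<bullet> (1, z)\<close>, and taking the first such index keeps the choice
    measurable.\<close>
  define sel where "sel z = (LEAST j. j \<in> I \<and> (\<forall>k\<in>I. r j \<bullet> (1, z) \<le> r k \<bullet> (1, z)))" for z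
  define g1 where "g1 i z = (if sel z = i then 1 else 0 :: real)" for i z
  have sel: "sel z \<in> I \<and> (\<forall>k\<in>I. r (sel z) \<bullet> (1, z) \<le> r k \<bullet> (1, z))" for z
  proof -
    define f where "f k = r k \<bullet> (1, z)" for k
    have "arg_min_on f I \<in> I \<and> (\<forall>k\<in>I. f (arg_min_on f I) \<le> f k)"
      using arg_min_if_finite(1)[OF I, of f] arg_min_least[OF I, of _ f] by simp
    then show ?thesis unfolding sel_def f_def by (rule LeastI)
  qed
  have "sel \<in> measurable borel (count_space UNIV)"
    unfolding sel_def using I(1) by measurable
  then have g1m: "g1 i \<in> borel_measurable borel" for i unfolding g1_def by measurable
  have g1: "g1 \<in> G"
    using g1m sel I(1) by (auto simp: G_def g1_def)
  define g2 where "g2 i z = (1 - \<delta>) * g0 i z + \<delta> * g1 i z" for i z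
  have g2: "g2 \<in> G"
  proof -
    have [measurable]: "g0 i \<in> borel_measurable borel" "g1 i \<in> borel_measurable borel" for i
      using g0 g1 by (auto simp: G_def)
    have "g2 i \<in> borel_measurable borel" for i unfolding g2_def by measurable
    moreover have "(\<Sum>i\<in>I. g2 i z) = (1 - \<delta>) * (\<Sum>i\<in>I. g0 i z) + \<delta> * (\<Sum>i\<in>I. g1 i z)" for z
      by (simp add: g2_def sum.distrib sum_distrib_left)
    ultimately show ?thesis using g0(1) g1 \<delta> by (auto simp: G_def g2_def)
  qed
  have L2: "L g2 i = L g0 i + \<delta> *\<^sub>R (L g1 i - L g0 i)" if "i \<in> I" for i
  proof -
    have "L g2 i = (\<integral>z. (1 - \<delta>) *\<^sub>R (g0 i z *\<^sub>R (1::real, z)) + \<delta> *\<^sub>R (g1 i z *\<^sub>R (1::real, z)) \<partial>\<nu>)"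
      unfolding L_def g2_def by (intro Bochner_Integration.integral_cong) (auto simp: algebra_simps)
    also have "\<dots> = (1 - \<delta>) *\<^sub>R L g0 i + \<delta> *\<^sub>R L g1 i"
      unfolding L_def using iG[OF g0(1) that] iG[OF g1 that]
      by (subst Bochner_Integration.integral_add) (auto simp del: scaleR_Pair scaleR_scaleR)
    finally show ?thesis by (simp add: algebra_simps)
  qed
  have "F g2 = (\<Sum>i\<in>I. (norm (r i))\<^sup>2 + 2 * \<delta> * (r i \<bullet> (L g1 i - L g0 i)) + \<delta>\<^sup>2 * (norm (L g1 i - L g0 i))\<^sup>2)"
    unfolding F_def
  proof (rule sum.cong[OF refl])
    fix i assume i: "i \<in> I"
    have "L g2 i - t i = r i + \<delta> *\<^sub>R (L g1 i - L g0 i)" using L2[OF i] by (simp add: r_def)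
    then show "(norm (L g2 i - t i))\<^sup>2 = (norm (r i))\<^sup>2 + 2 * \<delta> * (r i \<bullet> (L g1 i - L g0 i)) + \<delta>\<^sup>2 * (norm (L g1 i - L g0 i))\<^sup>2"
      by (simp only: power2_norm_eq_inner inner_add_left inner_add_right inner_scaleR_left inner_scaleR_right
          inner_commute[of "L g1 i - L g0 i" "r i"]) (simp add: power2_eq_square distrib_left)
  qed
  also have "\<dots> = F g0 + 2 * \<delta> * (\<Sum>i\<in>I. r i \<bullet> (L g1 i - L g0 i)) + \<delta>\<^sup>2 * (\<Sum>i\<in>I. (norm (L g1 i - L g0 i))\<^sup>2)"
    by (simp add: F_def r_def sum.distrib sum_distrib_left)
  finally have F2: "F g2 = F g0 + 2 * \<delta> * (\<Sum>i\<in>I. r i \<bullet> (L g1 i - L g0 i)) + \<delta>\<^sup>2 * (\<Sum>i\<in>I. (norm (L g1 i - L g0 i))\<^sup>2)" .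
  have "(\<Sum>i\<in>I. (norm (L g1 i - L g0 i))\<^sup>2) \<le> (\<Sum>i\<in>I. 4 * K\<^sup>2)"
  proof (rule sum_mono)
    fix i assume i: "i \<in> I"
    have "norm (L g1 i - L g0 i) \<le> 2 * K" using LK[OF g0(1) i] LK[OF g1 i] norm_triangle_ineq4[of "L g1 i" "L g0 i"] by linarith
    then have "(norm (L g1 i - L g0 i))\<^sup>2 \<le> (2 * K)\<^sup>2" by (rule power_mono) simp
    then show "(norm (L g1 i - L g0 i))\<^sup>2 \<le> 4 * K\<^sup>2" by (simp add: power_mult_distrib)
  qed
  also have "(\<Sum>i\<in>I. 4 * K\<^sup>2) = D - 1" by (simp add: D_def)
  finally have "F g2 \<le> F g0 + 2 * \<delta> * (\<Sum>i\<in>I. r i \<bullet> (L g1 i - L g0 i)) + \<delta>\<^sup>2 * (D - 1)"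
    unfolding F2 by (intro add_left_mono mult_left_mono) auto
  moreover have "Inf (F ` G) \<le> F g2" using g2 bdd by (intro cInf_lower) auto
  \<comment> \<open>Near minimality becomes a first order condition with slack: the linear term
    cannot be more negative than a multiple of \<delta>.\<close>
  ultimately have "0 < 2 * \<delta> * (\<Sum>i\<in>I. r i \<bullet> (L g1 i - L g0 i)) + \<delta>\<^sup>2 * D"
    using g0(2) by (simp add: algebra_simps)
  then have "0 < \<delta> * (2 * (\<Sum>i\<in>I. r i \<bullet> (L g1 i - L g0 i)) + \<delta> * D)"
    by (simp add: algebra_simps power2_eq_square)
  then have "- (\<Sum>i\<in>I. r i \<bullet> (L g1 i - L g0 i)) \<le> \<delta> * D"
    using \<delta> D by (simp add: zero_less_mult_iff) (smt (verit) mult_pos_pos)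
  moreover have "(\<Sum>i\<in>I. r i \<bullet> (L g1 i - t i)) \<le> 0"
  proof -
    \<comment> \<open>Minus the minimum of the \<open>r j \<bullet> (1, z)\<close> is a maximum of
      affine functions, so the order hypothesis applies. Minus its integral under \<nu> is the
      linear functional at \<open>g1\<close>; minus its integral under the finitely supported law is
      at most the functional at the target \<open>t\<close>.\<close>
    define M where "M z = Max ((\<lambda>j. - fst (r j) + (- snd (r j)) \<bullet> z) ` I)" for z
    have M: "- (r i \<bullet> (1, z)) \<le> M z" if "i \<in> I" for i z
    proof -
      have "- (r i \<bullet> (1, z)) = - fst (r i) + (- snd (r i)) \<bullet> z" by (simp add: inner_prod_def)
      then show ?thesis unfolding M_def using that I by (auto intro!: Max_ge)
    qed
    have Msel: "(\<Sum>i\<in>I. r i \<bullet> (g1 i z *\<^sub>R (1, z))) = - M z" for z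
    proof -
      have "(\<Sum>i\<in>I. r i \<bullet> (g1 i z *\<^sub>R (1, z))) = (\<Sum>i\<in>I. if i = sel z then r i \<bullet> (1, z) else 0)"
        by (intro sum.cong) (auto simp: g1_def zero_prod_def[symmetric])
      also have "\<dots> = r (sel z) \<bullet> (1, z)" using I(1) sel by simp
      also have "\<dots> = - M z"
      proof (rule antisym)
        show "- M z \<le> r (sel z) \<bullet> (1, z)" using M[of "sel z" z] sel by fastforce
        have "M z \<le> - (r (sel z) \<bullet> (1, z))"
          unfolding M_def using I sel[of z] by (auto simp: inner_prod_def)
        then show "r (sel z) \<bullet> (1, z) \<le> - M z" by simp
      qed
      finally show ?thesis .
    qed
    have "(\<Sum>i\<in>I. r i \<bullet> L g1 i) = (\<integral>z. (\<Sum>i\<in>I. r i \<bullet> (g1 i z *\<^sub>R (1, z))) \<partial>\<nu>)"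
      unfolding L_def using iG[OF g1]
      by (subst Bochner_Integration.integral_sum) (auto simp del: scaleR_Pair inner_scaleR_right)
    also have "\<dots> = - (\<integral>z. M z \<partial>\<nu>)" unfolding Msel by simp
    also have "\<dots> \<le> - (\<Sum>i\<in>I. p i * M (y i))" using le[of "\<lambda>j. - fst (r j)" "\<lambda>j. - snd (r j)"] by (simp add: M_def)
    also have "\<dots> \<le> (\<Sum>i\<in>I. r i \<bullet> t i)"
      unfolding sum_negf[symmetric]
    proof (rule sum_mono)
      fix i assume i: "i \<in> I"
      show "- (p i * M (y i)) \<le> r i \<bullet> t i"
        using mult_left_mono[OF M[OF i, of "y i"] p[OF i]] unfolding t_def by (simp only: inner_scaleR_right)
    qed
    finally show ?thesis by (simp add: inner_diff_right sum_subtractf)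
  qed
  \<comment> \<open>\<open>F g0\<close> is \<open>r\<close> paired with itself; the residual
    \<open>L g0 - t\<close> is split at \<open>L g1\<close>.\<close>
  moreover have "F g0 = (\<Sum>i\<in>I. r i \<bullet> (L g1 i - t i)) - (\<Sum>i\<in>I. r i \<bullet> (L g1 i - L g0 i))"
    unfolding F_def r_def[symmetric] sum_subtractf[symmetric]
    by (intro sum.cong refl) (simp add: power2_norm_eq_inner inner_diff_right[symmetric] r_def)
  ultimately have "F g0 \<le> \<epsilon>" using \<delta>(3) by linarith
  then show ?thesis using g0(1) unfolding G_def F_def L_def t_def by blast
qed

text \<open>The masses are made exact at the price of a larger error in the means: each weight is
  shrunk by \<open>1 - \<tau>\<close> and a constant is added. Exact masses are what the weighted
  Jensen inequality asks for when the weights are moved to \<nu>'.\<close>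

lemma approx_strassen:
  fixes y :: "nat \<Rightarrow> 'a::euclidean_space" and p :: "nat \<Rightarrow> real"
  assumes I: "finite I" "I \<noteq> {}" and \<nu>: "\<nu> \<in> prob_moment 1" and p: "\<And>i. i \<in> I \<Longrightarrow> 0 < p i" "(\<Sum>i\<in>I. p i) = 1"
    and le: "\<And>\<alpha> \<beta>. (\<Sum>i\<in>I. p i * Max ((\<lambda>j. \<alpha> j + \<beta> j \<bullet> y i) ` I)) \<le> (\<integral>z. Max ((\<lambda>j. \<alpha> j + \<beta> j \<bullet> z) ` I) \<partial>\<nu>)"
    and "\<epsilon> > 0"
  shows "\<exists>g :: nat \<Rightarrow> 'a \<Rightarrow> real. (\<forall>i. g i \<in> borel_measurable borel) \<and> (\<forall>i\<in>I. \<forall>z. 0 \<le> g i z) \<and>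
    (\<forall>z. (\<Sum>i\<in>I. g i z) = 1) \<and> (\<forall>i\<in>I. (\<integral>z. g i z \<partial>\<nu>) = p i) \<and>
    (\<forall>i\<in>I. norm ((\<integral>z. g i z *\<^sub>R z \<partial>\<nu>) - p i *\<^sub>R y i) \<le> \<epsilon>)"
proof -
  interpret prob_space \<nu> using \<nu> by (simp add: prob_moment_1_iff)
  have [measurable_cong]: "sets \<nu> = sets borel" using \<nu> by (simp add: prob_moment_1_iff)
  have iz: "integrable \<nu> (\<lambda>z. z)" using \<nu> by (simp add: prob_moment_1_iff)
  define K where "K = (\<integral>z. norm z \<partial>\<nu>)"
  have K: "K \<ge> 0" by (simp add: K_def)
  define p0 where "p0 = Min (p ` I)"
  have p0: "0 < p0" "\<And>i. i \<in> I \<Longrightarrow> p0 \<le> p i" using I p(1) by (auto simp: p0_def)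
  \<comment> \<open>The bound by \<open>p0\<close> gives \<open>\<tau> \<le> 1\<close>, and the last
    entry makes the error \<open>3 * \<tau> * K\<close> of the mass correction at most half of
    \<epsilon>.\<close>
  define \<xi> where "\<xi> = min (\<epsilon> / 2) (min p0 (\<epsilon> * p0 / (8 * (1 + K))))"
  have \<xi>: "0 < \<xi>" "\<xi> \<le> \<epsilon> / 2" "\<xi> \<le> p0" "\<xi> * (8 * (1 + K)) \<le> \<epsilon> * p0"
  proof -
    show "0 < \<xi>"
      using \<open>\<epsilon> > 0\<close> p0(1) K by (simp add: \<xi>_def add_pos_nonneg)
    show "\<xi> \<le> \<epsilon> / 2" unfolding \<xi>_def by (rule min.cobounded1)
    show "\<xi> \<le> p0" by (simp add: \<xi>_def)
    have "\<xi> \<le> \<epsilon> * p0 / (8 * (1 + K))" by (simp add: \<xi>_def)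
    then show "\<xi> * (8 * (1 + K)) \<le> \<epsilon> * p0" using K by (simp add: pos_le_divide_eq)
  qed
  obtain g :: "nat \<Rightarrow> 'a \<Rightarrow> real" where gall: "(\<forall>i. g i \<in> borel_measurable borel) \<and> (\<forall>i z. 0 \<le> g i z) \<and> (\<forall>z. (\<Sum>i\<in>I. g i z) = 1) \<and>
    (\<Sum>i\<in>I. (norm ((\<integral>z. g i z *\<^sub>R (1::real, z) \<partial>\<nu>) - p i *\<^sub>R (1, y i)))\<^sup>2) \<le> \<xi>\<^sup>2"
    using approx_strassen_aux[OF I \<nu> less_imp_le[OF p(1)] le zero_less_power[OF \<xi>(1), of 2]] by (rule exE)
  then have gm[measurable]: "\<And>i. g i \<in> borel_measurable borel" and g: "\<And>i z. 0 \<le> g i z" "\<And>z. (\<Sum>i\<in>I. g i z) = (1::real)"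
    and gF: "(\<Sum>i\<in>I. (norm ((\<integral>z. g i z *\<^sub>R (1::real, z) \<partial>\<nu>) - p i *\<^sub>R (1, y i)))\<^sup>2) \<le> \<xi>\<^sup>2"
    by simp_all
  have g1: "g i z \<le> 1" if "i \<in> I" for i z
    using that member_le_sum[of i I "\<lambda>i. g i z"] I(1) g by auto
  have ig: "integrable \<nu> (g i)" if "i \<in> I" for i
    using g1[OF that] g(1) by (intro integrable_const_bound[of _ 1]) auto
  have igz: "integrable \<nu> (\<lambda>z. g i z *\<^sub>R z)" if "i \<in> I" for i
  proof (rule Bochner_Integration.integrable_bound[OF iz])
    show "(\<lambda>z. g i z *\<^sub>R z) \<in> borel_measurable \<nu>" by measurable
    show "AE z in \<nu>. norm (g i z *\<^sub>R z) \<le> norm z"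
      using g1[OF that] g(1) by (intro AE_I2) (simp add: mult_left_le_one_le)
  qed
  define q where "q i = (\<integral>z. g i z \<partial>\<nu>)" for i
  define b where "b i = (\<integral>z. g i z *\<^sub>R z \<partial>\<nu>)" for i
  have near: "\<bar>q i - p i\<bar> \<le> \<xi>" "norm (b i - p i *\<^sub>R y i) \<le> \<xi>" if i: "i \<in> I" for i
  proof -
    have ip: "integrable \<nu> (\<lambda>z. g i z *\<^sub>R (1::real, z))"
    proof -
      have "bounded_linear (\<lambda>u::real. (u, 0::'a))" "bounded_linear (\<lambda>v::'a. (0::real, v))"
        by (intro bounded_linear_Pair bounded_linear_ident bounded_linear_zero)+
      then have "integrable \<nu> (\<lambda>z. (g i z, 0::'a) + (0::real, g i z *\<^sub>R z))"
        using integrable_bounded_linear[OF _ ig[OF i]] integrable_bounded_linear[OF _ igz[OF i]]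
        by (intro Bochner_Integration.integrable_add) auto
      then show ?thesis by simp
    qed
    have eq: "(\<integral>z. g i z *\<^sub>R (1::real, z) \<partial>\<nu>) = (q i, b i)"
      using integral_fst[OF ip] integral_snd[OF ip] by (simp add: q_def b_def prod_eq_iff)
    have "(norm ((\<integral>z. g i z *\<^sub>R (1::real, z) \<partial>\<nu>) - p i *\<^sub>R (1, y i)))\<^sup>2 \<le> \<xi>\<^sup>2"
      by (rule order_trans[OF member_le_sum[of i I "\<lambda>i. (norm ((\<integral>z. g i z *\<^sub>R (1::real, z) \<partial>\<nu>) - p i *\<^sub>R (1, y i)))\<^sup>2"] gF])
        (use i I(1) in auto)
    then have "(norm (q i - p i, b i - p i *\<^sub>R y i))\<^sup>2 \<le> \<xi>\<^sup>2" unfolding eq by simp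
    then have *: "norm (q i - p i, b i - p i *\<^sub>R y i) \<le> \<xi>" using \<xi>(1) by (simp add: power2_le_iff_abs_le)
    show "\<bar>q i - p i\<bar> \<le> \<xi>" using norm_fst_le[of "q i - p i" "b i - p i *\<^sub>R y i"] * by simp
    show "norm (b i - p i *\<^sub>R y i) \<le> \<xi>" using norm_snd_le[of "b i - p i *\<^sub>R y i" "q i - p i"] * by simp
  qed
  \<comment> \<open>Since \<open>\<xi> \<le> \<tau> * p i\<close>, shrinking \<open>g i\<close>
    leaves room for a nonnegative constant that restores the mass \<open>p i\<close>. These
    constants add up to \<tau>, so the new weights still sum to one.\<close>
  define \<tau> where "\<tau> = \<xi> / p0"
  have \<tau>: "0 \<le> \<tau>" "\<tau> \<le> 1" "\<tau> * (8 * (1 + K)) \<le> \<epsilon>" using \<xi> p0(1) by (auto simp: \<tau>_def field_simps)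
  define f where "f i z = (1 - \<tau>) * g i z + (p i - (1 - \<tau>) * q i)" for i z
  have h: "0 \<le> p i - (1 - \<tau>) * q i" "\<bar>p i - (1 - \<tau>) * q i\<bar> \<le> 2 * \<tau>" if i: "i \<in> I" for i
  proof -
    have "\<xi> \<le> \<tau> * p i" using p0(2)[OF i] p0(1) \<xi>(1) by (simp add: \<tau>_def field_simps)
    moreover have "(1 - \<tau>) * q i \<le> (1 - \<tau>) * (p i + \<xi>)" using near(1)[OF i] \<tau> by (intro mult_left_mono) auto
    moreover have "\<tau> * \<xi> \<ge> 0" using \<tau> \<xi> by simp
    ultimately show *: "0 \<le> p i - (1 - \<tau>) * q i" by (simp add: algebra_simps)
    have "p i \<le> 1" using member_le_sum[of i I p] i p I(1) by (simp add: less_imp_le)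
    then have "\<tau> * q i \<le> \<tau>" "\<xi> \<le> \<tau>"
      using \<tau>(1) \<xi>(1) p0(1) p0(2)[OF i] integral_le_const[OF ig[OF i], of 1] g1[OF i]
      by (auto simp: q_def \<tau>_def field_simps intro!: mult_left_le)
    then show "\<bar>p i - (1 - \<tau>) * q i\<bar> \<le> 2 * \<tau>" using * near(1)[OF i] by (simp add: algebra_simps)
  qed
  have sq: "(\<Sum>i\<in>I. q i) = 1"
  proof -
    have "(\<Sum>i\<in>I. q i) = (\<integral>z. (\<Sum>i\<in>I. g i z) \<partial>\<nu>)"
      unfolding q_def using ig by (subst Bochner_Integration.integral_sum) auto
    then show ?thesis using g(2) by (simp add: prob_space)
  qed
  show ?thesis
  proof (intro exI[of _ f] conjI allI ballI)
    show "f i \<in> borel_measurable borel" for i unfolding f_def by measurable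
    show "0 \<le> f i z" if "i \<in> I" for i z using h(1)[OF that] g(1)[of i z] \<tau> by (simp add: f_def)
    show "(\<Sum>i\<in>I. f i z) = 1" for z
    proof -
      have "(\<Sum>i\<in>I. f i z) = (1 - \<tau>) * (\<Sum>i\<in>I. g i z) + ((\<Sum>i\<in>I. p i) - (1 - \<tau>) * (\<Sum>i\<in>I. q i))"
        by (simp add: f_def sum.distrib sum_subtractf sum_distrib_left)
      then show ?thesis using g(2) p(2) sq by simp
    qed
    fix i assume i: "i \<in> I"
    show "(\<integral>z. f i z \<partial>\<nu>) = p i" using ig[OF i] by (simp add: f_def q_def prob_space)
    have "(\<integral>z. f i z *\<^sub>R z \<partial>\<nu>) = (\<integral>z. (1 - \<tau>) *\<^sub>R (g i z *\<^sub>R z) + (p i - (1 - \<tau>) * q i) *\<^sub>R z \<partial>\<nu>)"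
      by (intro Bochner_Integration.integral_cong) (auto simp: f_def algebra_simps)
    also have "\<dots> = (1 - \<tau>) *\<^sub>R b i + (p i - (1 - \<tau>) * q i) *\<^sub>R (\<integral>z. z \<partial>\<nu>)"
      using igz[OF i] iz by (subst Bochner_Integration.integral_add) (auto simp: b_def simp del: scaleR_scaleR)
    finally have eq0: "(\<integral>z. f i z *\<^sub>R z \<partial>\<nu>) - p i *\<^sub>R y i
        = (b i - p i *\<^sub>R y i) - \<tau> *\<^sub>R b i + (p i - (1 - \<tau>) * q i) *\<^sub>R (\<integral>z. z \<partial>\<nu>)" by (simp add: algebra_simps)
    have "norm ((b i - p i *\<^sub>R y i) - \<tau> *\<^sub>R b i + (p i - (1 - \<tau>) * q i) *\<^sub>R (\<integral>z. z \<partial>\<nu>)) \<le> \<xi> + \<tau> * K + 2 * \<tau> * K"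
    proof (rule order_trans[OF norm_triangle_ineq], rule add_mono, rule order_trans[OF norm_triangle_ineq4], rule add_mono)
      show "norm (b i - p i *\<^sub>R y i) \<le> \<xi>" using near(2)[OF i] .
      have "norm (b i) \<le> (\<integral>z. norm (g i z *\<^sub>R z) \<partial>\<nu>)" unfolding b_def by (rule integral_norm_bound)
      also have "\<dots> \<le> K" unfolding K_def using igz[OF i] iz g1[OF i] g(1)
        by (intro integral_mono integrable_norm) (auto intro!: mult_left_le_one_le)
      finally show "norm (\<tau> *\<^sub>R b i) \<le> \<tau> * K" using \<tau>(1) by (simp add: mult_left_mono)
      have "norm (\<integral>z. z \<partial>\<nu>) \<le> K" unfolding K_def by (rule integral_norm_bound)
      then show "norm ((p i - (1 - \<tau>) * q i) *\<^sub>R (\<integral>z. z \<partial>\<nu>)) \<le> 2 * \<tau> * K"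
        using h(2)[OF i] \<tau>(1) by (simp add: mult_mono)
    qed
    moreover have "\<xi> + \<tau> * K + 2 * \<tau> * K \<le> \<epsilon>" using \<xi>(2) \<tau>(1,3) K \<open>\<epsilon> > 0\<close> by (simp add: algebra_simps)
    ultimately show "norm ((\<integral>z. f i z *\<^sub>R z \<partial>\<nu>) - p i *\<^sub>R y i) \<le> \<epsilon>"
      unfolding eq0 by (rule order_trans)
  qed
qed

section \<open>Costs of polynomial growth\<close>

lemma powr_add_le:
  fixes x y \<rho> :: real
  assumes "0 \<le> x" "0 \<le> y" "0 \<le> \<rho>"
  shows "(x + y) powr \<rho> \<le> 2 powr \<rho> * (x powr \<rho> + y powr \<rho>)"
proof -
  have "(x + y) powr \<rho> \<le> (2 * max x y) powr \<rho>" using assms by (intro powr_mono2) auto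
  also have "\<dots> = 2 powr \<rho> * (max x y) powr \<rho>" using assms by (simp add: powr_mult)
  also have "\<dots> \<le> 2 powr \<rho> * (x powr \<rho> + y powr \<rho>)" by (intro mult_left_mono) (auto simp: max_def)
  finally show ?thesis .
qed

lemma norm_add_powr_le:
  assumes "0 \<le> \<rho>"
  shows "norm (u + v) powr \<rho> \<le> 2 powr \<rho> * (norm u powr \<rho> + norm v powr \<rho>)"
  using assms by (intro order_trans[OF powr_mono2 powr_add_le]) (auto simp: norm_triangle_ineq)

lemma norm_diff_powr_le:
  assumes "0 \<le> \<rho>"
  shows "norm (u - v) powr \<rho> \<le> 2 powr \<rho> * (norm u powr \<rho> + norm v powr \<rho>)"
  using norm_add_powr_le[OF assms, of u "- v"] by simp

text \<open>\<open>B e\<close> is a level whose integrated excess is at most \<open>e\<close>. The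
  excess is preferred to the tail of \<open>f\<close> because for \<open>f = norm\<close> it is
  convex in the point, so one \<open>B\<close> serves all measures below in the convex
  order.\<close>

definition ui_bound :: "'b measure \<Rightarrow> ('b \<Rightarrow> real) \<Rightarrow> (real \<Rightarrow> real) \<Rightarrow> bool" where
  "ui_bound M f B \<longleftrightarrow> integrable M f \<and> (\<forall>e>0. (\<integral>x. max 0 (f x - B e) \<partial>M) \<le> e)"

text \<open>Pointwise \<open>w * f \<le> B e * w + max 0 (f - B e)\<close>, as \<open>w\<close> lies
  between 0 and 1. Small weight thus means small weighted mean, uniformly over measures with the
  same modulus.\<close>

lemma (in prob_space) ui_bound_weighted:
  assumes "ui_bound M f B" "0 \<le> B e" "0 < e"
    and [measurable]: "w \<in> borel_measurable M" and w: "\<And>x. 0 \<le> w x" "\<And>x. w x \<le> 1"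
  shows "integrable M (\<lambda>x. w x * f x)" "(\<integral>x. w x * f x \<partial>M) \<le> B e * (\<integral>x. w x \<partial>M) + e"
proof -
  have f[measurable]: "integrable M f" and e: "(\<integral>x. max 0 (f x - B e) \<partial>M) \<le> e"
    using assms by (auto simp: ui_bound_def)
  have iw: "integrable M w" using w by (intro integrable_const_bound[of _ 1]) auto
  show i: "integrable M (\<lambda>x. w x * f x)"
  proof (rule Bochner_Integration.integrable_bound[OF f])
    show "AE x in M. norm (w x * f x) \<le> norm (f x)"
      using w by (auto simp: abs_mult intro!: mult_left_le_one_le)
  qed measurable
  have "(\<integral>x. w x * f x \<partial>M) \<le> (\<integral>x. B e * w x + max 0 (f x - B e) \<partial>M)"
  proof (rule integral_mono[OF i])
    show "integrable M (\<lambda>x. B e * w x + max 0 (f x - B e))" using iw f by auto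
    fix x
    have "w x * (f x - B e) \<le> max 0 (f x - B e)"
    proof (cases "f x - B e \<ge> 0")
      case True
      then have "w x * (f x - B e) \<le> f x - B e" using w[of x] by (intro mult_left_le_one_le) auto
      then show ?thesis by simp
    next
      case False
      then have "w x * (f x - B e) \<le> 0" using w[of x] by (intro mult_nonneg_nonpos) auto
      then show ?thesis by simp
    qed
    then show "w x * f x \<le> B e * w x + max 0 (f x - B e)" by (simp add: algebra_simps)
  qed
  also have "\<dots> = B e * (\<integral>x. w x \<partial>M) + (\<integral>x. max 0 (f x - B e) \<partial>M)"
    using iw f by (subst Bochner_Integration.integral_add) auto
  finally show "(\<integral>x. w x * f x \<partial>M) \<le> B e * (\<integral>x. w x \<partial>M) + e" using e by linarith
qed

lemma (in prob_space) ui_bound_mean: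
  assumes "ui_bound M f B" "0 \<le> B 1"
  shows "(\<integral>x. f x \<partial>M) \<le> B 1 + 1"
  using ui_bound_weighted(2)[OF assms, of "\<lambda>_. 1"] by (simp add: prob_space)

text \<open>Where \<open>f\<close> exceeds \<open>2 * B e\<close>, it is at most twice its excess
  over \<open>B e\<close>.\<close>

lemma (in prob_space) ui_bound_tail:
  assumes "ui_bound M f B" "0 < e" "2 * B e \<le> R" "\<And>x. 0 \<le> f x"
  shows "(\<integral>x. f x * indicator {x \<in> space M. R < f x} x \<partial>M) \<le> 2 * e"
proof -
  have f[measurable]: "integrable M f" and e: "(\<integral>x. max 0 (f x - B e) \<partial>M) \<le> e"
    using assms by (auto simp: ui_bound_def)
  have "(\<integral>x. f x * indicator {x \<in> space M. R < f x} x \<partial>M) \<le> (\<integral>x. 2 * max 0 (f x - B e) \<partial>M)"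
  proof (rule integral_mono)
    show "integrable M (\<lambda>x. f x * indicator {x \<in> space M. R < f x} x)"
      using f by (intro integrable_real_mult_indicator) auto
    show "integrable M (\<lambda>x. 2 * max 0 (f x - B e))" using f by auto
    show "f x * indicator {x \<in> space M. R < f x} x \<le> 2 * max 0 (f x - B e)" for x
      using assms(3) assms(4)[of x] by (auto simp: indicator_def max_def)
  qed
  also have "\<dots> = 2 * (\<integral>x. max 0 (f x - B e) \<partial>M)" by simp
  finally show ?thesis using e by linarith
qed

text \<open>An average inherits every bound that holds where its weight is positive.\<close>

lemma norm_weighted_average_diff_le:
  fixes T :: "'b \<Rightarrow> 'a::euclidean_space"
  assumes w: "integrable M w" "\<And>x. 0 \<le> w x" "integrable M (\<lambda>x. w x *\<^sub>R T x)" "(\<integral>x. w x \<partial>M) = p" "0 < p"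
    and eq: "(\<integral>x. w x *\<^sub>R T x \<partial>M) = p *\<^sub>R y"
    and r: "\<And>x. 0 < w x \<Longrightarrow> norm (T x - v) \<le> r"
  shows "norm (y - v) \<le> r"
proof -
  have i: "integrable M (\<lambda>x. w x *\<^sub>R (T x - v))" using w by (simp add: scaleR_diff_right)
  have "(\<integral>x. w x *\<^sub>R (T x - v) \<partial>M) = p *\<^sub>R (y - v)"
    using w eq by (simp add: scaleR_diff_right)
  then have "p * norm (y - v) = norm (\<integral>x. w x *\<^sub>R (T x - v) \<partial>M)"
    using w(5) by simp
  also have "\<dots> \<le> (\<integral>x. norm (w x *\<^sub>R (T x - v)) \<partial>M)" by (rule integral_norm_bound)
  also have "\<dots> \<le> (\<integral>x. w x * r \<partial>M)"
  proof (rule integral_mono[OF integrable_norm[OF i]])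
    fix x show "norm (w x *\<^sub>R (T x - v)) \<le> w x * r"
      using w(2)[of x] r[of x] by (cases "w x = 0") (auto intro!: mult_left_mono)
  qed (use w in auto)
  also have "\<dots> = p * r" using w by simp
  finally show ?thesis using w(5) by simp
qed

text \<open>The constant \<open>a\<close> comes from an affine minorant. Linear growth from below
  matches the first moments of \<nu>, power growth from above the moments of \<mu>.\<close>

locale convex_cost =
  fixes \<theta> :: "'a::euclidean_space \<Rightarrow> real" and \<rho> c a :: real
  assumes convex: "convex_on UNIV \<theta>" and \<rho>: "1 \<le> \<rho>" and c: "0 < c"
    and upper: "\<And>x. \<theta> x \<le> c * (1 + norm x powr \<rho>)"
    and a: "0 \<le> a" and lower: "\<And>x. - \<theta> x \<le> a * (1 + norm x)"
begin

lemma measurable_cost[measurable]: "\<theta> \<in> borel_measurable borel"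
  using convex by (rule convex_borel_measurable)

text \<open>The coefficients that bound the difference of \<theta> between the far point
  \<open>u + e / l\<close> and \<open>u\<close>: \<open>c\<close> and
  \<open>c * 2 powr \<rho>\<close> stem from the growth at the far point, \<open>2 * a\<close> from
  the lower bound at \<open>u\<close>.\<close>

definition C where "C = c + c * 2 powr \<rho> + 2 * a"

lemma C_pos: "0 < C" using c a by (simp add: C_def add_pos_nonneg)

text \<open>Write \<open>u + e\<close> as the convex combination \<open>(1 - l) u + l (u + e / l)\<close>; only the one-sided growth
  bound is then needed at the far away point \<open>u + e / l\<close>.\<close>

lemma cost_shift:
  assumes l: "0 < l" "l \<le> 1"
  shows "\<theta> (u + e) \<le> \<theta> u + l * C * (1 + norm u powr \<rho> + norm e powr \<rho> / l powr \<rho>)"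
proof -
  define E where "E = norm e powr \<rho> / l powr \<rho>"
  have E: "norm ((1 / l) *\<^sub>R e) powr \<rho> = E" "E \<ge> 0" using l by (simp_all add: E_def powr_divide)
  have "u + e = (1 - l) *\<^sub>R u + l *\<^sub>R (u + (1 / l) *\<^sub>R e)" using l by (simp add: algebra_simps)
  then have "\<theta> (u + e) \<le> (1 - l) * \<theta> u + l * \<theta> (u + (1 / l) *\<^sub>R e)"
    using convex_onD[OF convex, of l u "u + (1 / l) *\<^sub>R e"] l by auto
  moreover have "\<theta> (u + (1 / l) *\<^sub>R e) - \<theta> u \<le> C * (1 + norm u powr \<rho> + E)"
  proof -
    have "c * norm (u + (1 / l) *\<^sub>R e) powr \<rho> \<le> c * (2 powr \<rho> * (norm u powr \<rho> + E))"
      using norm_add_powr_le[of \<rho> u "(1 / l) *\<^sub>R e"] \<rho> c unfolding E(1) by (intro mult_left_mono) auto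
    moreover have "a * norm u \<le> a * (1 + norm u powr \<rho>)"
      using le_1_powr[OF norm_ge_zero \<rho>, of u] a by (intro mult_left_mono)
    moreover have "0 \<le> c * norm u powr \<rho>" "0 \<le> c * 2 powr \<rho>" "0 \<le> a * norm u powr \<rho>" "0 \<le> c * E" "0 \<le> a * E"
      using c a E by simp_all
    ultimately show ?thesis using upper[of "u + (1 / l) *\<^sub>R e"] lower[of u] by (simp add: C_def algebra_simps)
  qed
  then have "l * (\<theta> (u + (1 / l) *\<^sub>R e) - \<theta> u) \<le> l * (C * (1 + norm u powr \<rho> + E))"
    using l by (intro mult_left_mono) auto
  ultimately show ?thesis by (simp add: E_def algebra_simps)
qed

lemma cost_integrable:
  assumes "finite_measure M" and [measurable]: "X \<in> borel_measurable M" "Y \<in> borel_measurable M"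
    and "integrable M (\<lambda>x. norm (X x) powr \<rho>)" "integrable M (\<lambda>x. norm (Y x) powr \<rho>)"
  shows "integrable M (\<lambda>x. \<theta> (X x - Y x))"
proof -
  interpret finite_measure M by fact
  define h where "h x = (a + c) * (2 + 2 powr \<rho> * (norm (X x) powr \<rho> + norm (Y x) powr \<rho>))" for x
  show ?thesis
  proof (rule Bochner_Integration.integrable_bound)
    show "integrable M h" unfolding h_def using assms by auto
    have "\<bar>\<theta> (X x - Y x)\<bar> \<le> h x" for x
    proof -
      define P where "P = 2 powr \<rho> * (norm (X x) powr \<rho> + norm (Y x) powr \<rho>)"
      have P: "norm (X x - Y x) powr \<rho> \<le> P" unfolding P_def using \<rho> by (intro norm_diff_powr_le) auto
      have "P \<ge> 0" by (simp add: P_def)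
      have "\<theta> (X x - Y x) \<le> c * (1 + P)"
        using P c by (intro order_trans[OF upper] mult_left_mono) auto
      moreover have "- \<theta> (X x - Y x) \<le> a * (2 + P)"
        using P le_1_powr[OF norm_ge_zero \<rho>, of "X x - Y x"] a by (intro order_trans[OF lower] mult_left_mono) auto
      moreover have "c * (1 + P) \<le> (a + c) * (2 + P)" "a * (2 + P) \<le> (a + c) * (2 + P)"
        using a c \<open>P \<ge> 0\<close> by (auto intro!: mult_mono)
      ultimately show ?thesis unfolding h_def P_def[symmetric] by linarith
    qed
    then show "AE x in M. norm (\<theta> (X x - Y x)) \<le> norm (h x)"
      by (intro AE_I2) (simp add: order_trans[OF _ abs_ge_self])
  qed measurable
qed

text \<open>Moduli of uniform integrability make the estimates below uniform along the approximating
  sequences.\<close>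

definition bounded_data :: "(real \<Rightarrow> real) \<Rightarrow> (real \<Rightarrow> real) \<Rightarrow> 'a measure \<Rightarrow> 'a measure \<Rightarrow> bool" where
  "bounded_data B1 B2 \<mu> \<nu> \<longleftrightarrow> \<mu> \<in> prob_moment \<rho> \<and> \<nu> \<in> prob_moment 1 \<and>
     ui_bound \<mu> (\<lambda>x. norm x powr \<rho>) B1 \<and> ui_bound \<nu> norm B2"

text \<open>With \<open>X\<close> the identity on \<mu> this is a map; on a coupling,
  \<open>X\<close> and \<open>Y\<close> may use different coordinates. Integrability is included so
  that costs can be compared as real integrals.\<close>

definition competitor :: "'b measure \<Rightarrow> ('b \<Rightarrow> 'a) \<Rightarrow> ('b \<Rightarrow> 'a) \<Rightarrow> 'a measure \<Rightarrow> 'a measure \<Rightarrow> bool" where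
  "competitor M X Y \<mu> \<nu> \<longleftrightarrow> X \<in> borel_measurable M \<and> Y \<in> borel_measurable M \<and>
     distr M borel X = \<mu> \<and> distr M borel Y \<le>\<^sub>c \<nu> \<and> integrable M (\<lambda>x. \<theta> (X x - Y x))"

text \<open>\<kappa> is a parameter because perturbed competitors are random variables on it,
  whereas the coupling of \<nu> and \<nu>' only moves weights and stays existential. The exponent 1
  is written out to match the shape of the Wasserstein estimates.\<close>

definition near_data :: "real \<Rightarrow> 'a measure \<Rightarrow> 'a measure \<Rightarrow> 'a measure \<Rightarrow> 'a measure \<Rightarrow> ('a \<times> 'a) measure \<Rightarrow> bool" where
  "near_data \<delta> \<mu> \<nu> \<mu>' \<nu>' \<kappa> \<longleftrightarrow> \<mu>' \<in> prob_moment \<rho> \<and> \<nu>' \<in> prob_moment 1 \<and>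
     \<kappa> \<in> couplings \<mu> \<mu>' \<and> (\<integral>p. norm (fst p - snd p) powr \<rho> \<partial>\<kappa>) \<le> \<delta> \<and>
     (\<exists>\<xi> \<in> couplings \<nu> \<nu>'. (\<integral>p. norm (fst p - snd p) powr 1 \<partial>\<xi>) \<le> \<delta>)"

lemma competitor_self:
  assumes "\<mu> \<in> prob_moment \<rho>"
  shows "competitor \<mu> (\<lambda>x. x) T \<mu> \<nu> \<longleftrightarrow>
    T \<in> borel_measurable borel \<and> distr \<mu> borel T \<le>\<^sub>c \<nu> \<and> integrable \<mu> (\<lambda>x. \<theta> (x - T x))"
proof -
  have s: "sets \<mu> = sets borel" using assms by (simp add: prob_moment_def)
  then have "distr \<mu> borel (\<lambda>x. x) = \<mu>" by (intro distr_id2) simp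
  moreover have "(\<lambda>x. x) \<in> borel_measurable \<mu>" using s measurable_ident_sets by blast
  ultimately show ?thesis using measurable_cong_sets[OF s refl] by (auto simp: competitor_def)
qed

text \<open>A finite picture of \<open>T\<close>: the map that replaces it is the mean of the
  \<open>y i\<close> with weights \<open>w i x\<close>. The bounds \<open>p0\<close> and
  \<open>K\<close> are separate parameters so that they can be fixed before \<mu> and
  \<open>T\<close>.\<close>

definition smoothing_of ::
  "'a measure \<Rightarrow> ('a \<Rightarrow> 'a) \<Rightarrow> nat set \<Rightarrow> (nat \<Rightarrow> 'a \<Rightarrow> real) \<Rightarrow> (nat \<Rightarrow> 'a) \<Rightarrow> real \<Rightarrow> real \<Rightarrow> real \<Rightarrow> bool" where
  "smoothing_of \<mu> T I w y p0 K \<epsilon> \<longleftrightarrow> finite I \<and> I \<noteq> {} \<and> (\<forall>i. w i \<in> borel_measurable borel) \<and> (\<forall>i x. 0 \<le> w i x) \<and>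
     (\<forall>x. (\<Sum>i\<in>I. w i x) = 1) \<and> (\<forall>i\<in>I. p0 \<le> (\<integral>x. w i x \<partial>\<mu>)) \<and>
     (\<forall>i\<in>I. (\<integral>x. w i x *\<^sub>R T x \<partial>\<mu>) = (\<integral>x. w i x \<partial>\<mu>) *\<^sub>R y i) \<and> (\<forall>i\<in>I. norm (y i) \<le> K) \<and>
     (\<integral>x. norm ((\<Sum>i\<in>I. w i x *\<^sub>R y i) - T x) \<partial>\<mu>) \<le> \<epsilon> \<and>
     (\<integral>x. \<theta> (x - (\<Sum>i\<in>I. w i x *\<^sub>R y i)) \<partial>\<mu>) \<le> (\<integral>x. \<theta> (x - T x) \<partial>\<mu>) + \<epsilon>"

end

lemma totally_bounded_partition:
  fixes R \<kappa> :: real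
  assumes "0 < \<kappa>"
  obtains k :: nat and D :: "nat \<Rightarrow> 'a::euclidean_space set"
  where "\<And>i. D i \<in> sets borel" "disjoint_family D" "(\<Union>i<k. D i) = cball 0 R"
    "\<And>i x y. x \<in> D i \<Longrightarrow> y \<in> D i \<Longrightarrow> norm (x - y) \<le> \<kappa>" "\<And>i x. x \<in> D i \<Longrightarrow> norm x \<le> R"
proof -
  have "compact (cball (0::'a) R)" by simp
  then obtain Z where Z: "finite Z" "cball (0::'a) R \<subseteq> (\<Union>x\<in>Z. ball x (\<kappa> / 2))"
    using assms unfolding compact_eq_totally_bounded by (meson half_gt_zero)
  obtain k and z :: "nat \<Rightarrow> 'a" where z: "Z = z ` {i. i < k}"
    using finite_imp_nat_seg_image_inj_on[OF Z(1)] by metis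
  define D where "D = disjointed (\<lambda>i. ball (z i) (\<kappa> / 2) \<inter> cball 0 R)"
  have sub: "D i \<subseteq> ball (z i) (\<kappa> / 2) \<inter> cball 0 R" for i
    unfolding D_def by (rule disjointed_subset)
  show ?thesis
  proof (rule that[of D k])
    have "ball (z i) (\<kappa> / 2) \<inter> cball 0 R \<in> sets borel" for i by (intro sets.Int) auto
    then show "D i \<in> sets borel" for i
      unfolding D_def disjointed_def by (intro sets.Diff sets.finite_UN) auto
    show "disjoint_family D" unfolding D_def by (rule disjoint_family_disjointed)
    have "(\<Union>i<k. D i) = (\<Union>i<k. ball (z i) (\<kappa> / 2) \<inter> cball 0 R)"
      using finite_UN_disjointed_eq[of "\<lambda>i. ball (z i) (\<kappa> / 2) \<inter> cball 0 R" k]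
      by (simp add: D_def lessThan_atLeast0)
    then show "(\<Union>i<k. D i) = cball 0 R" using Z(2) unfolding z by (auto simp: lessThan_def)
    show "norm (x - y) \<le> \<kappa>" if "x \<in> D i" "y \<in> D i" for i x y
    proof -
      have "x \<in> ball (z i) (\<kappa> / 2)" "y \<in> ball (z i) (\<kappa> / 2)" using sub[of i] that by blast+
      then have "dist (z i) x < \<kappa> / 2" "dist (z i) y < \<kappa> / 2" by simp_all
      then show ?thesis using dist_triangle3[of x y "z i"] by (simp add: dist_norm norm_minus_commute)
    qed
    show "norm x \<le> R" if "x \<in> D i" for i x using sub[of i] that by auto
  qed
qed

text \<open>The region where \<open>T\<close> is large and the cells of small mass are lumped together with a small
  fraction of the whole space, so that all weights are bounded below and all averages are bounded
  above, uniformly in the measure.\<close>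

lemma (in convex_cost) smoothing:
  fixes B1 B2 :: "real \<Rightarrow> real"
  assumes B: "\<And>e. 0 \<le> B1 e" "\<And>e. 0 \<le> B2 e" and "0 < \<epsilon>"
  shows "\<exists>p0 K. 0 < p0 \<and> 0 \<le> K \<and> (\<forall>\<mu> T. prob_space \<mu> \<longrightarrow> sets \<mu> = sets borel \<longrightarrow>
    ui_bound \<mu> (\<lambda>x. norm x powr \<rho>) B1 \<longrightarrow> T \<in> borel_measurable borel \<longrightarrow>
    ui_bound \<mu> (\<lambda>x. norm (T x)) B2 \<longrightarrow> integrable \<mu> (\<lambda>x. \<theta> (x - T x)) \<longrightarrow>
    (\<exists>I w y. smoothing_of \<mu> T I w y p0 K \<epsilon>))"
proof -
  \<comment> \<open>\<open>m1\<close> and \<open>K2\<close> bound the moments of \<mu> and of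
    \<open>T\<close>; \<open>M0\<close> will bound the average over the remainder piece.\<close>
  define m1 where "m1 = B1 1 + 1"
  define K2 where "K2 = B2 1 + 1"
  define M0 where "M0 = 1 + K2"
  have nn: "0 \<le> m1" "0 \<le> K2" "0 \<le> M0" using B[of 1] by (auto simp: m1_def K2_def M0_def)
  \<comment> \<open>Coefficients in the bound
    \<open>A1 + A2 * norm x powr \<rho> + a * norm (T x)\<close> for the extra cost of sending
    \<open>x\<close> to the remainder average instead of \<open>T x\<close>.\<close>
  define A1 where "A1 = 2 * a + c + c * 2 powr \<rho> * M0 powr \<rho>"
  define A2 where "A2 = a + c * 2 powr \<rho>"
  have A: "0 \<le> A1" "0 \<le> A2" using a c by (auto simp: A1_def A2_def)
  define e1 where "e1 = \<epsilon> / (4 * (A2 + 1))"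
  have e1: "0 < e1" "A2 * e1 \<le> \<epsilon> / 4"
    using \<open>0 < \<epsilon>\<close> A by (auto simp: e1_def field_simps)
  \<comment> \<open>\<open>Q\<close> gathers the coefficients of \<open>\<epsilon>1\<close> in
    \<open>Q1\<close> and \<open>Q2\<close>; \<open>\<epsilon>1\<close> is the fraction of every
    point that is given to the remainder piece.\<close>
  define Q where "Q = 1 + 2 * (A1 + A2 * B1 e1) + a * (1 + K2) + 2 * M0 + (1 + K2)"
  have Q: "Q > 0" using A B(1)[of e1] a nn by (simp add: Q_def add_pos_nonneg)
  define \<epsilon>1 where "\<epsilon>1 = min (1/2) (\<epsilon> / (4 * Q))"
  have \<epsilon>1: "0 < \<epsilon>1" "\<epsilon>1 \<le> 1/2" "\<epsilon>1 * Q \<le> \<epsilon> / 4"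
  proof -
    show "0 < \<epsilon>1" "\<epsilon>1 \<le> 1/2" using \<open>0 < \<epsilon>\<close> Q by (auto simp: \<epsilon>1_def)
    have "\<epsilon>1 \<le> \<epsilon> / (4 * Q)" by (simp add: \<epsilon>1_def)
    then show "\<epsilon>1 * Q \<le> \<epsilon> / 4" using Q by (simp add: pos_le_divide_eq)
  qed
  have Q1: "2 * \<epsilon>1 * A1 + A2 * (B1 e1 * (2 * \<epsilon>1) + e1) + a * (\<epsilon>1 * (1 + K2)) \<le> \<epsilon> / 2"
    and Q2: "2 * \<epsilon>1 * M0 + \<epsilon>1 * (1 + K2) \<le> \<epsilon> / 2"
  proof -
    have "0 \<le> \<epsilon>1 * M0" "0 \<le> \<epsilon>1 * K2" "0 \<le> \<epsilon>1 * A1" "0 \<le> \<epsilon>1 * (A2 * B1 e1)" "0 \<le> \<epsilon>1 * a" "0 \<le> \<epsilon>1 * (a * K2)"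
      using \<epsilon>1(1) nn A B a by auto
    then show "2 * \<epsilon>1 * A1 + A2 * (B1 e1 * (2 * \<epsilon>1) + e1) + a * (\<epsilon>1 * (1 + K2)) \<le> \<epsilon> / 2"
      "2 * \<epsilon>1 * M0 + \<epsilon>1 * (1 + K2) \<le> \<epsilon> / 2"
      using \<epsilon>1 e1(2) \<open>0 < \<epsilon>\<close> unfolding Q_def by (simp_all add: algebra_simps)
  qed
  \<comment> \<open>Beyond norm \<open>R\<close> the map carries mean at most
    \<open>\<epsilon>1 / 2\<close>; the factor 2 is the one in \<open>ui_bound_tail\<close>, and
    \<open>1 \<le> R\<close> lets this control the mass of the tail as well.\<close>
  define R where "R = 2 * max 1 (B2 (\<epsilon>1 / 4))"
  have R: "1 \<le> R" "2 * B2 (\<epsilon>1 / 4) \<le> R" by (auto simp: R_def)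
  define H where "H = C * (2 + 2 powr \<rho> * (m1 + R powr \<rho>))"
  have H: "0 \<le> H" using C_pos nn by (simp add: H_def)
  \<comment> \<open>The cell diameter is also the parameter \<open>l\<close> of
    \<open>cost_shift\<close>, so that the quotient of powers there is at most 1.\<close>
  define \<kappa> where "\<kappa> = min 1 (min (\<epsilon> / 2) (\<epsilon> / (2 * (1 + H))))"
  have \<kappa>: "0 < \<kappa>" "\<kappa> \<le> 1" "\<kappa> \<le> \<epsilon> / 2" "\<kappa> * H \<le> \<epsilon> / 2"
  proof -
    show l: "0 < \<kappa>" using \<open>0 < \<epsilon>\<close> H by (simp add: \<kappa>_def)
    show "\<kappa> \<le> 1" by (simp add: \<kappa>_def)
    show "\<kappa> \<le> \<epsilon> / 2" unfolding \<kappa>_def by linarith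
    have "\<kappa> \<le> \<epsilon> / (2 * (1 + H))" unfolding \<kappa>_def by linarith
    then have "\<kappa> * (2 * (1 + H)) \<le> \<epsilon>" using H by (simp add: pos_le_divide_eq)
    then show "\<kappa> * H \<le> \<epsilon> / 2" using l by (simp add: algebra_simps)
  qed
  obtain k :: nat and D :: "nat \<Rightarrow> 'a set" where D[measurable]: "\<And>i. D i \<in> sets borel"
    and Dd: "disjoint_family D" and Dc: "(\<Union>i<k. D i) = cball 0 R"
    and Ds: "\<And>i x y. x \<in> D i \<Longrightarrow> y \<in> D i \<Longrightarrow> norm (x - y) \<le> \<kappa>" and Dn: "\<And>i x. x \<in> D i \<Longrightarrow> norm x \<le> R"
    using totally_bounded_partition[OF \<kappa>(1), of R] by metis
  \<comment> \<open>At most \<open>k\<close> cells are lighter than \<delta>, and even after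
    weighting by \<open>1 + R\<close> they contribute at most
    \<open>\<epsilon>1 / 2\<close>.\<close>
  define \<delta> where "\<delta> = \<epsilon>1 / (2 * (1 + real k) * (1 + R))"
  have \<delta>: "0 < \<delta>" "real k * \<delta> * (1 + R) \<le> \<epsilon>1 / 2"
  proof -
    have d: "0 < 2 * (1 + real k) * (1 + R)" using R by simp
    then show "0 < \<delta>" using \<epsilon>1 by (simp add: \<delta>_def)
    then have "real k * \<delta> * (1 + R) \<le> (1 + real k) * \<delta> * (1 + R)" using R by (intro mult_right_mono) auto
    moreover have "\<delta> * (2 * (1 + real k) * (1 + R)) = \<epsilon>1"
      unfolding \<delta>_def using d by (metis less_irrefl nonzero_eq_divide_eq)
    ultimately show "real k * \<delta> * (1 + R) \<le> \<epsilon>1 / 2" by (simp add: algebra_simps)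
  qed
  have kd: "0 \<le> real k * \<delta>" "0 \<le> R * (real k * \<delta>)" "real k * \<delta> + R * (real k * \<delta>) \<le> \<epsilon>1 / 2"
    using \<delta> R(1) by (simp_all add: algebra_simps)
  \<comment> \<open>The remainder piece has weight at least \<open>\<epsilon>1\<close> everywhere; a
    retained cell has mass at least \<open>(1 - \<epsilon>1) * \<delta>\<close>, which is at least
    \<open>\<delta> / 2\<close>.\<close>
  define p0 where "p0 = min \<epsilon>1 (\<delta> / 2)"
  define K where "K = max M0 R"
  have "\<exists>I w y. smoothing_of \<mu> T I w y p0 K \<epsilon>"
    if "prob_space \<mu>" and sets_\<mu>[measurable_cong]: "sets \<mu> = sets borel"
      and ui1: "ui_bound \<mu> (\<lambda>x. norm x powr \<rho>) B1" and T[measurable]: "T \<in> borel_measurable borel"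
      and ui2: "ui_bound \<mu> (\<lambda>x. norm (T x)) B2" and i\<theta>: "integrable \<mu> (\<lambda>x. \<theta> (x - T x))"
    for \<mu> :: "'a measure" and T :: "'a \<Rightarrow> 'a"
  proof -
    interpret prob_space \<mu> by fact
    have ix: "integrable \<mu> (\<lambda>x. norm x powr \<rho>)" and iTn: "integrable \<mu> (\<lambda>x. norm (T x))"
      using ui1 ui2 by (auto simp: ui_bound_def)
    have iT: "integrable \<mu> T" by (rule integrable_norm_cancel[OF iTn]) measurable
    have mx: "(\<integral>x. norm x powr \<rho> \<partial>\<mu>) \<le> m1" and mT: "(\<integral>x. norm (T x) \<partial>\<mu>) \<le> K2"
      using ui_bound_mean[OF ui1 B(1)] ui_bound_mean[OF ui2 B(2)] by (auto simp: m1_def K2_def)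
    define C' where "C' i = T -` D i" for i
    have C'm[measurable]: "C' i \<in> sets borel" for i
      unfolding C'_def using measurable_sets[OF T D[of i]] by simp
    have C'd: "i = j" if "x \<in> C' i" "x \<in> C' j" for x i j
      using Dd that by (auto simp: C'_def disjoint_family_on_def)
    define J where "J = {i. i < k \<and> \<delta> \<le> measure \<mu> (C' i)}"
    have J: "finite J" "k \<notin> J" by (auto simp: J_def)
    define G where "G = (\<Union>i\<in>J. C' i)"
    have Gm[measurable]: "G \<in> sets borel" unfolding G_def using J(1) by (intro sets.finite_UN) auto
    have Gsum: "(\<Sum>i\<in>J. indicator (C' i) x) = (indicator G x :: real)" for x
      unfolding G_def using J(1) C'd by (intro indicator_UN_disjoint[symmetric]) (auto simp: disjoint_family_on_def)
    \<comment> \<open>Cells have indices below \<open>k\<close>, so \<open>k\<close> is free for the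
      remainder: everything outside \<open>G\<close> and the fraction \<open>\<epsilon>1\<close> of
      each retained cell.\<close>
    define w where "w i x = (if i = k then 1 - (1 - \<epsilon>1) * indicator G x
        else if i \<in> J then (1 - \<epsilon>1) * indicator (C' i) x else (0::real))" for i x
    define I where "I = insert k J"
    have I: "finite I" "I \<noteq> {}" using J by (auto simp: I_def)
    have wm[measurable]: "w i \<in> borel_measurable borel" for i
      unfolding w_def by (cases "i = k"; cases "i \<in> J") (simp_all, measurable)
    have w0: "0 \<le> w i x" for i x using \<epsilon>1 by (auto simp: w_def indicator_def)
    have w1: "w i x \<le> 1" for i x using \<epsilon>1 by (auto simp: w_def indicator_def)
    have wsumJ: "(\<Sum>i\<in>J. w i x) = 1 - w k x" for x
    proof -
      have "(\<Sum>i\<in>J. w i x) = (\<Sum>i\<in>J. (1 - \<epsilon>1) * indicator (C' i) x)"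
        using J by (intro sum.cong) (auto simp: w_def)
      also have "\<dots> = (1 - \<epsilon>1) * indicator G x" by (simp add: Gsum[symmetric] sum_distrib_left)
      finally show ?thesis by (simp add: w_def)
    qed
    have wsum: "(\<Sum>i\<in>I. w i x) = 1" for x
      using wsumJ J by (simp add: I_def)
    have wk: "\<epsilon>1 \<le> w k x" for x using \<epsilon>1 by (auto simp: w_def indicator_def)
    have iw: "integrable \<mu> (w i)" for i using w0 w1 by (intro integrable_const_bound[of _ 1]) auto
    have iwT: "integrable \<mu> (\<lambda>x. w i x *\<^sub>R T x)" for i
    proof (rule Bochner_Integration.integrable_bound[OF iTn])
      show "AE x in \<mu>. norm (w i x *\<^sub>R T x) \<le> norm (norm (T x))"
        using w0 w1 by (auto intro!: mult_left_le_one_le)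
    qed measurable
    have p0: "p0 \<le> (\<integral>x. w i x \<partial>\<mu>)" if "i \<in> I" for i
    proof (cases "i = k")
      case True
      have "\<epsilon>1 \<le> (\<integral>x. w k x \<partial>\<mu>)" using integral_mono[OF _ iw[of k], of "\<lambda>_. \<epsilon>1"] wk by (simp add: prob_space)
      then show ?thesis using True by (simp add: p0_def)
    next
      case False
      then have i: "i \<in> J" using that by (simp add: I_def)
      have "(\<integral>x. w i x \<partial>\<mu>) = (1 - \<epsilon>1) * measure \<mu> (C' i)"
        using i False sets_eq_imp_space_eq[OF sets_\<mu>] by (simp add: w_def)
      moreover have "\<delta> / 2 \<le> (1 - \<epsilon>1) * measure \<mu> (C' i)"
        using mult_mono[of "1/2" "1 - \<epsilon>1" \<delta> "measure \<mu> (C' i)"] i \<epsilon>1 \<delta> by (simp add: J_def)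
      ultimately show ?thesis by (simp add: p0_def)
    qed
    have p0pos: "0 < p0" using \<epsilon>1 \<delta> by (simp add: p0_def)
    define y where "y i = (1 / (\<integral>x. w i x \<partial>\<mu>)) *\<^sub>R (\<integral>x. w i x *\<^sub>R T x \<partial>\<mu>)" for i
    have y: "(\<integral>x. w i x *\<^sub>R T x \<partial>\<mu>) = (\<integral>x. w i x \<partial>\<mu>) *\<^sub>R y i" if "i \<in> I" for i
      using p0[OF that] p0pos by (simp add: y_def)
    have wC: "x \<in> C' i" if "i \<in> J" "0 < w i x" for i x
      using that J by (auto simp: w_def split: if_splits) (metis indicator_simps(2) mult_zero_right less_irrefl)
    have yJ: "norm (y i) \<le> R" if i: "i \<in> J" for i
    proof -
      have "norm (y i - 0) \<le> R"
      proof (rule norm_weighted_average_diff_le[OF iw w0 iwT refl _ y])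
        show "norm (T x - 0) \<le> R" if "0 < w i x" for x using wC[OF i that] Dn by (simp add: C'_def)
      qed (use p0[of i] p0pos i in \<open>auto simp: I_def\<close>)
      then show ?thesis by simp
    qed
    have yJ2: "norm (y i - T x) \<le> \<kappa>" if i: "i \<in> J" and x: "x \<in> C' i" for i x
    proof (rule norm_weighted_average_diff_le[OF iw w0 iwT refl _ y])
      show "norm (T x' - T x) \<le> \<kappa>" if "0 < w i x'" for x'
        using wC[OF i that] x Ds by (simp add: C'_def)
    qed (use p0[of i] p0pos i in \<open>auto simp: I_def\<close>)
    define tail where "tail x = (indicator {x \<in> space \<mu>. R < norm (T x)} x :: real)" for x
    define small where "small x = (\<Sum>i\<in>{..<k} - J. indicator (C' i) x :: real)" for x
    have sp: "space \<mu> = UNIV" using sets_eq_imp_space_eq[OF sets_\<mu>] by simp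
    have tm[measurable]: "tail \<in> borel_measurable borel" unfolding tail_def sp by measurable
    have sm[measurable]: "small \<in> borel_measurable borel" unfolding small_def by measurable
    have tail0: "0 \<le> tail x" for x by (simp add: tail_def)
    have small0: "0 \<le> small x" for x by (simp add: small_def sum_nonneg)
    \<comment> \<open>In the retained cells the remainder weight is \<open>\<epsilon>1\<close>; any
      other point lies in the tail or in a small cell.\<close>
    have wk_le: "w k x \<le> tail x + small x + \<epsilon>1" for x
    proof (cases "R < norm (T x)")
      case True
      then show ?thesis using w1[of k x] \<epsilon>1 by (simp add: tail_def sp small_def sum_nonneg add_nonneg_nonneg add_increasing2)
    next
      case False
      then have "T x \<in> (\<Union>i<k. D i)" unfolding Dc by simp
      then obtain i where i: "i < k" "x \<in> C' i" by (auto simp: C'_def)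
      show ?thesis
      proof (cases "i \<in> J")
        case True
        then have "x \<in> G" using i by (auto simp: G_def)
        then show ?thesis by (simp add: w_def tail_def small_def sum_nonneg)
      next
        case False
        have "1 \<le> small x"
          using member_le_sum[of i "{..<k} - J" "\<lambda>i. indicator (C' i) x :: real"] i False by (simp add: small_def)
        then show ?thesis using w1[of k x] \<epsilon>1(1) tail0[of x] by linarith
      qed
    qed
    have it: "integrable \<mu> tail" and its: "integrable \<mu> small"
      and itT: "integrable \<mu> (\<lambda>x. norm (T x) * tail x)"
      unfolding tail_def small_def using iTn
      by (auto intro!: integrable_real_mult_indicator simp: less_top[symmetric])
    have tailT: "(\<integral>x. norm (T x) * tail x \<partial>\<mu>) \<le> \<epsilon>1 / 2"
      using ui_bound_tail[OF ui2 _ R(2)] \<epsilon>1 by (simp add: tail_def)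
    have tail1: "(\<integral>x. tail x \<partial>\<mu>) \<le> \<epsilon>1 / 2"
    proof -
      have "(\<integral>x. tail x \<partial>\<mu>) \<le> (\<integral>x. norm (T x) * tail x \<partial>\<mu>)"
        using R(1) by (intro integral_mono[OF it itT]) (auto simp: tail_def indicator_def)
      then show ?thesis using tailT by simp
    qed
    have small1: "(\<integral>x. small x \<partial>\<mu>) \<le> real k * \<delta>"
    proof -
      have "(\<integral>x. small x \<partial>\<mu>) = (\<Sum>i\<in>{..<k} - J. measure \<mu> (C' i))"
        unfolding small_def by (subst Bochner_Integration.integral_sum) (auto simp: sp less_top[symmetric])
      also have "\<dots> \<le> (\<Sum>i\<in>{..<k} - J. \<delta>)" by (intro sum_mono) (auto simp: J_def)
      also have "\<dots> \<le> real k * \<delta>"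
        using \<delta>(1) card_mono[of "{..<k}" "{..<k} - J"] by (simp add: mult_right_mono)
      finally show ?thesis .
    qed
    have Wk: "(\<integral>x. w k x \<partial>\<mu>) \<le> 2 * \<epsilon>1"
    proof -
      have "(\<integral>x. w k x \<partial>\<mu>) \<le> (\<integral>x. tail x + small x + \<epsilon>1 \<partial>\<mu>)"
        using iw it its wk_le by (intro integral_mono) auto
      also have "\<dots> = (\<integral>x. tail x \<partial>\<mu>) + (\<integral>x. small x \<partial>\<mu>) + \<epsilon>1"
        using it its by (simp add: prob_space)
      also have "\<dots> \<le> \<epsilon>1 / 2 + real k * \<delta> + \<epsilon>1" using tail1 small1 by simp
      also have "\<dots> \<le> 2 * \<epsilon>1" using kd by simp
      finally show ?thesis .
    qed
    have iwTn: "integrable \<mu> (\<lambda>x. w k x * norm (T x))"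
      using integrable_norm[OF iwT[of k]] w0 by simp
    have WT: "(\<integral>x. w k x * norm (T x) \<partial>\<mu>) \<le> \<epsilon>1 * (1 + K2)"
    proof -
      have "w k x * norm (T x) \<le> norm (T x) * tail x + R * small x + \<epsilon>1 * norm (T x)" for x
      proof -
        have "w k x * norm (T x) \<le> (tail x + small x + \<epsilon>1) * norm (T x)"
          using wk_le by (intro mult_right_mono) auto
        moreover have "small x * norm (T x) \<le> R * small x"
        proof (cases "small x = 0")
          case False
          then have "\<exists>i\<in>{..<k} - J. indicator (C' i) x \<noteq> (0::real)"
            unfolding small_def by (rule contrapos_np) (auto intro!: sum.neutral)
          then obtain i where "x \<in> C' i" by (auto simp: indicator_def)
          then have "norm (T x) \<le> R" using Dn[of "T x" i] by (simp add: C'_def)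
          then show ?thesis using mult_left_mono[of "norm (T x)" R "small x"] small0[of x] by (simp add: mult.commute)
        qed simp
        ultimately show ?thesis by (simp add: algebra_simps)
      qed
      then have "(\<integral>x. w k x * norm (T x) \<partial>\<mu>) \<le> (\<integral>x. norm (T x) * tail x + R * small x + \<epsilon>1 * norm (T x) \<partial>\<mu>)"
        using iwTn itT its iTn by (intro integral_mono) auto
      also have "\<dots> = (\<integral>x. norm (T x) * tail x \<partial>\<mu>) + R * (\<integral>x. small x \<partial>\<mu>) + \<epsilon>1 * (\<integral>x. norm (T x) \<partial>\<mu>)"
        using itT its iTn by simp
      also have "\<dots> \<le> \<epsilon>1 / 2 + R * (real k * \<delta>) + \<epsilon>1 * K2"
        using tailT small1 mT R \<epsilon>1 by (intro add_mono mult_left_mono) auto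
      also have "\<dots> \<le> \<epsilon>1 * (1 + K2)"
        using kd by (simp add: distrib_left)
      finally show ?thesis .
    qed
    \<comment> \<open>The remainder weight has mass at least \<open>\<epsilon>1\<close> and first
      moment at most \<open>\<epsilon>1 * (1 + K2)\<close>, so \<open>\<epsilon>1\<close> cancels.
      Hence \<open>M0\<close> could be fixed before \<open>\<epsilon>1\<close> without
      circularity.\<close>
    have yk: "norm (y k) \<le> M0"
    proof -
      have "(\<integral>x. w k x \<partial>\<mu>) \<ge> \<epsilon>1" using integral_mono[OF _ iw[of k], of "\<lambda>_. \<epsilon>1"] wk by (simp add: prob_space)
      moreover have "(\<integral>x. w k x \<partial>\<mu>) * norm (y k) \<le> \<epsilon>1 * M0"
      proof -
        have "norm ((\<integral>x. w k x \<partial>\<mu>) *\<^sub>R y k) = norm (\<integral>x. w k x *\<^sub>R T x \<partial>\<mu>)" using y[of k] by (simp add: I_def)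
        also have "\<dots> \<le> (\<integral>x. w k x * norm (T x) \<partial>\<mu>)"
          using integral_norm_bound[of \<mu> "\<lambda>x. w k x *\<^sub>R T x"] w0 by simp
        finally show ?thesis using WT w0 by (simp add: M0_def abs_of_nonneg integral_nonneg)
      qed
      ultimately have "\<epsilon>1 * norm (y k) \<le> \<epsilon>1 * M0" using mult_right_mono[of \<epsilon>1 "\<integral>x. w k x \<partial>\<mu>" "norm (y k)"] by simp
      then show ?thesis using \<epsilon>1(1) by simp
    qed
    have yK: "norm (y i) \<le> K" if "i \<in> I" for i
      using that yk yJ by (auto simp: I_def K_def le_max_iff_disj)
    define S where "S x = (\<Sum>i\<in>I. w i x *\<^sub>R y i)" for x
    have Sm[measurable]: "S \<in> borel_measurable borel" unfolding S_def by measurable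
    have SK: "norm (S x) \<le> K" for x
    proof -
      have "norm (S x) \<le> (\<Sum>i\<in>I. w i x * K)"
        unfolding S_def using w0 yK by (intro sum_norm_le) (auto intro!: mult_left_mono)
      then show ?thesis using wsum[of x] by (simp add: sum_distrib_right[symmetric])
    qed
    have iS: "integrable \<mu> (\<lambda>x. norm (S x - T x))"
    proof -
      have "integrable \<mu> S" using SK by (intro integrable_const_bound[of _ K]) auto
      then show ?thesis using iT by auto
    qed
    have L1: "(\<integral>x. norm (S x - T x) \<partial>\<mu>) \<le> \<epsilon>"
    proof -
      have "norm (S x - T x) \<le> M0 * w k x + w k x * norm (T x) + \<kappa>" for x
      proof -
        have "S x - T x = (\<Sum>i\<in>I. w i x *\<^sub>R (y i - T x))"
          using wsum[of x] by (simp add: S_def scaleR_diff_right sum_subtractf scaleR_left.sum[symmetric])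
        also have "\<dots> = w k x *\<^sub>R (y k - T x) + (\<Sum>i\<in>J. w i x *\<^sub>R (y i - T x))"
          using J by (simp add: I_def)
        finally have "norm (S x - T x) \<le> norm (w k x *\<^sub>R (y k - T x)) + norm (\<Sum>i\<in>J. w i x *\<^sub>R (y i - T x))"
          using norm_triangle_ineq by metis
        also have "norm (w k x *\<^sub>R (y k - T x)) \<le> w k x * (M0 + norm (T x))"
          using w0[of k x] yk norm_triangle_ineq4[of "y k" "T x"] by (simp add: mult_left_mono)
        also have "norm (\<Sum>i\<in>J. w i x *\<^sub>R (y i - T x)) \<le> (\<Sum>i\<in>J. w i x * \<kappa>)"
        proof (rule sum_norm_le)
          fix i assume i: "i \<in> J"
          show "norm (w i x *\<^sub>R (y i - T x)) \<le> w i x * \<kappa>"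
            using w0[of i x] yJ2[OF i] wC[OF i, of x] by (cases "w i x = 0") (auto intro!: mult_left_mono)
        qed
        also have "(\<Sum>i\<in>J. w i x * \<kappa>) \<le> \<kappa>"
          using wsumJ[of x] w0[of k x] \<kappa>(1) by (simp add: sum_distrib_right[symmetric] mult_left_le_one_le w1)
        finally show ?thesis by (simp add: algebra_simps)
      qed
      then have "(\<integral>x. norm (S x - T x) \<partial>\<mu>) \<le> (\<integral>x. M0 * w k x + w k x * norm (T x) + \<kappa> \<partial>\<mu>)"
        using iS iw iwTn by (intro integral_mono) auto
      also have "\<dots> = M0 * (\<integral>x. w k x \<partial>\<mu>) + (\<integral>x. w k x * norm (T x) \<partial>\<mu>) + \<kappa>"
        using iw iwTn by (simp add: prob_space)
      also have "\<dots> \<le> M0 * (2 * \<epsilon>1) + \<epsilon>1 * (1 + K2) + \<epsilon> / 2"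
        using Wk WT \<kappa>(3) nn by (intro add_mono mult_left_mono) auto
      also have "\<dots> \<le> \<epsilon>" using Q2 by (simp add: algebra_simps)
      finally show ?thesis .
    qed
    have cost: "(\<integral>x. \<theta> (x - S x) \<partial>\<mu>) \<le> (\<integral>x. \<theta> (x - T x) \<partial>\<mu>) + \<epsilon>"
    proof -
      define E where "E x = \<kappa> * C * (2 + 2 powr \<rho> * (norm x powr \<rho> + R powr \<rho>))" for x :: 'a
      have E0: "0 \<le> E x" for x using \<kappa>(1) C_pos by (simp add: E_def)
      \<comment> \<open>Convexity splits the cost over the pieces. The cells cost only the local
        shift \<open>E\<close>, while the remainder costs its weight times a crude growth
        bound.\<close>
      have pt: "\<theta> (x - S x) \<le> \<theta> (x - T x) + (A1 * w k x + A2 * (w k x * norm x powr \<rho>) + a * (w k x * norm (T x))) + E x" for x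
      proof -
        have xS: "x - S x = (\<Sum>i\<in>I. w i x *\<^sub>R (x - y i))"
          using wsum[of x] by (simp add: S_def scaleR_diff_right sum_subtractf scaleR_left.sum[symmetric])
        have "\<theta> (x - S x) \<le> (\<Sum>i\<in>I. w i x * \<theta> (x - y i))"
          unfolding xS using convex_on_sum[OF I convex wsum] w0 by auto
        also have "\<dots> = w k x * \<theta> (x - y k) + (\<Sum>i\<in>J. w i x * \<theta> (x - y i))" using J by (simp add: I_def)
        also have "(\<Sum>i\<in>J. w i x * \<theta> (x - y i)) \<le> (\<Sum>i\<in>J. w i x * (\<theta> (x - T x) + E x))"
        proof (rule sum_mono)
          fix i assume i: "i \<in> J"
          have "\<theta> (x - y i) \<le> \<theta> (x - T x) + E x" if "x \<in> C' i"
          proof -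
            have "\<theta> ((x - T x) + (T x - y i)) \<le> \<theta> (x - T x) + \<kappa> * C * (1 + norm (x - T x) powr \<rho> + norm (T x - y i) powr \<rho> / \<kappa> powr \<rho>)"
              using \<kappa>(1,2) by (rule cost_shift)
            also have "\<kappa> * C * (1 + norm (x - T x) powr \<rho> + norm (T x - y i) powr \<rho> / \<kappa> powr \<rho>) \<le> E x"
              unfolding E_def
            proof (intro mult_left_mono)
              have "norm (T x - y i) powr \<rho> / \<kappa> powr \<rho> \<le> 1"
                using yJ2[OF i that] \<kappa>(1) \<rho> by (simp add: norm_minus_commute powr_mono2)
              moreover have "norm (x - T x) powr \<rho> \<le> 2 powr \<rho> * (norm x powr \<rho> + R powr \<rho>)"
              proof -
                have "norm (T x) powr \<rho> \<le> R powr \<rho>" using Dn[of "T x" i] that \<rho> by (intro powr_mono2) (auto simp: C'_def)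
                then have "2 powr \<rho> * (norm x powr \<rho> + norm (T x) powr \<rho>) \<le> 2 powr \<rho> * (norm x powr \<rho> + R powr \<rho>)"
                  by (intro mult_left_mono) auto
                then show ?thesis using norm_diff_powr_le[of \<rho> x "T x"] \<rho> by linarith
              qed
              ultimately show "1 + norm (x - T x) powr \<rho> + norm (T x - y i) powr \<rho> / \<kappa> powr \<rho>
                  \<le> 2 + 2 powr \<rho> * (norm x powr \<rho> + R powr \<rho>)" by linarith
            qed (use \<kappa>(1) C_pos in simp)
            finally show ?thesis by simp
          qed
          then show "w i x * \<theta> (x - y i) \<le> w i x * (\<theta> (x - T x) + E x)"
            using wC[OF i, of x] w0[of i x] by (cases "w i x = 0") (auto intro!: mult_left_mono)
        qed
        also have "(\<Sum>i\<in>J. w i x * (\<theta> (x - T x) + E x)) = (1 - w k x) * (\<theta> (x - T x) + E x)"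
          using wsumJ[of x] by (simp add: sum_distrib_right[symmetric])
        also have "\<dots> \<le> \<theta> (x - T x) + w k x * (- \<theta> (x - T x)) + E x"
          using mult_nonneg_nonneg[OF w0[of k x] E0[of x]] by (simp add: algebra_simps)
        finally have "\<theta> (x - S x) \<le> \<theta> (x - T x) + w k x * (\<theta> (x - y k) - \<theta> (x - T x)) + E x" by (simp add: algebra_simps)
        also have "w k x * (\<theta> (x - y k) - \<theta> (x - T x)) \<le> w k x * (A1 + A2 * norm x powr \<rho> + a * norm (T x))"
        proof (rule mult_left_mono[OF _ w0])
          have "c * norm (x - y k) powr \<rho> \<le> c * (2 powr \<rho> * (norm x powr \<rho> + M0 powr \<rho>))"
          proof (rule mult_left_mono)
            have "2 powr \<rho> * (norm x powr \<rho> + norm (y k) powr \<rho>) \<le> 2 powr \<rho> * (norm x powr \<rho> + M0 powr \<rho>)"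
              using yk \<rho> by (intro mult_left_mono add_left_mono powr_mono2) auto
            then show "norm (x - y k) powr \<rho> \<le> 2 powr \<rho> * (norm x powr \<rho> + M0 powr \<rho>)"
              using norm_diff_powr_le[of \<rho> x "y k"] \<rho> by linarith
          qed (use c in simp)
          moreover have "a * norm (x - T x) \<le> a * (1 + norm x powr \<rho> + norm (T x))"
            using le_1_powr[OF norm_ge_zero \<rho>, of x] norm_triangle_ineq4[of x "T x"] a by (intro mult_left_mono) auto
          ultimately show "\<theta> (x - y k) - \<theta> (x - T x) \<le> A1 + A2 * norm x powr \<rho> + a * norm (T x)"
            using upper[of "x - y k"] lower[of "x - T x"] unfolding A1_def A2_def by (simp add: algebra_simps)
        qed
        finally show ?thesis by (simp add: algebra_simps)
      qed
      \<comment> \<open>The remainder weight is small in mass only; uniform integrability makes it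
        small against the growing factor too.\<close>
      have iwx: "integrable \<mu> (\<lambda>x. w k x * norm x powr \<rho>)" and Wx: "(\<integral>x. w k x * norm x powr \<rho> \<partial>\<mu>) \<le> B1 e1 * (\<integral>x. w k x \<partial>\<mu>) + e1"
        using ui_bound_weighted[OF ui1 B(1) e1(1) _ w0 w1] by auto
      have iE: "integrable \<mu> E" unfolding E_def using ix by auto
      have iS: "integrable \<mu> (\<lambda>x. \<theta> (x - S x))"
      proof (rule cost_integrable[OF finite_measure_axioms])
        show "integrable \<mu> (\<lambda>x. norm (S x) powr \<rho>)"
          using SK \<rho> by (intro integrable_const_bound[of _ "K powr \<rho>"]) (auto intro!: powr_mono2)
      qed (use ix in auto)
      have "(\<integral>x. \<theta> (x - S x) \<partial>\<mu>) \<le> (\<integral>x. \<theta> (x - T x) + (A1 * w k x + A2 * (w k x * norm x powr \<rho>) + a * (w k x * norm (T x))) + E x \<partial>\<mu>)"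
        using iS i\<theta> iw iwx iwTn iE pt by (intro integral_mono) auto
      also have "\<dots> = (\<integral>x. \<theta> (x - T x) \<partial>\<mu>) + (A1 * (\<integral>x. w k x \<partial>\<mu>) + A2 * (\<integral>x. w k x * norm x powr \<rho> \<partial>\<mu>)
          + a * (\<integral>x. w k x * norm (T x) \<partial>\<mu>)) + (\<integral>x. E x \<partial>\<mu>)"
        using i\<theta> iw iwx iwTn iE by simp
      also have "(\<integral>x. E x \<partial>\<mu>) = \<kappa> * C * (2 + 2 powr \<rho> * ((\<integral>x. norm x powr \<rho> \<partial>\<mu>) + R powr \<rho>))"
        unfolding E_def using ix by (simp add: prob_space)
      also have "\<dots> \<le> \<kappa> * C * (2 + 2 powr \<rho> * (m1 + R powr \<rho>))"
        using mx \<kappa>(1) C_pos by (intro mult_left_mono add_left_mono add_right_mono) auto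
      also have "\<dots> \<le> \<epsilon> / 2" using \<kappa>(4) by (simp add: H_def mult.assoc)
      also have "A1 * (\<integral>x. w k x \<partial>\<mu>) + A2 * (\<integral>x. w k x * norm x powr \<rho> \<partial>\<mu>) + a * (\<integral>x. w k x * norm (T x) \<partial>\<mu>)
          \<le> A1 * (2 * \<epsilon>1) + A2 * (B1 e1 * (2 * \<epsilon>1) + e1) + a * (\<epsilon>1 * (1 + K2))"
        using Wk Wx WT A a B(1)[of e1] mult_left_mono[OF Wk B(1)[of e1]] by (intro add_mono mult_left_mono) auto
      also have "\<dots> \<le> \<epsilon> / 2" using Q1 by (simp add: algebra_simps)
      finally show ?thesis by simp
    qed
    show ?thesis
      unfolding smoothing_of_def
      by (rule exI[of _ I], rule exI[of _ w], rule exI[of _ y], intro conjI allI ballI)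
        (erule p0 y yK | fact I wm w0 wsum L1[unfolded S_def] cost[unfolded S_def])+
  qed
  moreover have "0 < p0" "0 \<le> K" using \<epsilon>1 \<delta> nn by (auto simp: p0_def K_def)
  ultimately show ?thesis by blast
qed

section \<open>Stability of competitors\<close>

lemma couplingD:
  fixes \<pi> :: "('a::euclidean_space \<times> 'a) measure"
  assumes "\<pi> \<in> couplings \<mu> \<eta>"
  shows "sets \<pi> = sets borel" "fst \<in> borel_measurable \<pi>" "snd \<in> borel_measurable \<pi>"
    "distr \<pi> borel fst = \<mu>" "distr \<pi> borel snd = \<eta>"
proof -
  show s: "sets \<pi> = sets borel" "distr \<pi> borel fst = \<mu>" "distr \<pi> borel snd = \<eta>"
    using assms by (auto simp: couplings_def)
  have "fst \<in> borel_measurable (borel :: ('a \<times> 'a) measure)" "snd \<in> borel_measurable (borel :: ('a \<times> 'a) measure)"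
    by (auto intro!: borel_measurable_continuous_onI continuous_intros)
  then show "fst \<in> borel_measurable \<pi>" "snd \<in> borel_measurable \<pi>"
    using measurable_cong_sets[OF s(1) refl] by blast+
qed

lemma coupling_prob_space:
  assumes "\<pi> \<in> couplings \<mu> \<eta>" "prob_space \<mu>"
  shows "prob_space \<pi>"
  using prob_space_distrD[OF couplingD(2)[OF assms(1)]] assms(2) by (simp add: couplingD(4)[OF assms(1)])

lemma coupling_fst:
  fixes f :: "'a::euclidean_space \<Rightarrow> 'c::{banach, second_countable_topology}"
  assumes "\<pi> \<in> couplings \<mu> \<eta>" "f \<in> borel_measurable borel"
  shows "integrable \<pi> (\<lambda>p. f (fst p)) \<longleftrightarrow> integrable \<mu> f" "(\<integral>p. f (fst p) \<partial>\<pi>) = (\<integral>x. f x \<partial>\<mu>)"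
  using integrable_distr_eq[OF couplingD(2)[OF assms(1)] assms(2)] integral_distr[OF couplingD(2)[OF assms(1)] assms(2)]
  by (simp_all add: couplingD(4)[OF assms(1)])

lemma coupling_snd:
  fixes f :: "'a::euclidean_space \<Rightarrow> 'c::{banach, second_countable_topology}"
  assumes "\<pi> \<in> couplings \<mu> \<eta>" "f \<in> borel_measurable borel"
  shows "integrable \<pi> (\<lambda>p. f (snd p)) \<longleftrightarrow> integrable \<eta> f" "(\<integral>p. f (snd p) \<partial>\<pi>) = (\<integral>x. f x \<partial>\<eta>)"
  using integrable_distr_eq[OF couplingD(3)[OF assms(1)] assms(2)] integral_distr[OF couplingD(3)[OF assms(1)] assms(2)]
  by (simp_all add: couplingD(5)[OF assms(1)])

lemma coupling_nn_snd:
  assumes "\<pi> \<in> couplings \<mu> \<eta>" "f \<in> borel_measurable borel"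
  shows "(\<integral>\<^sup>+p. f (snd p) \<partial>\<pi>) = (\<integral>\<^sup>+x. f x \<partial>\<eta>)"
proof -
  have "f \<in> borel_measurable (distr \<pi> borel snd)" using assms(2) by simp
  from nn_integral_distr[OF couplingD(3)[OF assms(1)] this] show ?thesis by (simp add: couplingD(5)[OF assms(1)])
qed

lemma coupling_powr_integrable:
  assumes \<pi>: "\<pi> \<in> couplings \<alpha> \<beta>" and "\<alpha> \<in> prob_moment \<rho>" "\<beta> \<in> prob_moment \<rho>" "0 \<le> \<rho>"
  shows "integrable \<pi> (\<lambda>p. norm (fst p - snd p) powr \<rho>)"
proof (rule Bochner_Integration.integrable_bound)
  have [measurable]: "fst \<in> borel_measurable \<pi>" "snd \<in> borel_measurable \<pi>" using couplingD[OF \<pi>] by auto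
  show "integrable \<pi> (\<lambda>p. 2 powr \<rho> * (norm (fst p) powr \<rho> + norm (snd p) powr \<rho>))"
    using assms coupling_fst(1)[OF \<pi>, of "\<lambda>x. norm x powr \<rho>"] coupling_snd(1)[OF \<pi>, of "\<lambda>x. norm x powr \<rho>"]
    by (auto simp: prob_moment_def)
  show "(\<lambda>p. norm (fst p - snd p) powr \<rho>) \<in> borel_measurable \<pi>" by measurable
  show "AE p in \<pi>. norm (norm (fst p - snd p) powr \<rho>) \<le> norm (2 powr \<rho> * (norm (fst p) powr \<rho> + norm (snd p) powr \<rho>))"
    using norm_diff_powr_le[OF \<open>0 \<le> \<rho>\<close>] by (intro AE_I2) (simp add: order_trans[OF _ abs_ge_self])
qed

lemma ui_bound_convex_order:
  assumes "distr M borel Y \<le>\<^sub>c \<nu>" "Y \<in> borel_measurable M" "ui_bound \<nu> norm B"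
  shows "ui_bound M (\<lambda>x. norm (Y x)) B"
  unfolding ui_bound_def
proof (intro conjI allI impI)
  note d = convex_order_distrD[OF assms(1,2)]
  have i: "integrable \<nu> norm" and e: "\<And>e. 0 < e \<Longrightarrow> (\<integral>x. max 0 (norm x - B e) \<partial>\<nu>) \<le> e"
    using assms(3) by (auto simp: ui_bound_def)
  show "integrable M (\<lambda>x. norm (Y x))" using d(2) by auto
  interpret \<nu>: prob_space \<nu> using d(3) by (simp add: prob_moment_1_iff)
  fix e :: real assume "0 < e"
  show "(\<integral>x. max 0 (norm (Y x) - B e) \<partial>M) \<le> e"
    using d(6)[OF convex_on_norm_excess, of "B e"] e[OF \<open>0 < e\<close>] i by auto
qed

lemma integrable_Max_affine:
  fixes \<beta> :: "'i \<Rightarrow> 'a::euclidean_space"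
  assumes "finite I" "I \<noteq> {}" "\<nu> \<in> prob_moment 1"
  shows "integrable \<nu> (\<lambda>z. Max ((\<lambda>j. \<alpha> j + \<beta> j \<bullet> z) ` I))"
proof -
  interpret prob_space \<nu> using assms by (simp add: prob_moment_1_iff)
  have s: "sets \<nu> = sets borel" and i: "integrable \<nu> (\<lambda>x. x)" using assms by (auto simp: prob_moment_1_iff)
  show ?thesis
  proof (rule Bochner_Integration.integrable_bound)
    show "integrable \<nu> (\<lambda>z. \<Sum>j\<in>I. \<bar>\<alpha> j + \<beta> j \<bullet> z\<bar>)" using i by auto
    show "(\<lambda>z. Max ((\<lambda>j. \<alpha> j + \<beta> j \<bullet> z) ` I)) \<in> borel_measurable \<nu>"
      using convex_borel_measurable[OF convex_on_Max_affine[OF assms(1,2), of \<alpha> \<beta>]] measurable_cong_sets[OF s refl] by blast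
    show "AE z in \<nu>. norm (Max ((\<lambda>j. \<alpha> j + \<beta> j \<bullet> z) ` I)) \<le> norm (\<Sum>j\<in>I. \<bar>\<alpha> j + \<beta> j \<bullet> z\<bar>)"
    proof (rule AE_I2)
      fix z
      have "Max ((\<lambda>j. \<alpha> j + \<beta> j \<bullet> z) ` I) \<in> (\<lambda>j. \<alpha> j + \<beta> j \<bullet> z) ` I" using assms by (intro Max_in) auto
      then obtain j where "j \<in> I" "Max ((\<lambda>j. \<alpha> j + \<beta> j \<bullet> z) ` I) = \<alpha> j + \<beta> j \<bullet> z" by auto
      then show "norm (Max ((\<lambda>j. \<alpha> j + \<beta> j \<bullet> z) ` I)) \<le> norm (\<Sum>j\<in>I. \<bar>\<alpha> j + \<beta> j \<bullet> z\<bar>)"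
        using member_le_sum[of j I "\<lambda>j. \<bar>\<alpha> j + \<beta> j \<bullet> z\<bar>"] assms(1) by simp
    qed
  qed
qed

lemma integrable_weight_mult:
  fixes f :: "'b \<Rightarrow> 'c::{banach, second_countable_topology}"
  assumes f: "integrable M f" and [measurable]: "w \<in> borel_measurable M" and w: "\<And>x. 0 \<le> w x" "\<And>x. w x \<le> (1::real)"
  shows "integrable M (\<lambda>x. w x *\<^sub>R f x)"
proof (rule Bochner_Integration.integrable_bound[OF f])
  show "(\<lambda>x. w x *\<^sub>R f x) \<in> borel_measurable M" using f by measurable
  show "AE x in M. norm (w x *\<^sub>R f x) \<le> norm (f x)"
    using w by (intro AE_I2) (simp add: mult_left_le_one_le)
qed

text \<open>The martingale weights that transport the averages of \<open>T\<close> to \<open>\<nu>\<close> are pushed along a coupling of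
  \<open>\<nu>\<close> and \<open>\<nu>'\<close>.\<close>

lemma convex_order_transport:
  fixes T :: "'a::euclidean_space \<Rightarrow> 'a" and w :: "nat \<Rightarrow> 'a \<Rightarrow> real" and y :: "nat \<Rightarrow> 'a"
  assumes sets_\<mu>[measurable_cong]: "sets \<mu> = sets borel" and T[measurable]: "T \<in> borel_measurable borel"
    and le: "distr \<mu> borel T \<le>\<^sub>c \<nu>"
    and I: "finite I" "I \<noteq> {}" and wm[measurable]: "\<And>i. w i \<in> borel_measurable borel"
    and w0: "\<And>i x. 0 \<le> w i x" and wsum: "\<And>x. (\<Sum>i\<in>I. w i x) = 1"
    and p0: "0 < p0" "\<And>i. i \<in> I \<Longrightarrow> p0 \<le> (\<integral>x. w i x \<partial>\<mu>)"
    and y: "\<And>i. i \<in> I \<Longrightarrow> (\<integral>x. w i x *\<^sub>R T x \<partial>\<mu>) = (\<integral>x. w i x \<partial>\<mu>) *\<^sub>R y i"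
    and \<xi>: "\<xi> \<in> couplings \<nu> \<nu>'" and \<nu>': "\<nu>' \<in> prob_moment 1"
    and \<delta>: "0 < \<delta>" and i\<xi>: "integrable \<xi> (\<lambda>p. norm (snd p - fst p))" "(\<integral>p. norm (snd p - fst p) \<partial>\<xi>) \<le> \<delta>"
  shows "\<exists>y'. (\<forall>i\<in>I. norm (y' i - y i) \<le> 2 * \<delta> / p0) \<and> distr \<mu> borel (\<lambda>x. \<Sum>i\<in>I. w i x *\<^sub>R y' i) \<le>\<^sub>c \<nu>'"
proof -
  have Tm: "T \<in> borel_measurable \<mu>" by measurable
  note d = convex_order_distrD[OF le Tm]
  interpret prob_space \<mu> by (rule d(1))
  interpret \<nu>: prob_space \<nu> using d(3) by (simp add: prob_moment_1_iff)
  have iz: "integrable \<nu> (\<lambda>z. z)" "sets \<nu> = sets borel" using d(3) by (auto simp: prob_moment_1_iff)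
  interpret \<xi>: prob_space \<xi> using coupling_prob_space[OF \<xi> \<nu>.prob_space_axioms] .
  have [measurable]: "fst \<in> borel_measurable \<xi>" "snd \<in> borel_measurable \<xi>" using couplingD[OF \<xi>] by auto
  have w1: "w i x \<le> 1" if "i \<in> I" for i x
    using that member_le_sum[of i I "\<lambda>i. w i x"] w0 wsum I(1) by auto
  have iw: "integrable \<mu> (w i)" if "i \<in> I" for i using w0 w1[OF that] by (intro integrable_const_bound[of _ 1]) auto
  define p where "p i = (\<integral>x. w i x \<partial>\<mu>)" for i
  have p: "0 < p i" "p0 \<le> p i" if "i \<in> I" for i using p0 p0(2)[OF that] by (auto simp: p_def)
  have psum: "(\<Sum>i\<in>I. p i) = 1"
  proof -
    have "(\<Sum>i\<in>I. p i) = (\<integral>x. (\<Sum>i\<in>I. w i x) \<partial>\<mu>)"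
      unfolding p_def using iw by (subst Bochner_Integration.integral_sum) auto
    then show ?thesis using wsum by (simp add: prob_space)
  qed
  \<comment> \<open>The finitely supported law of the averages is below \<nu> on maxima of affine
    functions: Jensen on each weighted piece, then the order for the law of
    \<open>T\<close>.\<close>
  have aff: "(\<Sum>i\<in>I. p i * Max ((\<lambda>j. \<alpha> j + \<beta> j \<bullet> y i) ` I)) \<le> (\<integral>z. Max ((\<lambda>j. \<alpha> j + \<beta> j \<bullet> z) ` I) \<partial>\<nu>)" for \<alpha> \<beta>
  proof -
    define \<phi> where "\<phi> z = Max ((\<lambda>j. \<alpha> j + \<beta> j \<bullet> z) ` I)" for z
    have c: "convex_on UNIV \<phi>" unfolding \<phi>_def using I by (rule convex_on_Max_affine)
    have i\<nu>: "integrable \<nu> \<phi>" unfolding \<phi>_def using I d(3) by (rule integrable_Max_affine)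
    have i\<mu>: "integrable \<mu> (\<lambda>x. \<phi> (T x))" using d(5)[OF c i\<nu>] .
    have iwi: "integrable \<mu> (\<lambda>x. w i x * \<phi> (T x))" if "i \<in> I" for i
      using integrable_weight_mult[OF i\<mu> _ w0 w1[OF that]] by simp
    have "p i * \<phi> (y i) \<le> (\<integral>x. w i x * \<phi> (T x) \<partial>\<mu>)" if i: "i \<in> I" for i
    proof -
      have "(1 / p i) *\<^sub>R (\<integral>x. w i x *\<^sub>R T x \<partial>\<mu>) = y i" using y[OF i] p(1)[OF i] by (simp add: p_def)
      then show ?thesis
        using jensen_weighted[OF c iw[OF i] w0 refl _ integrable_weight_mult[OF d(2) _ w0 w1[OF i]] iwi[OF i]] p(1)[OF i]
        by (simp add: p_def)
    qed
    then have "(\<Sum>i\<in>I. p i * \<phi> (y i)) \<le> (\<Sum>i\<in>I. \<integral>x. w i x * \<phi> (T x) \<partial>\<mu>)" by (intro sum_mono)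
    also have "\<dots> = (\<integral>x. (\<Sum>i\<in>I. w i x) * \<phi> (T x) \<partial>\<mu>)"
      using iwi by (simp add: sum_distrib_right)
    also have "\<dots> \<le> (\<integral>z. \<phi> z \<partial>\<nu>)" using d(6)[OF c i\<nu>] wsum by simp
    finally show ?thesis by (simp add: \<phi>_def)
  qed
  have "\<exists>g :: nat \<Rightarrow> 'a \<Rightarrow> real. (\<forall>i. g i \<in> borel_measurable borel) \<and> (\<forall>i\<in>I. \<forall>z. 0 \<le> g i z) \<and>
    (\<forall>z. (\<Sum>i\<in>I. g i z) = 1) \<and> (\<forall>i\<in>I. (\<integral>z. g i z \<partial>\<nu>) = p i) \<and>
    (\<forall>i\<in>I. norm ((\<integral>z. g i z *\<^sub>R z \<partial>\<nu>) - p i *\<^sub>R y i) \<le> \<delta>)"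
    by (rule approx_strassen[OF I d(3) _ psum aff \<delta>]) (rule p(1))
  then obtain g :: "nat \<Rightarrow> 'a \<Rightarrow> real" where "(\<forall>i. g i \<in> borel_measurable borel) \<and> (\<forall>i\<in>I. \<forall>z. 0 \<le> g i z) \<and>
    (\<forall>z. (\<Sum>i\<in>I. g i z) = 1) \<and> (\<forall>i\<in>I. (\<integral>z. g i z \<partial>\<nu>) = p i) \<and>
    (\<forall>i\<in>I. norm ((\<integral>z. g i z *\<^sub>R z \<partial>\<nu>) - p i *\<^sub>R y i) \<le> \<delta>)"
    by (rule exE)
  then have g[measurable]: "\<And>i. g i \<in> borel_measurable borel"
    and g0: "\<And>i z. i \<in> I \<Longrightarrow> 0 \<le> g i z" and gsum: "\<And>z. (\<Sum>i\<in>I. g i z) = (1::real)"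
    and gp: "\<And>i. i \<in> I \<Longrightarrow> (\<integral>z. g i z \<partial>\<nu>) = p i"
    and gy: "\<And>i. i \<in> I \<Longrightarrow> norm ((\<integral>z. g i z *\<^sub>R z \<partial>\<nu>) - p i *\<^sub>R y i) \<le> \<delta>"
    by simp_all
  have g1: "g i z \<le> 1" if "i \<in> I" for i z
    using that member_le_sum[of i I "\<lambda>i. g i z"] g0 gsum I(1) by auto
  have ig: "integrable \<xi> (\<lambda>q. g i (fst q))" if "i \<in> I" for i
    using g0[OF that] g1[OF that] by (intro \<xi>.integrable_const_bound[of _ 1]) auto
  have if1: "integrable \<xi> fst" using coupling_fst(1)[OF \<xi> measurable_ident] iz(1) by (simp add: id_def)
  have is1: "integrable \<xi> snd" using coupling_snd(1)[OF \<xi> measurable_ident] \<nu>' by (simp add: prob_moment_1_iff id_def)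
  have igs: "integrable \<xi> (\<lambda>q. g i (fst q) *\<^sub>R snd q)" "integrable \<xi> (\<lambda>q. g i (fst q) *\<^sub>R fst q)" if "i \<in> I" for i
    using g0[OF that] g1[OF that]
    by (auto intro!: integrable_weight_mult[OF is1] integrable_weight_mult[OF if1])
  \<comment> \<open>The i-th martingale weight is evaluated at the first coordinate of \<xi>, and
    \<open>y' i\<close> is the resulting mean of the second coordinate.\<close>
  define y' where "y' i = (1 / p i) *\<^sub>R (\<integral>q. g i (fst q) *\<^sub>R snd q \<partial>\<xi>)" for i
  have y': "p i *\<^sub>R y' i = (\<integral>q. g i (fst q) *\<^sub>R snd q \<partial>\<xi>)" if "i \<in> I" for i using p[OF that] by (simp add: y'_def)
  \<comment> \<open>One \<delta> comes from the cost of \<xi>, the other from the Strassen error;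
    division by the mass of the piece brings in \<open>p0\<close>.\<close>
  have near: "norm (y' i - y i) \<le> 2 * \<delta> / p0" if i: "i \<in> I" for i
  proof -
    have "(\<integral>z. g i z *\<^sub>R z \<partial>\<nu>) = (\<integral>q. g i (fst q) *\<^sub>R fst q \<partial>\<xi>)"
      using coupling_fst(2)[OF \<xi>, of "\<lambda>z. g i z *\<^sub>R z"] by simp
    then have "p i *\<^sub>R (y' i - y i) = (\<integral>q. g i (fst q) *\<^sub>R (snd q - fst q) \<partial>\<xi>) + ((\<integral>z. g i z *\<^sub>R z \<partial>\<nu>) - p i *\<^sub>R y i)"
      using igs[OF i] y'[OF i] by (simp add: scaleR_diff_right)
    moreover have "norm (\<integral>q. g i (fst q) *\<^sub>R (snd q - fst q) \<partial>\<xi>) \<le> \<delta>"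
    proof -
      have "norm (\<integral>q. g i (fst q) *\<^sub>R (snd q - fst q) \<partial>\<xi>) \<le> (\<integral>q. norm (g i (fst q) *\<^sub>R (snd q - fst q)) \<partial>\<xi>)"
        by (rule integral_norm_bound)
      also have "\<dots> \<le> (\<integral>q. norm (snd q - fst q) \<partial>\<xi>)"
      proof (rule integral_mono)
        show "integrable \<xi> (\<lambda>q. norm (g i (fst q) *\<^sub>R (snd q - fst q)))"
          using g0[OF i] g1[OF i] is1 if1 by (intro integrable_norm integrable_weight_mult) auto
        show "norm (g i (fst q) *\<^sub>R (snd q - fst q)) \<le> norm (snd q - fst q)" for q
          using g0[OF i] g1[OF i] by (simp add: mult_left_le_one_le)
      qed (rule i\<xi>)
      finally show ?thesis using i\<xi>(2) by linarith
    qed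
    ultimately have "norm (p i *\<^sub>R (y' i - y i)) \<le> 2 * \<delta>"
      using gy[OF i] norm_triangle_ineq[of "\<integral>q. g i (fst q) *\<^sub>R (snd q - fst q) \<partial>\<xi>" "(\<integral>z. g i z *\<^sub>R z \<partial>\<nu>) - p i *\<^sub>R y i"] by simp
    then have "p i * norm (y' i - y i) \<le> 2 * \<delta>" using p(1)[OF i] by simp
    then have "p0 * norm (y' i - y i) \<le> 2 * \<delta>"
      using mult_right_mono[OF p(2)[OF i], of "norm (y' i - y i)"] by simp
    then show ?thesis using p0(1) by (simp add: field_simps)
  qed
  define S where "S x = (\<Sum>i\<in>I. w i x *\<^sub>R y' i)" for x
  have [measurable]: "S \<in> borel_measurable borel" unfolding S_def by measurable
  have iS: "integrable \<mu> S" unfolding S_def using iw by auto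
  \<comment> \<open>Jensen twice: over the weights \<open>w\<close> at fixed \<open>x\<close>, and
    over the weights \<open>g\<close> under \<xi>. Both families have masses \<open>p i\<close>, so
    the two estimates meet in the finite sum of the \<open>p i * \<phi> (y' i)\<close>.\<close>
  have "distr \<mu> borel S \<le>\<^sub>c \<nu>'"
  proof (rule convex_order_distrI[OF prob_space_axioms iS \<nu>'])
    fix \<phi> :: "'a \<Rightarrow> real" assume \<phi>: "convex_on UNIV \<phi>" "\<And>x. 0 \<le> \<phi> x"
    have [measurable]: "\<phi> \<in> borel_measurable borel" using convex_borel_measurable[OF \<phi>(1)] .
    have "(\<integral>\<^sup>+x. ennreal (\<phi> (S x)) \<partial>\<mu>) \<le> (\<integral>\<^sup>+x. ennreal (\<Sum>i\<in>I. w i x * \<phi> (y' i)) \<partial>\<mu>)"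
      unfolding S_def using convex_on_sum[OF I \<phi>(1) wsum] w0 by (intro nn_integral_mono ennreal_leI) auto
    also have "\<dots> = ennreal (\<integral>x. (\<Sum>i\<in>I. w i x * \<phi> (y' i)) \<partial>\<mu>)"
      using iw w0 \<phi>(2) by (intro nn_integral_eq_integral) (auto intro!: sum_nonneg)
    also have "(\<integral>x. (\<Sum>i\<in>I. w i x * \<phi> (y' i)) \<partial>\<mu>) = (\<Sum>i\<in>I. p i * \<phi> (y' i))"
      unfolding p_def using iw by (subst Bochner_Integration.integral_sum) auto
    also have "ennreal \<dots> = (\<Sum>i\<in>I. ennreal (p i * \<phi> (y' i)))"
      using p(1) \<phi>(2) by (subst sum_ennreal) (auto simp: less_imp_le)
    also have "\<dots> \<le> (\<Sum>i\<in>I. \<integral>\<^sup>+q. ennreal (g i (fst q) * \<phi> (snd q)) \<partial>\<xi>)"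
    proof (rule sum_mono)
      fix i assume i: "i \<in> I"
      have "g i \<in> borel_measurable borel" by measurable
      then have "(\<integral>q. g i (fst q) \<partial>\<xi>) = p i" using coupling_fst(2)[OF \<xi>, of "g i"] gp[OF i] by simp
      then show "ennreal (p i * \<phi> (y' i)) \<le> (\<integral>\<^sup>+q. ennreal (g i (fst q) * \<phi> (snd q)) \<partial>\<xi>)"
        unfolding y'_def using jensen_weighted_nn[OF \<phi> ig[OF i] g0[OF i] _ p(1)[OF i] igs(1)[OF i]] by simp
    qed
    also have "\<dots> = (\<integral>\<^sup>+q. (\<Sum>i\<in>I. ennreal (g i (fst q) * \<phi> (snd q))) \<partial>\<xi>)"
      by (subst nn_integral_sum) auto
    also have "\<dots> = (\<integral>\<^sup>+q. ennreal (\<phi> (snd q)) \<partial>\<xi>)"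
    proof (rule nn_integral_cong)
      fix q
      have "(\<Sum>i\<in>I. ennreal (g i (fst q) * \<phi> (snd q))) = ennreal ((\<Sum>i\<in>I. g i (fst q)) * \<phi> (snd q))"
        using g0 \<phi>(2) by (subst sum_ennreal) (auto simp: sum_distrib_right)
      then show "(\<Sum>i\<in>I. ennreal (g i (fst q) * \<phi> (snd q))) = ennreal (\<phi> (snd q))" using gsum by simp
    qed
    also have "\<dots> = (\<integral>\<^sup>+z. ennreal (\<phi> z) \<partial>\<nu>')" by (rule coupling_nn_snd[OF \<xi>]) measurable
    finally show "(\<integral>\<^sup>+x. ennreal (\<phi> (S x)) \<partial>\<mu>) \<le> (\<integral>\<^sup>+z. ennreal (\<phi> z) \<partial>\<nu>')" .
  qed
  then show ?thesis using near unfolding S_def by blast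
qed

text \<open>The new competitor is read off the first coordinate of \<kappa> but paired with the
  second, whose law is \<mu>'. Smoothing bounds the map by a constant depending on the moduli;
  exchanging the averages \<open>y\<close> for admissible ones \<open>y'\<close> then displaces it
  uniformly, and \<open>cost_shift\<close> controls the cost. Hence one \<delta> serves all data
  with the same moduli.\<close>

lemma (in convex_cost) perturb:
  fixes B1 B2 :: "real \<Rightarrow> real"
  assumes B: "\<And>e. 0 \<le> B1 e" "\<And>e. 0 \<le> B2 e" and \<epsilon>: "0 < \<epsilon>"
  shows "\<exists>\<delta>>0. \<forall>\<mu> \<nu> T \<mu>' \<nu>' \<kappa>. bounded_data B1 B2 \<mu> \<nu> \<longrightarrow> near_data \<delta> \<mu> \<nu> \<mu>' \<nu>' \<kappa> \<longrightarrow>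
    competitor \<mu> (\<lambda>x. x) T \<mu> \<nu> \<longrightarrow>
    (\<exists>S. competitor \<kappa> snd (\<lambda>p. S (fst p)) \<mu>' \<nu>' \<and> (\<integral>p. norm (S (fst p) - T (fst p)) \<partial>\<kappa>) \<le> \<epsilon> \<and>
      (\<integral>p. \<theta> (snd p - S (fst p)) \<partial>\<kappa>) \<le> (\<integral>x. \<theta> (x - T x) \<partial>\<mu>) + \<epsilon>)"
proof -
  have "0 < \<epsilon> / 2" using \<epsilon> by simp
  from smoothing[of B1 B2, OF B this] obtain p0 K where p0: "0 < p0" and K: "0 \<le> K"
    and sm: "\<forall>\<mu> T. prob_space \<mu> \<longrightarrow> sets \<mu> = sets borel \<longrightarrow>
    ui_bound \<mu> (\<lambda>x. norm x powr \<rho>) B1 \<longrightarrow> T \<in> borel_measurable borel \<longrightarrow>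
    ui_bound \<mu> (\<lambda>x. norm (T x)) B2 \<longrightarrow> integrable \<mu> (\<lambda>x. \<theta> (x - T x)) \<longrightarrow>
    (\<exists>I w y. smoothing_of \<mu> T I w y p0 K (\<epsilon> / 2))"
    by (elim exE conjE) (rule that)
  define m1 where "m1 = B1 1 + 1"
  have m1: "0 \<le> m1" using B(1)[of 1] by (simp add: m1_def)
  \<comment> \<open>\<open>l * W\<close> bounds the integrated error of \<open>cost_shift\<close>
    once its quotient term integrates to at most 1.\<close>
  define W where "W = C * (2 + 2 powr \<rho> * (m1 + K powr \<rho>))"
  have W: "0 < W" using C_pos m1 by (simp add: W_def add_pos_nonneg)
  define l where "l = min 1 (\<epsilon> / (2 * W))"
  have l: "0 < l" "l \<le> 1" "l * W \<le> \<epsilon> / 2"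
  proof -
    show "0 < l" "l \<le> 1" using \<epsilon> W by (auto simp: l_def)
    have "l \<le> \<epsilon> / (2 * W)" by (simp add: l_def)
    then show "l * W \<le> \<epsilon> / 2" using W by (simp add: pos_le_divide_eq)
  qed
  \<comment> \<open>If the transport cost and \<open>q powr \<rho>\<close> are both at most
    \<open>L\<close>, the quotient term is at most
    \<open>2 powr \<rho> * (L + L) / l powr \<rho> = 1\<close>.\<close>
  define L where "L = l powr \<rho> / (2 * 2 powr \<rho>)"
  have L: "0 < L" using l by (simp add: L_def)
  define q where "q = min (\<epsilon> / 2) (L powr (1 / \<rho>))"
  have q: "0 < q" "q \<le> \<epsilon> / 2" "q powr \<rho> \<le> L"
  proof -
    show "0 < q" "q \<le> \<epsilon> / 2" using \<epsilon> L by (auto simp: q_def)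
    have "q powr \<rho> \<le> (L powr (1 / \<rho>)) powr \<rho>" using \<epsilon> \<rho> by (intro powr_mono2) (auto simp: q_def)
    also have "\<dots> = L" using L \<rho> by (simp add: powr_powr)
    finally show "q powr \<rho> \<le> L" .
  qed
  \<comment> \<open>The second entry makes the displacement \<open>2 * \<delta> / p0\<close> of the
    averages at most \<open>q\<close>.\<close>
  define \<delta> where "\<delta> = min L (q * p0 / 2)"
  have \<delta>: "0 < \<delta>" "\<delta> \<le> L" "2 * \<delta> / p0 \<le> q"
    using L q p0 by (auto simp: \<delta>_def field_simps min_def)
  have "\<exists>S. competitor \<kappa> snd (\<lambda>p. S (fst p)) \<mu>' \<nu>' \<and> (\<integral>p. norm (S (fst p) - T (fst p)) \<partial>\<kappa>) \<le> \<epsilon> \<and>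
      (\<integral>p. \<theta> (snd p - S (fst p)) \<partial>\<kappa>) \<le> (\<integral>x. \<theta> (x - T x) \<partial>\<mu>) + \<epsilon>"
    if bounded: "bounded_data B1 B2 \<mu> \<nu>" and near: "near_data \<delta> \<mu> \<nu> \<mu>' \<nu>' \<kappa>"
      and comp: "competitor \<mu> (\<lambda>x. x) T \<mu> \<nu>"
    for \<mu> \<nu> \<mu>' \<nu>' :: "'a measure" and T and \<kappa>
  proof -
    have \<mu>: "\<mu> \<in> prob_moment \<rho>" and \<nu>: "\<nu> \<in> prob_moment 1" and ui1: "ui_bound \<mu> (\<lambda>x. norm x powr \<rho>) B1"
      and ui2: "ui_bound \<nu> norm B2" using bounded by (auto simp: bounded_data_def)
    have sets_\<mu>[measurable_cong]: "sets \<mu> = sets borel" using \<mu> by (simp add: prob_moment_def)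
    have T[measurable]: "T \<in> borel_measurable borel" and le: "distr \<mu> borel T \<le>\<^sub>c \<nu>"
      and i\<theta>: "integrable \<mu> (\<lambda>x. \<theta> (x - T x))" using comp by (auto simp: competitor_self[OF \<mu>])
    obtain \<xi> where \<xi>: "\<xi> \<in> couplings \<nu> \<nu>'" and "(\<integral>p. norm (fst p - snd p) powr 1 \<partial>\<xi>) \<le> \<delta>"
      and \<mu>': "\<mu>' \<in> prob_moment \<rho>" and \<nu>': "\<nu>' \<in> prob_moment 1" and \<kappa>: "\<kappa> \<in> couplings \<mu> \<mu>'"
      and l\<kappa>: "(\<integral>p. norm (fst p - snd p) powr \<rho> \<partial>\<kappa>) \<le> \<delta>" using near unfolding near_data_def by blast
    then have i\<xi>: "integrable \<xi> (\<lambda>p. norm (fst p - snd p))" "(\<integral>p. norm (fst p - snd p) \<partial>\<xi>) \<le> \<delta>"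
      using coupling_powr_integrable[OF \<xi> \<nu> \<nu>'] by simp_all
    have i\<kappa>: "integrable \<kappa> (\<lambda>p. norm (fst p - snd p) powr \<rho>)" "(\<integral>p. norm (fst p - snd p) powr \<rho> \<partial>\<kappa>) \<le> \<delta>"
      using coupling_powr_integrable[OF \<kappa> \<mu> \<mu>'] l\<kappa> \<rho> by simp_all
    have Tm: "T \<in> borel_measurable \<mu>" by measurable
    note d = convex_order_distrD[OF le Tm]
    interpret prob_space \<mu> by (rule d(1))
    interpret \<kappa>: prob_space \<kappa> using coupling_prob_space[OF \<kappa> prob_space_axioms] .
    have [measurable]: "fst \<in> borel_measurable \<kappa>" "snd \<in> borel_measurable \<kappa>" using couplingD[OF \<kappa>] by auto
    have ix: "integrable \<mu> (\<lambda>x. norm x powr \<rho>)" using ui1 by (simp add: ui_bound_def)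
    have mx: "(\<integral>x. norm x powr \<rho> \<partial>\<mu>) \<le> m1" using ui_bound_mean[OF ui1 B(1)] by (simp add: m1_def)
    from sm[rule_format, OF prob_space_axioms sets_\<mu> ui1 T ui_bound_convex_order[OF le Tm ui2] i\<theta>]
    obtain I :: "nat set" and w y where "smoothing_of \<mu> T I w y p0 K (\<epsilon> / 2)" by blast
    then have I: "finite I" "I \<noteq> {}" and wm[measurable]: "\<And>i. w i \<in> borel_measurable borel"
      and w0: "\<And>i x. 0 \<le> w i x" and wsum: "\<And>x. (\<Sum>i\<in>I. w i x) = 1"
      and p: "\<And>i. i \<in> I \<Longrightarrow> p0 \<le> (\<integral>x. w i x \<partial>\<mu>)"
      and y: "\<And>i. i \<in> I \<Longrightarrow> (\<integral>x. w i x *\<^sub>R T x \<partial>\<mu>) = (\<integral>x. w i x \<partial>\<mu>) *\<^sub>R y i"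
      and yK: "\<And>i. i \<in> I \<Longrightarrow> norm (y i) \<le> K"
      and L1: "(\<integral>x. norm ((\<Sum>i\<in>I. w i x *\<^sub>R y i) - T x) \<partial>\<mu>) \<le> \<epsilon> / 2"
      and cost: "(\<integral>x. \<theta> (x - (\<Sum>i\<in>I. w i x *\<^sub>R y i)) \<partial>\<mu>) \<le> (\<integral>x. \<theta> (x - T x) \<partial>\<mu>) + \<epsilon> / 2"
      unfolding smoothing_of_def by simp_all
    have comm: "(\<lambda>p. norm (snd p - fst p)) = (\<lambda>p::'a \<times> 'a. norm (fst p - snd p))"
      by (simp add: fun_eq_iff norm_minus_commute)
    have "\<exists>y'. (\<forall>i\<in>I. norm (y' i - y i) \<le> 2 * \<delta> / p0) \<and> distr \<mu> borel (\<lambda>x. \<Sum>i\<in>I. w i x *\<^sub>R y' i) \<le>\<^sub>c \<nu>'"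
      by (rule convex_order_transport[OF sets_\<mu> T le I wm w0 wsum p0 _ _ \<xi> \<nu>' \<delta>(1)])
        (fact p y i\<xi>[folded comm] | erule p y)+
    then obtain y' where y': "\<And>i. i \<in> I \<Longrightarrow> norm (y' i - y i) \<le> 2 * \<delta> / p0"
      and le': "distr \<mu> borel (\<lambda>x. \<Sum>i\<in>I. w i x *\<^sub>R y' i) \<le>\<^sub>c \<nu>'" by blast
    define S0 where "S0 x = (\<Sum>i\<in>I. w i x *\<^sub>R y i)" for x
    define S where "S x = (\<Sum>i\<in>I. w i x *\<^sub>R y' i)" for x
    have Sm[measurable]: "S0 \<in> borel_measurable borel" "S \<in> borel_measurable borel" unfolding S0_def S_def
      by (intro borel_measurable_sum borel_measurable_scaleR wm borel_measurable_const)+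
    have conv: "norm (\<Sum>i\<in>I. w i x *\<^sub>R z i) \<le> r" if "\<And>i. i \<in> I \<Longrightarrow> norm (z i) \<le> r" for x z r
    proof -
      have "norm (\<Sum>i\<in>I. w i x *\<^sub>R z i) \<le> (\<Sum>i\<in>I. w i x * r)"
        using w0 that by (intro sum_norm_le) (auto intro!: mult_left_mono)
      then show ?thesis using wsum[of x] by (simp add: sum_distrib_right[symmetric])
    qed
    have S0K: "norm (S0 x) \<le> K" for x unfolding S0_def using yK by (rule conv)
    have SS: "norm (S0 x - S x) \<le> q" for x
    proof -
      have "S0 x - S x = (\<Sum>i\<in>I. w i x *\<^sub>R (y i - y' i))" by (simp add: S0_def S_def scaleR_diff_right sum_subtractf)
      moreover have "norm (y i - y' i) \<le> q" if "i \<in> I" for i using y'[OF that] \<delta>(3) by (simp add: norm_minus_commute)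
      ultimately show ?thesis using conv[of "\<lambda>i. y i - y' i" q x] by simp
    qed
    have SKq: "norm (S x) \<le> K + q" for x
      using S0K[of x] SS[of x] norm_triangle_ineq4[of "S0 x" "S0 x - S x"] by simp
    have bi: "integrable \<mu> S0" "integrable \<mu> S"
      using S0K SKq integrable_const_bound[of S0 K] integrable_const_bound[of S "K + q"] by auto
    have L1': "(\<integral>x. norm (S x - T x) \<partial>\<mu>) \<le> \<epsilon>"
    proof -
      have "(\<integral>x. norm (S x - T x) \<partial>\<mu>) \<le> (\<integral>x. norm (S0 x - T x) + q \<partial>\<mu>)"
      proof (rule integral_mono)
        show "norm (S x - T x) \<le> norm (S0 x - T x) + q" for x
          using SS[of x] norm_triangle_ineq4[of "S0 x - T x" "S0 x - S x"] by simp
      qed (use bi d(2) in auto)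
      also have "\<dots> = (\<integral>x. norm (S0 x - T x) \<partial>\<mu>) + q" using bi d(2) by (simp add: prob_space)
      finally show ?thesis using L1 q(2) by (simp add: S0_def)
    qed
    have i0: "integrable \<mu> (\<lambda>x. \<theta> (x - S0 x))"
    proof (rule cost_integrable[OF finite_measure_axioms])
      show "integrable \<mu> (\<lambda>x. norm (S0 x) powr \<rho>)"
        using S0K \<rho> by (intro integrable_const_bound[of _ "K powr \<rho>"]) (auto intro!: powr_mono2)
    qed (use ix in auto)
    have iS: "integrable \<kappa> (\<lambda>p. \<theta> (snd p - S (fst p)))"
    proof (rule cost_integrable[OF \<kappa>.finite_measure_axioms])
      show "integrable \<kappa> (\<lambda>p. norm (S (fst p)) powr \<rho>)"
        using SKq \<rho> by (intro \<kappa>.integrable_const_bound[of _ "(K + q) powr \<rho>"]) (auto intro!: powr_mono2)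
      show "integrable \<kappa> (\<lambda>p. norm (snd p) powr \<rho>)"
        using coupling_snd(1)[OF \<kappa>, of "\<lambda>x. norm x powr \<rho>"] \<mu>' by (simp add: prob_moment_def)
    qed measurable
    define E where "E p = l * C * (1 + 2 powr \<rho> * (norm (fst p) powr \<rho> + K powr \<rho>)
      + (2 powr \<rho> * (norm (fst p - snd p) powr \<rho> + q powr \<rho>)) / l powr \<rho>)" for p :: "'a \<times> 'a"
    have ixf: "integrable \<kappa> (\<lambda>p. norm (fst p) powr \<rho>)" "(\<integral>p. norm (fst p) powr \<rho> \<partial>\<kappa>) \<le> m1"
      using coupling_fst[OF \<kappa>, of "\<lambda>x. norm x powr \<rho>"] ix mx by simp_all
    have i0f: "integrable \<kappa> (\<lambda>p. \<theta> (fst p - S0 (fst p)))" "(\<integral>p. \<theta> (fst p - S0 (fst p)) \<partial>\<kappa>) = (\<integral>x. \<theta> (x - S0 x) \<partial>\<mu>)"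
      using coupling_fst[OF \<kappa>, of "\<lambda>x. \<theta> (x - S0 x)"] i0 by simp_all
    have iE: "integrable \<kappa> E" unfolding E_def using ixf i\<kappa> by auto
    have pt: "\<theta> (snd p - S (fst p)) \<le> \<theta> (fst p - S0 (fst p)) + E p" for p
    proof -
      define u where "u = fst p - S0 (fst p)"
      \<comment> \<open>The shift combines the displacement of the first marginal with that of the
        map, so \<open>cost_shift\<close> is applied once for both.\<close>
      define e where "e = (snd p - fst p) + (S0 (fst p) - S (fst p))"
      have "norm u powr \<rho> \<le> 2 powr \<rho> * (norm (fst p) powr \<rho> + K powr \<rho>)"
      proof -
        have "norm u powr \<rho> \<le> 2 powr \<rho> * (norm (fst p) powr \<rho> + norm (S0 (fst p)) powr \<rho>)"
          unfolding u_def using \<rho> by (intro norm_diff_powr_le) auto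
        also have "\<dots> \<le> 2 powr \<rho> * (norm (fst p) powr \<rho> + K powr \<rho>)"
          using S0K \<rho> by (intro mult_left_mono add_left_mono powr_mono2) auto
        finally show ?thesis .
      qed
      moreover have "norm e powr \<rho> \<le> 2 powr \<rho> * (norm (fst p - snd p) powr \<rho> + q powr \<rho>)"
      proof -
        have "norm e powr \<rho> \<le> 2 powr \<rho> * (norm (snd p - fst p) powr \<rho> + norm (S0 (fst p) - S (fst p)) powr \<rho>)"
          unfolding e_def using \<rho> by (intro norm_add_powr_le) auto
        also have "\<dots> \<le> 2 powr \<rho> * (norm (fst p - snd p) powr \<rho> + q powr \<rho>)"
          using SS \<rho> by (intro mult_left_mono add_mono powr_mono2) (auto simp: norm_minus_commute)
        finally show ?thesis .
      qed
      then have "norm e powr \<rho> / l powr \<rho> \<le> (2 powr \<rho> * (norm (fst p - snd p) powr \<rho> + q powr \<rho>)) / l powr \<rho>"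
        by (rule divide_right_mono) simp
      ultimately have "l * C * (1 + norm u powr \<rho> + norm e powr \<rho> / l powr \<rho>) \<le> E p"
        unfolding E_def using l(1) C_pos by (intro mult_left_mono add_mono) auto
      moreover have "snd p - S (fst p) = u + e" by (simp add: u_def e_def)
      ultimately show ?thesis using cost_shift[OF l(1,2), of u e] by (simp add: u_def)
    qed
    have "(\<integral>p. \<theta> (snd p - S (fst p)) \<partial>\<kappa>) \<le> (\<integral>p. \<theta> (fst p - S0 (fst p)) + E p \<partial>\<kappa>)"
      using iS i0f iE pt by (intro integral_mono) auto
    also have "\<dots> = (\<integral>x. \<theta> (x - S0 x) \<partial>\<mu>) + (\<integral>p. E p \<partial>\<kappa>)" using i0f iE by simp
    also have "(\<integral>p. E p \<partial>\<kappa>) = l * C * (1 + 2 powr \<rho> * ((\<integral>p. norm (fst p) powr \<rho> \<partial>\<kappa>) + K powr \<rho>)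
      + (2 powr \<rho> * ((\<integral>p. norm (fst p - snd p) powr \<rho> \<partial>\<kappa>) + q powr \<rho>)) / l powr \<rho>)"
      unfolding E_def using ixf i\<kappa> by (simp add: \<kappa>.prob_space)
    also have "\<dots> \<le> l * C * (1 + 2 powr \<rho> * (m1 + K powr \<rho>) + 1)"
    proof (intro mult_left_mono add_mono)
      have "2 powr \<rho> * ((\<integral>p. norm (fst p - snd p) powr \<rho> \<partial>\<kappa>) + q powr \<rho>) \<le> 2 powr \<rho> * (L + L)"
        using i\<kappa>(2) \<delta>(2) q(3) by (intro mult_left_mono add_mono) auto
      also have "\<dots> = l powr \<rho>" by (simp add: L_def)
      finally show "2 powr \<rho> * ((\<integral>p. norm (fst p - snd p) powr \<rho> \<partial>\<kappa>) + q powr \<rho>) / l powr \<rho> \<le> 1"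
        using l(1) by (simp add: divide_le_eq)
    qed (use ixf l(1) C_pos in auto)
    also have "\<dots> = l * W" by (simp add: W_def algebra_simps)
    finally have "(\<integral>p. \<theta> (snd p - S (fst p)) \<partial>\<kappa>) \<le> (\<integral>x. \<theta> (x - T x) \<partial>\<mu>) + \<epsilon>"
      using l(3) cost by (simp add: S0_def)
    moreover have "distr \<kappa> borel (\<lambda>p. S (fst p)) = distr \<mu> borel S"
      unfolding couplingD(4)[OF \<kappa>, symmetric] by (simp add: distr_distr comp_def)
    then have "competitor \<kappa> snd (\<lambda>p. S (fst p)) \<mu>' \<nu>'"
      using le' iS couplingD(5)[OF \<kappa>] by (simp add: competitor_def S_def[abs_def])
    moreover have "(\<integral>p. norm (S (fst p) - T (fst p)) \<partial>\<kappa>) \<le> \<epsilon>"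
      using L1' coupling_fst(2)[OF \<kappa>, of "\<lambda>x. norm (S x - T x)"] by simp
    ultimately show ?thesis by blast
  qed
  then show ?thesis using \<delta>(1) by blast
qed

section \<open>The value and nearly optimal competitors\<close>

lemma convex_order_trans: "\<eta> \<le>\<^sub>c \<nu> \<Longrightarrow> \<nu> \<le>\<^sub>c \<zeta> \<Longrightarrow> \<eta> \<le>\<^sub>c \<zeta>"
  unfolding convex_order_def by (meson order_trans)

lemma convex_order_distr_norm:
  assumes "distr M borel Y \<le>\<^sub>c \<nu>" "Y \<in> borel_measurable M"
  shows "(\<integral>x. norm (Y x) \<partial>M) \<le> (\<integral>z. norm z \<partial>\<nu>)"
proof -
  have "integrable \<nu> norm" using convex_order_distrD(3)[OF assms] by (auto simp: prob_moment_1_iff)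
  moreover have "convex_on UNIV (norm :: 'a \<Rightarrow> real)" using convex_on_dist[of UNIV "0::'a"] by simp
  ultimately show ?thesis using convex_order_distrD(6)[OF assms] by blast
qed

text \<open>Linear functions are convex with either sign. Consequently an affine cost has the same
  integral for all competitors.\<close>

lemma convex_order_distr_mean:
  assumes "distr M borel Y \<le>\<^sub>c \<nu>" "Y \<in> borel_measurable M"
  shows "(\<integral>x. Y x \<partial>M) = (\<integral>z. z \<partial>\<nu>)"
proof -
  note d = convex_order_distrD[OF assms]
  have i\<nu>: "integrable \<nu> (\<lambda>z. z)" using d(3) by (simp add: prob_moment_1_iff)
  have le: "b \<bullet> (\<integral>x. Y x \<partial>M) \<le> b \<bullet> (\<integral>z. z \<partial>\<nu>)" for b
  proof -
    have "convex_on UNIV (\<lambda>z. b \<bullet> z)" by (auto intro!: convex_onI simp: inner_add_right)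
    from d(6)[OF this] show ?thesis using i\<nu> d(2) by simp
  qed
  define w where "w = (\<integral>x. Y x \<partial>M) - (\<integral>z. z \<partial>\<nu>)"
  have "w \<bullet> w \<le> 0" using le[of w] by (simp add: w_def inner_diff_right)
  then have "w = 0" using inner_gt_zero_iff[of w] by fastforce
  then show ?thesis by (simp add: w_def)
qed

text \<open>The law of the midpoint depends on the joint law, but convexity of the test function is
  used pointwise, so a common space is all that matters.\<close>

lemma convex_order_distr_midpoint:
  fixes Y Y' :: "'b \<Rightarrow> 'a::euclidean_space"
  assumes "distr M borel Y \<le>\<^sub>c \<nu>" "distr M borel Y' \<le>\<^sub>c \<nu>"
    and [measurable]: "Y \<in> borel_measurable M" "Y' \<in> borel_measurable M"
  shows "distr M borel (\<lambda>x. (1/2) *\<^sub>R (Y x + Y' x)) \<le>\<^sub>c \<nu>"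
proof (rule convex_order_distrI)
  note d = convex_order_distrD[OF assms(1,3)] and d' = convex_order_distrD[OF assms(2,4)]
  show "prob_space M" "\<nu> \<in> prob_moment 1" by (fact d)+
  show "integrable M (\<lambda>x. (1/2) *\<^sub>R (Y x + Y' x))" using d(2) d'(2) by auto
  fix \<phi> :: "'a \<Rightarrow> real" assume \<phi>: "convex_on UNIV \<phi>" "\<And>x. 0 \<le> \<phi> x"
  have [measurable]: "\<phi> \<in> borel_measurable borel" using convex_borel_measurable[OF \<phi>(1)] .
  show "(\<integral>\<^sup>+ x. ennreal (\<phi> ((1/2) *\<^sub>R (Y x + Y' x))) \<partial>M) \<le> (\<integral>\<^sup>+ x. ennreal (\<phi> x) \<partial>\<nu>)" (is "?L \<le> ?R")
  proof -
    have "?L \<le> (\<integral>\<^sup>+ x. ennreal (1/2) * (ennreal (\<phi> (Y x)) + ennreal (\<phi> (Y' x))) \<partial>M)"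
    proof (rule nn_integral_mono)
      fix x
      have "ennreal (\<phi> ((1/2) *\<^sub>R (Y x + Y' x))) \<le> ennreal ((1/2) * (\<phi> (Y x) + \<phi> (Y' x)))"
        using convex_on_midpoint[OF \<phi>(1), of "Y x" "Y' x"] by (intro ennreal_leI) simp
      also have "\<dots> = ennreal (1/2) * (ennreal (\<phi> (Y x)) + ennreal (\<phi> (Y' x)))"
        using \<phi>(2) by (subst ennreal_mult) (auto simp: add_nonneg_nonneg)
      finally show "ennreal (\<phi> ((1/2) *\<^sub>R (Y x + Y' x))) \<le> ennreal (1/2) * (ennreal (\<phi> (Y x)) + ennreal (\<phi> (Y' x)))" .
    qed
    also have "\<dots> = ennreal (1/2) * ((\<integral>\<^sup>+ x. ennreal (\<phi> (Y x)) \<partial>M) + (\<integral>\<^sup>+ x. ennreal (\<phi> (Y' x)) \<partial>M))"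
      by (subst nn_integral_cmult) (auto simp: nn_integral_add)
    also have "\<dots> \<le> ennreal (1/2) * (?R + ?R)"
      using d(4)[OF \<phi>] d'(4)[OF \<phi>] by (intro mult_left_mono add_mono) auto
    also have "\<dots> = (ennreal (1/2) + ennreal (1/2)) * ?R" by (simp only: distrib_left distrib_right)
    also have "ennreal (1/2) + ennreal (1/2) = 1" by (subst ennreal_plus[symmetric]) auto
    finally show ?thesis by simp
  qed
qed

text \<open>Fatou's lemma for nonnegative convex test functions; the norm as test function yields
  integrability of the limit.\<close>

lemma convex_order_distr_limit:
  fixes Y :: "nat \<Rightarrow> 'b \<Rightarrow> 'a::euclidean_space"
  assumes le: "\<And>n. distr M borel (Y n) \<le>\<^sub>c \<nu>" and m[measurable]: "\<And>n. Y n \<in> borel_measurable M" "T \<in> borel_measurable M"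
    and lim: "AE x in M. (\<lambda>n. Y n x) \<longlonglongrightarrow> T x"
  shows "distr M borel T \<le>\<^sub>c \<nu>"
proof -
  note d = convex_order_distrD[OF le m(1)]
  have fatou: "(\<integral>\<^sup>+ x. ennreal (\<phi> (T x)) \<partial>M) \<le> (\<integral>\<^sup>+ x. ennreal (\<phi> x) \<partial>\<nu>)"
    if \<phi>: "convex_on UNIV \<phi>" "\<And>x. 0 \<le> \<phi> x" for \<phi>
  proof -
    have [measurable]: "\<phi> \<in> borel_measurable borel" using convex_borel_measurable[OF \<phi>(1)] .
    have "(\<integral>\<^sup>+ x. ennreal (\<phi> (T x)) \<partial>M) = (\<integral>\<^sup>+ x. liminf (\<lambda>n. ennreal (\<phi> (Y n x))) \<partial>M)"
    proof (rule nn_integral_cong_AE)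
      show "AE x in M. ennreal (\<phi> (T x)) = liminf (\<lambda>n. ennreal (\<phi> (Y n x)))"
        using lim
      proof eventually_elim
        case (elim x)
        have "(\<lambda>n. \<phi> (Y n x)) \<longlonglongrightarrow> \<phi> (T x)"
          using convex_continuous_UNIV[OF \<phi>(1)] elim by (rule continuous_on_tendsto_compose) auto
        then have "(\<lambda>n. ennreal (\<phi> (Y n x))) \<longlonglongrightarrow> ennreal (\<phi> (T x))" by (rule tendsto_ennrealI)
        then show ?case using lim_imp_Liminf[OF sequentially_bot] by metis
      qed
    qed
    also have "\<dots> \<le> liminf (\<lambda>n. \<integral>\<^sup>+ x. ennreal (\<phi> (Y n x)) \<partial>M)"
      by (rule nn_integral_liminf) measurable
    also have "\<dots> \<le> liminf (\<lambda>n::nat. \<integral>\<^sup>+ x. ennreal (\<phi> x) \<partial>\<nu>)"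
      using d(4)[OF \<phi>] by (intro Liminf_mono) auto
    finally show ?thesis by (simp add: Liminf_const)
  qed
  have "integrable M T"
  proof (rule integrableI_bounded)
    have "convex_on UNIV (norm :: 'a \<Rightarrow> real)" using convex_on_dist[of UNIV "0::'a"] by simp
    then have "(\<integral>\<^sup>+ x. ennreal (norm (T x)) \<partial>M) \<le> (\<integral>\<^sup>+ x. ennreal (norm x) \<partial>\<nu>)" using fatou by auto
    also have "\<dots> < \<infinity>" using d(3) by (simp add: prob_moment_1_iff integrable_iff_bounded)
    finally show "(\<integral>\<^sup>+ x. ennreal (norm (T x)) \<partial>M) < \<infinity>" .
  qed (rule m)
  then show ?thesis using d(1,3) fatou by (intro convex_order_distrI) auto
qed

text \<open>The deficit is continuous and positive on the compact set of pairs in a ball at distance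
  at least \<epsilon>. Outside a ball it may degenerate, so the radius has to be fixed
  beforehand.\<close>

lemma strictly_convex_deficit:
  fixes \<theta> :: "'a::euclidean_space \<Rightarrow> real"
  assumes \<theta>: "convex_on UNIV \<theta>" and strict: "strictly_convex \<theta>" and "0 < \<epsilon>"
  obtains d where "0 < d"
    "\<And>u v. norm u \<le> R \<Longrightarrow> norm v \<le> R \<Longrightarrow> \<epsilon> \<le> norm (u - v) \<Longrightarrow> d \<le> (\<theta> u + \<theta> v) / 2 - \<theta> ((1/2) *\<^sub>R (u + v))"
proof -
  define f where "f p = (\<theta> (fst p) + \<theta> (snd p)) / 2 - \<theta> ((1/2) *\<^sub>R (fst p + snd p))" for p :: "'a \<times> 'a"
  define Z where "Z = (cball 0 R \<times> cball 0 R) \<inter> {p :: 'a \<times> 'a. \<epsilon> \<le> norm (fst p - snd p)}"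
  have "compact Z"
    unfolding Z_def by (intro compact_Int_closed compact_Times closed_Collect_le continuous_intros) auto
  moreover have "continuous_on Z f"
    unfolding f_def using convex_continuous_UNIV[OF \<theta>]
    by (intro continuous_intros) (auto intro!: continuous_on_compose2[of UNIV \<theta>] continuous_intros)
  moreover have pos: "0 < f p" if "p \<in> Z" for p
  proof -
    have "fst p \<noteq> snd p" using that \<open>0 < \<epsilon>\<close> by (auto simp: Z_def)
    then have "\<theta> ((1 - 1/2) *\<^sub>R fst p + (1/2) *\<^sub>R snd p) < (1 - 1/2) * \<theta> (fst p) + (1/2) * \<theta> (snd p)"
      using strict unfolding strictly_convex_def by (metis half_gt_zero zero_less_one one_less_numeral_iff
          semiring_norm(76) divide_less_eq_1_pos zero_less_numeral)
    then show ?thesis by (simp add: f_def scaleR_add_right field_simps)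
  qed
  ultimately have "\<exists>d>0. \<forall>p\<in>Z. d \<le> f p"
  proof (cases "Z = {}")
    case False
    then obtain p where "p \<in> Z" "\<forall>q\<in>Z. f p \<le> f q"
      using continuous_attains_inf[OF \<open>compact Z\<close> False \<open>continuous_on Z f\<close>] by blast
    then show ?thesis using pos by blast
  qed (auto intro: exI[of _ 1])
  then obtain d where "0 < d" "\<And>p. p \<in> Z \<Longrightarrow> d \<le> f p" by blast
  then show ?thesis using that[of d] by (force simp: Z_def f_def)
qed

context convex_cost
begin

definition value_of :: "'a measure \<Rightarrow> 'a measure \<Rightarrow> real" where
  "value_of \<mu> \<nu> = real_of_ereal (weak_transport_cost \<theta> \<mu> \<nu>)"

text \<open>The affine minorant excludes negative infinity, so a cost is a real integral or
  \<infinity>. The lower bound is uniform in \<eta> because the norm is a convex test function; this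
  makes the value finite from below.\<close>

lemma coupling_cost:
  assumes \<mu>: "\<mu> \<in> prob_moment \<rho>" and le: "\<eta> \<le>\<^sub>c \<nu>" and \<pi>: "\<pi> \<in> couplings \<mu> \<eta>"
  shows "ext_integral \<pi> (\<lambda>(x, y). \<theta> (x - y)) =
      (if integrable \<pi> (\<lambda>p. \<theta> (fst p - snd p)) then ereal (\<integral>p. \<theta> (fst p - snd p) \<partial>\<pi>) else \<infinity>)"
    and "integrable \<pi> (\<lambda>p. \<theta> (fst p - snd p)) \<Longrightarrow>
      - (a * (1 + (\<integral>x. norm x \<partial>\<mu>) + (\<integral>z. norm z \<partial>\<nu>))) \<le> (\<integral>p. \<theta> (fst p - snd p) \<partial>\<pi>)"
    and "integrable \<pi> fst" "integrable \<pi> snd" "prob_space \<pi>"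
proof -
  have \<mu>1: "\<mu> \<in> prob_moment 1" using prob_moment_1[OF \<mu> \<rho>] .
  have \<eta>1: "\<eta> \<in> prob_moment 1" using le by (simp add: convex_order_def)
  show ps: "prob_space \<pi>" using coupling_prob_space[OF \<pi>] \<mu>1 by (simp add: prob_moment_1_iff)
  interpret prob_space \<pi> by fact
  have [measurable]: "fst \<in> borel_measurable \<pi>" "snd \<in> borel_measurable \<pi>" using couplingD[OF \<pi>] by auto
  show i: "integrable \<pi> fst" "integrable \<pi> snd"
    using coupling_fst(1)[OF \<pi> measurable_ident] coupling_snd(1)[OF \<pi> measurable_ident] \<mu>1 \<eta>1
    by (simp_all add: prob_moment_1_iff id_def)
  have fs: "(\<lambda>(x, y). \<theta> (x - y)) = (\<lambda>p. \<theta> (fst p - snd p))" by (simp add: fun_eq_iff split_beta)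
  have neg: "(\<integral>\<^sup>+p. ennreal (- \<theta> (fst p - snd p)) \<partial>\<pi>) < \<infinity>"
    using i by (intro convex_neg_part_finite[OF convex finite_measure_axioms]) auto
  have m: "(\<lambda>p. \<theta> (fst p - snd p)) \<in> borel_measurable \<pi>" by measurable
  show "ext_integral \<pi> (\<lambda>(x, y). \<theta> (x - y)) =
      (if integrable \<pi> (\<lambda>p. \<theta> (fst p - snd p)) then ereal (\<integral>p. \<theta> (fst p - snd p) \<partial>\<pi>) else \<infinity>)"
    unfolding fs using ext_integral_integrable ext_integral_not_integrable[OF m neg] by auto
  assume int: "integrable \<pi> (\<lambda>p. \<theta> (fst p - snd p))"
  have "(\<integral>p. - (a * (1 + norm (fst p) + norm (snd p))) \<partial>\<pi>) \<le> (\<integral>p. \<theta> (fst p - snd p) \<partial>\<pi>)"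
  proof (rule integral_mono[OF _ int])
    fix p :: "'a \<times> 'a"
    have "a * (1 + norm (fst p - snd p)) \<le> a * (1 + norm (fst p) + norm (snd p))"
      using norm_triangle_ineq4[of "fst p" "snd p"] a by (intro mult_left_mono) auto
    then show "- (a * (1 + norm (fst p) + norm (snd p))) \<le> \<theta> (fst p - snd p)"
      using lower[of "fst p - snd p"] by linarith
  qed (use i in auto)
  moreover have "(\<integral>p. - (a * (1 + norm (fst p) + norm (snd p))) \<partial>\<pi>) = - (a * (1 + (\<integral>p. norm (fst p) \<partial>\<pi>) + (\<integral>p. norm (snd p) \<partial>\<pi>)))"
    using i by (simp add: prob_space)
  moreover have "(\<integral>p. norm (fst p) \<partial>\<pi>) = (\<integral>x. norm x \<partial>\<mu>)"
    using coupling_fst(2)[OF \<pi>, of norm] by simp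
  moreover have "(\<integral>p. norm (snd p) \<partial>\<pi>) \<le> (\<integral>z. norm z \<partial>\<nu>)"
    using convex_order_distr_norm[of \<pi> snd \<nu>] le couplingD[OF \<pi>] by simp
  ultimately show "- (a * (1 + (\<integral>x. norm x \<partial>\<mu>) + (\<integral>z. norm z \<partial>\<nu>))) \<le> (\<integral>p. \<theta> (fst p - snd p) \<partial>\<pi>)"
    using mult_left_mono[OF _ a, of "(\<integral>p. norm (snd p) \<partial>\<pi>)" "(\<integral>z. norm z \<partial>\<nu>)"] by (simp add: algebra_simps)
qed

lemma transport_cost_le:
  fixes M :: "'b measure"
  assumes [measurable]: "X \<in> borel_measurable M" "Y \<in> borel_measurable M"
    and "integrable M (\<lambda>x. \<theta> (X x - Y x))"
  shows "transport_cost \<theta> (distr M borel X) (distr M borel Y) \<le> ereal (\<integral>x. \<theta> (X x - Y x) \<partial>M)"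
proof -
  define \<pi> where "\<pi> = distr M borel (\<lambda>x. (X x, Y x))"
  have [measurable]: "fst \<in> borel_measurable (borel :: ('a \<times> 'a) measure)" "snd \<in> borel_measurable (borel :: ('a \<times> 'a) measure)"
    by (auto intro!: borel_measurable_continuous_onI continuous_intros)
  have "\<pi> \<in> couplings (distr M borel X) (distr M borel Y)"
    unfolding couplings_def \<pi>_def by (auto simp: distr_distr comp_def)
  moreover have "integrable \<pi> (\<lambda>p. \<theta> (fst p - snd p))" "(\<integral>p. \<theta> (fst p - snd p) \<partial>\<pi>) = (\<integral>x. \<theta> (X x - Y x) \<partial>M)"
    unfolding \<pi>_def using assms(3) by (simp_all add: integrable_distr_eq integral_distr)
  then have "ext_integral \<pi> (\<lambda>(x, y). \<theta> (x - y)) = ereal (\<integral>x. \<theta> (X x - Y x) \<partial>M)"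
    using ext_integral_integrable[of \<pi> "\<lambda>p. \<theta> (fst p - snd p)"] by (simp add: case_prod_beta')
  ultimately show ?thesis unfolding transport_cost_def by (intro INF_lower2) auto
qed

lemma weak_transport_cost_le:
  fixes M :: "'b measure"
  assumes "competitor M X Y \<mu> \<nu>"
  shows "weak_transport_cost \<theta> \<mu> \<nu> \<le> ereal (\<integral>x. \<theta> (X x - Y x) \<partial>M)"
  using assms transport_cost_le[of X M Y] unfolding weak_transport_cost_def competitor_def
  by (intro INF_lower2[of "distr M borel Y"]) auto

lemma weak_transport_cost_finite:
  assumes \<mu>: "\<mu> \<in> prob_moment \<rho>" and \<nu>: "\<nu> \<in> prob_moment 1"
  shows "weak_transport_cost \<theta> \<mu> \<nu> = ereal (value_of \<mu> \<nu>)"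
proof -
  interpret \<mu>: prob_space \<mu> using \<mu> by (simp add: prob_moment_def)
  interpret \<nu>: prob_space \<nu> using \<nu> by (simp add: prob_moment_1_iff)
  have [measurable_cong]: "sets \<mu> = sets borel" "sets \<nu> = sets borel" using \<mu> \<nu> by (auto simp: prob_moment_def)
  have "ereal (- (a * (1 + (\<integral>x. norm x \<partial>\<mu>) + (\<integral>z. norm z \<partial>\<nu>)))) \<le> weak_transport_cost \<theta> \<mu> \<nu>"
    unfolding weak_transport_cost_def transport_cost_def
    using coupling_cost(1,2)[OF \<mu>] by (intro INF_greatest) auto
  moreover have "weak_transport_cost \<theta> \<mu> \<nu> < \<infinity>"
  proof -
    \<comment> \<open>The point mass at the mean of \<nu> is below \<nu> by Jensen and has finite
      cost.\<close>
    define m where "m = (\<integral>z. z \<partial>\<nu>)"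
    have "distr \<mu> borel (\<lambda>x. m) \<le>\<^sub>c \<nu>"
    proof (rule convex_order_distrI[OF \<mu>.prob_space_axioms _ \<nu>])
      fix \<phi> :: "'a \<Rightarrow> real" assume \<phi>: "convex_on UNIV \<phi>" "\<And>x. 0 \<le> \<phi> x"
      show "(\<integral>\<^sup>+ x. ennreal (\<phi> m) \<partial>\<mu>) \<le> (\<integral>\<^sup>+ x. ennreal (\<phi> x) \<partial>\<nu>)"
        using jensen_weighted_nn[OF \<phi>, of \<nu> "\<lambda>_. 1" 1 "\<lambda>x. x"] \<nu>
        by (simp add: \<mu>.emeasure_space_1 \<nu>.prob_space m_def prob_moment_1_iff)
    qed simp
    moreover have "integrable \<mu> (\<lambda>x. \<theta> (x - m))"
      using \<mu> by (intro cost_integrable[OF \<mu>.finite_measure_axioms]) (auto simp: prob_moment_def)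
    ultimately have "weak_transport_cost \<theta> \<mu> \<nu> \<le> ereal (\<integral>x. \<theta> (x - m) \<partial>\<mu>)"
      by (intro weak_transport_cost_le) (simp add: competitor_self[OF \<mu>])
    then show ?thesis by (meson le_less_trans less_PInf_Ex_of_nat ereal_less(3) PInfty_neq_ereal(1) ereal_infty_less(1))
  qed
  ultimately show ?thesis unfolding value_of_def by (cases "weak_transport_cost \<theta> \<mu> \<nu>") auto
qed

lemma value_le:
  fixes M :: "'b measure"
  assumes "\<mu> \<in> prob_moment \<rho>" "\<nu> \<in> prob_moment 1" "competitor M X Y \<mu> \<nu>"
  shows "value_of \<mu> \<nu> \<le> (\<integral>x. \<theta> (X x - Y x) \<partial>M)"
  using weak_transport_cost_le[OF assms(3)] by (simp add: weak_transport_cost_finite[OF assms(1,2)])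

text \<open>Replacing the second coordinate by its barycenter given the first one lowers the cost and
  stays below in the convex order, by Jensen's inequality for both.\<close>

lemma barycenter_map:
  assumes \<mu>: "\<mu> \<in> prob_moment \<rho>" and le: "\<eta> \<le>\<^sub>c \<nu>" and \<pi>: "\<pi> \<in> couplings \<mu> \<eta>"
    and int: "integrable \<pi> (\<lambda>p. \<theta> (fst p - snd p))"
  shows "\<exists>T. competitor \<mu> (\<lambda>x. x) T \<mu> \<nu> \<and> (\<integral>x. \<theta> (x - T x) \<partial>\<mu>) \<le> (\<integral>p. \<theta> (fst p - snd p) \<partial>\<pi>)"
proof -
  note cc = coupling_cost[OF \<mu> le \<pi>]
  obtain T :: "'a \<Rightarrow> 'a" where T[measurable]: "T \<in> borel_measurable borel" and iT: "integrable \<pi> (\<lambda>p. T (fst p))"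
    and jensen: "\<And>\<phi> h s. convex_on UNIV \<phi> \<Longrightarrow> h \<in> borel_measurable borel \<Longrightarrow> integrable \<pi> (\<lambda>p. h (fst p)) \<Longrightarrow>
       integrable \<pi> (\<lambda>p. \<phi> (h (fst p) + s *\<^sub>R snd p)) \<Longrightarrow>
       integrable \<pi> (\<lambda>p. \<phi> (h (fst p) + s *\<^sub>R T (fst p))) \<and>
       (\<integral>p. \<phi> (h (fst p) + s *\<^sub>R T (fst p)) \<partial>\<pi>) \<le> (\<integral>p. \<phi> (h (fst p) + s *\<^sub>R snd p) \<partial>\<pi>)"
    by (rule barycenter[OF cc(5) couplingD(1)[OF \<pi>] cc(4)]) (rule that)
  have [measurable_cong]: "sets \<mu> = sets borel" using \<mu> by (simp add: prob_moment_def)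
  have "integrable \<pi> (\<lambda>p. \<theta> (fst p - T (fst p))) \<and> (\<integral>p. \<theta> (fst p - T (fst p)) \<partial>\<pi>) \<le> (\<integral>p. \<theta> (fst p - snd p) \<partial>\<pi>)"
    using jensen[OF convex, of "\<lambda>x. x" "-1"] cc(3) int by simp
  then have 1: "integrable \<mu> (\<lambda>x. \<theta> (x - T x))" "(\<integral>x. \<theta> (x - T x) \<partial>\<mu>) \<le> (\<integral>p. \<theta> (fst p - snd p) \<partial>\<pi>)"
    using coupling_fst[OF \<pi>, of "\<lambda>x. \<theta> (x - T x)"] by simp_all
  have iT\<mu>: "integrable \<mu> T" using coupling_fst(1)[OF \<pi> T] iT by simp
  have \<eta>1: "\<eta> \<in> prob_moment 1" using le by (simp add: convex_order_def)
  have "distr \<mu> borel T \<le>\<^sub>c \<eta>"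
  proof (rule convex_order_distrI[OF _ iT\<mu> \<eta>1])
    show "prob_space \<mu>" using \<mu> by (simp add: prob_moment_def)
    fix \<phi> :: "'a \<Rightarrow> real" assume \<phi>: "convex_on UNIV \<phi>" "\<And>x. 0 \<le> \<phi> x"
    have \<phi>m[measurable]: "\<phi> \<in> borel_measurable borel" using convex_borel_measurable[OF \<phi>(1)] .
    show "(\<integral>\<^sup>+ x. ennreal (\<phi> (T x)) \<partial>\<mu>) \<le> (\<integral>\<^sup>+ x. ennreal (\<phi> x) \<partial>\<eta>)"
    proof (cases "(\<integral>\<^sup>+ x. ennreal (\<phi> x) \<partial>\<eta>) = \<infinity>")
      case False
      have "sets \<eta> = sets borel" using \<eta>1 by (simp add: prob_moment_1_iff)
      then have "\<phi> \<in> borel_measurable \<eta>" using \<phi>m measurable_cong_sets by blast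
      then have i\<eta>: "integrable \<eta> \<phi>" using False \<phi>(2) by (intro integrableI_nonneg) (auto simp: less_top)
      then have i\<pi>: "integrable \<pi> (\<lambda>p. \<phi> (snd p))" using coupling_snd(1)[OF \<pi> \<phi>m] by simp
      have "integrable \<pi> (\<lambda>p. \<phi> (0 + 1 *\<^sub>R snd p))" using i\<pi> by simp
      from jensen[OF \<phi>(1) borel_measurable_const _ this]
      have "integrable \<pi> (\<lambda>p. \<phi> (T (fst p))) \<and> (\<integral>p. \<phi> (T (fst p)) \<partial>\<pi>) \<le> (\<integral>p. \<phi> (snd p) \<partial>\<pi>)"
        by simp
      then have "integrable \<mu> (\<lambda>x. \<phi> (T x))" "(\<integral>x. \<phi> (T x) \<partial>\<mu>) \<le> (\<integral>x. \<phi> x \<partial>\<eta>)"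
        using coupling_fst[OF \<pi>, of "\<lambda>x. \<phi> (T x)"] coupling_snd(2)[OF \<pi> \<phi>m] by simp_all
      then show ?thesis
        using nn_integral_eq_integral[OF i\<eta>] nn_integral_eq_integral[of \<mu> "\<lambda>x. \<phi> (T x)"] \<phi>(2) by (simp add: ennreal_leI)
    qed simp
  qed
  then show ?thesis using 1 T convex_order_trans[OF _ le] unfolding competitor_self[OF \<mu>] by blast
qed

text \<open>A coupling within \<epsilon> of the double infimum has finite cost, hence an integrable
  integrand, and its barycentric map does no worse.\<close>

lemma near_optimal_map:
  assumes \<mu>: "\<mu> \<in> prob_moment \<rho>" and \<nu>: "\<nu> \<in> prob_moment 1" and "0 < \<epsilon>"
  shows "\<exists>T. competitor \<mu> (\<lambda>x. x) T \<mu> \<nu> \<and> (\<integral>x. \<theta> (x - T x) \<partial>\<mu>) \<le> value_of \<mu> \<nu> + \<epsilon>"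
proof -
  have "weak_transport_cost \<theta> \<mu> \<nu> < ereal (value_of \<mu> \<nu> + \<epsilon>)"
    using \<open>0 < \<epsilon>\<close> by (simp add: weak_transport_cost_finite[OF \<mu> \<nu>])
  then obtain \<eta> where \<eta>: "\<eta> \<le>\<^sub>c \<nu>" "transport_cost \<theta> \<mu> \<eta> < ereal (value_of \<mu> \<nu> + \<epsilon>)"
    unfolding weak_transport_cost_def by (auto simp: INF_less_iff)
  then obtain \<pi> where \<pi>: "\<pi> \<in> couplings \<mu> \<eta>" "ext_integral \<pi> (\<lambda>(x, y). \<theta> (x - y)) < ereal (value_of \<mu> \<nu> + \<epsilon>)"
    unfolding transport_cost_def by (auto simp: INF_less_iff)
  then have "integrable \<pi> (\<lambda>p. \<theta> (fst p - snd p))" "(\<integral>p. \<theta> (fst p - snd p) \<partial>\<pi>) < value_of \<mu> \<nu> + \<epsilon>"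
    using coupling_cost(1)[OF \<mu> \<eta>(1) \<pi>(1)] by (auto split: if_splits)
  then show ?thesis using barycenter_map[OF \<mu> \<eta>(1) \<pi>(1)] by (meson less_imp_le order_trans)
qed

text \<open>Lifts a map to a coupling, where it can be compared with competitors that are not maps
  or that belong to other data.\<close>

lemma competitor_coupling:
  assumes \<mu>: "\<mu> \<in> prob_moment \<rho>" and T: "competitor \<mu> (\<lambda>x. x) T \<mu> \<nu>"
  shows "\<kappa> \<in> couplings \<mu> \<eta> \<Longrightarrow> competitor \<kappa> fst (\<lambda>p. T (fst p)) \<mu> \<nu>"
    and "\<kappa> \<in> couplings \<eta> \<mu> \<Longrightarrow> competitor \<kappa> snd (\<lambda>p. T (snd p)) \<mu> \<nu>"
proof -
  have [measurable]: "T \<in> borel_measurable borel" and le: "distr \<mu> borel T \<le>\<^sub>c \<nu>"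
    and i: "integrable \<mu> (\<lambda>x. \<theta> (x - T x))" using T by (auto simp: competitor_self[OF \<mu>])
  have m: "(\<lambda>x. \<theta> (x - T x)) \<in> borel_measurable borel" by measurable
  show "competitor \<kappa> fst (\<lambda>p. T (fst p)) \<mu> \<nu>" if \<kappa>: "\<kappa> \<in> couplings \<mu> \<eta>"
  proof -
    note cd = couplingD[OF \<kappa>]
    note [measurable] = cd(2)
    have "distr \<kappa> borel (\<lambda>p. T (fst p)) = distr \<mu> borel T"
      unfolding cd(4)[symmetric] by (simp add: distr_distr comp_def)
    then show ?thesis using le i coupling_fst(1)[OF \<kappa> m] cd(4) by (simp add: competitor_def)
  qed
  show "competitor \<kappa> snd (\<lambda>p. T (snd p)) \<mu> \<nu>" if \<kappa>: "\<kappa> \<in> couplings \<eta> \<mu>"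
  proof -
    note cd = couplingD[OF \<kappa>]
    note [measurable] = cd(3)
    have "distr \<kappa> borel (\<lambda>p. T (snd p)) = distr \<mu> borel T"
      unfolding cd(5)[symmetric] by (simp add: distr_distr comp_def)
    then show ?thesis using le i coupling_snd(1)[OF \<kappa> m] cd(5) by (simp add: competitor_def)
  qed
qed

text \<open>The midpoint of two nearly optimal competitors is again a competitor, so that the strict
  convexity deficit is small in mean.\<close>

lemma near_optimal_close:
  assumes strict: "strictly_convex \<theta>" and \<epsilon>: "0 < \<epsilon>" and K: "0 \<le> K"
  shows "\<exists>\<delta>>0. \<forall>(M :: 'b measure) X Y Y' \<mu> \<nu>. \<mu> \<in> prob_moment \<rho> \<longrightarrow> \<nu> \<in> prob_moment 1 \<longrightarrow>
    (\<integral>x. norm x \<partial>\<mu>) + (\<integral>z. norm z \<partial>\<nu>) \<le> K \<longrightarrow> competitor M X Y \<mu> \<nu> \<longrightarrow> competitor M X Y' \<mu> \<nu> \<longrightarrow>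
    (\<integral>x. \<theta> (X x - Y x) \<partial>M) \<le> value_of \<mu> \<nu> + \<delta> \<longrightarrow> (\<integral>x. \<theta> (X x - Y' x) \<partial>M) \<le> value_of \<mu> \<nu> + \<delta> \<longrightarrow>
    measure M {x \<in> space M. \<epsilon> < norm (Y x - Y' x)} \<le> \<epsilon>"
proof -
  \<comment> \<open>By Markov, each of the differences \<open>X - Y\<close> and
    \<open>X - Y'\<close> leaves the ball of radius \<open>R\<close> with probability at most
    \<open>K / R\<close>, hence \<open>\<epsilon> / 4\<close>; the choice of \<delta> leaves
    \<open>\<epsilon> / 2\<close> for the deficit. All constants depend on \<epsilon> and
    \<open>K\<close> only.\<close>
  define R where "R = 4 * K / \<epsilon> + 1"
  have R: "0 < R" "K / R \<le> \<epsilon> / 4" using \<epsilon> K by (auto simp: R_def field_simps add_pos_nonneg)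
  obtain d where d: "0 < d"
    "\<And>u v. norm u \<le> R \<Longrightarrow> norm v \<le> R \<Longrightarrow> \<epsilon> \<le> norm (u - v) \<Longrightarrow> d \<le> (\<theta> u + \<theta> v) / 2 - \<theta> ((1/2) *\<^sub>R (u + v))"
    using strictly_convex_deficit[OF convex strict \<epsilon>] by metis
  define \<delta> where "\<delta> = d * \<epsilon> / 2"
  have \<delta>: "0 < \<delta>" "\<delta> / d = \<epsilon> / 2" using d \<epsilon> by (simp_all add: \<delta>_def)
  have "measure M {x \<in> space M. \<epsilon> < norm (Y x - Y' x)} \<le> \<epsilon>"
    if \<mu>: "\<mu> \<in> prob_moment \<rho>" and \<nu>: "\<nu> \<in> prob_moment 1" and bK: "(\<integral>x. norm x \<partial>\<mu>) + (\<integral>z. norm z \<partial>\<nu>) \<le> K"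
      and comp: "competitor M X Y \<mu> \<nu>" "competitor M X Y' \<mu> \<nu>"
      and le: "(\<integral>x. \<theta> (X x - Y x) \<partial>M) \<le> value_of \<mu> \<nu> + \<delta>" "(\<integral>x. \<theta> (X x - Y' x) \<partial>M) \<le> value_of \<mu> \<nu> + \<delta>"
    for M :: "'b measure" and X Y Y' \<mu> \<nu>
  proof -
    have m[measurable]: "X \<in> borel_measurable M" "Y \<in> borel_measurable M" "Y' \<in> borel_measurable M"
      and X: "distr M borel X = \<mu>" and Y: "distr M borel Y \<le>\<^sub>c \<nu>" "distr M borel Y' \<le>\<^sub>c \<nu>"
      and i: "integrable M (\<lambda>x. \<theta> (X x - Y x))" "integrable M (\<lambda>x. \<theta> (X x - Y' x))"
      using comp by (auto simp: competitor_def)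
    note dY = convex_order_distrD[OF Y(1) m(2)] and dY' = convex_order_distrD[OF Y(2) m(3)]
    interpret prob_space M by (rule dY(1))
    have \<mu>1: "integrable \<mu> (\<lambda>x. x)" using prob_moment_1[OF \<mu> \<rho>] by (simp add: prob_moment_1_iff)
    have iX: "integrable M X" using \<mu>1 unfolding X[symmetric] by (simp add: integrable_distr_eq)
    have nX: "(\<integral>x. norm (X x) \<partial>M) = (\<integral>x. norm x \<partial>\<mu>)" unfolding X[symmetric] by (simp add: integral_distr)
    define U where "U x = X x - Y x" for x
    define U' where "U' x = X x - Y' x" for x
    define mid where "mid x = (1/2) *\<^sub>R (Y x + Y' x)" for x
    have mm[measurable]: "mid \<in> borel_measurable M" unfolding mid_def by measurable
    have mU: "(1/2) *\<^sub>R (U x + U' x) = X x - mid x" for x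
    proof -
      have "U x + U' x = 2 *\<^sub>R X x - (Y x + Y' x)" by (simp add: U_def U'_def scaleR_2)
      then show ?thesis by (simp add: mid_def scaleR_diff_right)
    qed
    \<comment> \<open>The midpoint cost lies between the linear lower bound and the mean of the two
      given costs.\<close>
    have imid: "integrable M (\<lambda>x. \<theta> (X x - mid x))"
    proof (rule Bochner_Integration.integrable_bound)
      show "integrable M (\<lambda>x. \<bar>\<theta> (U x)\<bar> + \<bar>\<theta> (U' x)\<bar> + a * (1 + norm (X x - mid x)))"
        using i iX dY(2) dY'(2) by (auto simp: U_def U'_def mid_def)
      show "AE x in M. norm (\<theta> (X x - mid x)) \<le> norm (\<bar>\<theta> (U x)\<bar> + \<bar>\<theta> (U' x)\<bar> + a * (1 + norm (X x - mid x)))"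
      proof (rule AE_I2)
        fix x
        have "0 \<le> a * (1 + norm (X x - mid x))" using a by simp
        then show "norm (\<theta> (X x - mid x)) \<le> norm (\<bar>\<theta> (U x)\<bar> + \<bar>\<theta> (U' x)\<bar> + a * (1 + norm (X x - mid x)))"
          using convex_on_midpoint[OF convex, of "U x" "U' x"] lower[of "X x - mid x"] unfolding mU by simp
      qed
    qed measurable
    have "distr M borel mid \<le>\<^sub>c \<nu>" unfolding mid_def using Y m by (intro convex_order_distr_midpoint) auto
    then have Vmid: "value_of \<mu> \<nu> \<le> (\<integral>x. \<theta> (X x - mid x) \<partial>M)"
      using m(1) mm X imid by (intro value_le[OF \<mu> \<nu>]) (simp add: competitor_def)
    define f where "f x = (\<theta> (U x) + \<theta> (U' x)) / 2 - \<theta> (X x - mid x)" for x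
    have f0: "0 \<le> f x" for x using convex_on_midpoint[OF convex, of "U x" "U' x"] by (simp add: f_def mU)
    have if': "integrable M f" unfolding f_def U_def U'_def using i imid by auto
    have intf: "(\<integral>x. f x \<partial>M) \<le> \<delta>"
    proof -
      have eq: "(\<integral>x. f x \<partial>M) = ((\<integral>x. \<theta> (X x - Y x) \<partial>M) + (\<integral>x. \<theta> (X x - Y' x) \<partial>M)) / 2 - (\<integral>x. \<theta> (X x - mid x) \<partial>M)"
        unfolding f_def U_def U'_def using i imid by simp
      have "e \<le> \<delta>" if "e = (b + b') / 2 - m" "b \<le> v + \<delta>" "b' \<le> v + \<delta>" "v \<le> m" for e b b' m v :: real
        using that by (simp add: field_simps)
      from this[OF eq le Vmid] show ?thesis .
    qed
    have iU: "integrable M U" "integrable M U'" unfolding U_def U'_def using iX dY(2) dY'(2) by auto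
    have nU: "(\<integral>x. norm (U x) \<partial>M) \<le> K" "(\<integral>x. norm (U' x) \<partial>M) \<le> K"
    proof -
      have "(\<integral>x. norm (U x) \<partial>M) \<le> (\<integral>x. norm (X x) + norm (Y x) \<partial>M)"
        using iU iX dY(2) by (intro integral_mono) (auto simp: U_def norm_triangle_ineq4)
      also have "\<dots> \<le> K" using iX dY(2) nX bK convex_order_distr_norm[OF Y(1) m(2)] by simp
      finally show "(\<integral>x. norm (U x) \<partial>M) \<le> K" .
      have "(\<integral>x. norm (U' x) \<partial>M) \<le> (\<integral>x. norm (X x) + norm (Y' x) \<partial>M)"
        using iU iX dY'(2) by (intro integral_mono) (auto simp: U'_def norm_triangle_ineq4)
      also have "\<dots> \<le> K" using iX dY'(2) nX bK convex_order_distr_norm[OF Y(2) m(3)] by simp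
      finally show "(\<integral>x. norm (U' x) \<partial>M) \<le> K" .
    qed
    define A where "A = {x \<in> space M. \<epsilon> < norm (Y x - Y' x)}"
    have [measurable]: "A \<in> sets M" unfolding A_def by measurable
    have "measure M A = (\<integral>x. indicator A x \<partial>M)" by simp
    also have "\<dots> \<le> (\<integral>x. norm (U x) / R + norm (U' x) / R + f x / d \<partial>M)"
    proof (rule integral_mono)
      show "integrable M (indicator A :: 'b \<Rightarrow> real)" by (simp add: less_top[symmetric])
      show "integrable M (\<lambda>x. norm (U x) / R + norm (U' x) / R + f x / d)" using iU if' by auto
      fix x
      have nn: "0 \<le> norm (U x) / R" "0 \<le> norm (U' x) / R" "0 \<le> f x / d" using R d f0 by auto
      show "indicator A x \<le> norm (U x) / R + norm (U' x) / R + f x / d"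
      proof (cases "x \<in> A \<and> norm (U x) \<le> R \<and> norm (U' x) \<le> R")
        case True
        have "norm (U x - U' x) = norm (Y x - Y' x)" by (simp add: U_def U'_def norm_minus_commute)
        then have "d \<le> f x" using d(2)[of "U x" "U' x"] True unfolding mU by (simp add: A_def f_def)
        then have "1 \<le> f x / d" using d(1) by simp
        then show ?thesis using nn True by simp
      next
        case False
        then have "x \<notin> A \<or> 1 \<le> norm (U x) / R \<or> 1 \<le> norm (U' x) / R" using R(1) by auto
        then show ?thesis using nn by (auto simp: indicator_def)
      qed
    qed
    also have "\<dots> = (\<integral>x. norm (U x) \<partial>M) / R + (\<integral>x. norm (U' x) \<partial>M) / R + (\<integral>x. f x \<partial>M) / d"
      using iU if' by simp
    also have "\<dots> \<le> K / R + K / R + \<delta> / d"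
      using nU intf R(1) d(1) by (intro add_mono divide_right_mono) auto
    also have "\<dots> \<le> \<epsilon>" using R(2) \<delta>(2) by linarith
    finally show ?thesis by (simp add: A_def)
  qed
  then show ?thesis using \<delta>(1) by blast
qed

end

section \<open>Couplings and convergence in probability\<close>

text \<open>Along a fast subsequence the increments exceed a geometric sequence with summable
  probabilities, so by Borel-Cantelli they are almost surely summable.\<close>

lemma (in prob_space) cauchy_in_prob_subseq:
  fixes f :: "nat \<Rightarrow> 'a \<Rightarrow> 'b::euclidean_space"
  assumes m[measurable]: "\<And>n. f n \<in> borel_measurable M"
    and cauchy: "\<And>\<epsilon>. 0 < \<epsilon> \<Longrightarrow> \<exists>N. \<forall>m\<ge>N. \<forall>n\<ge>N. measure M {x \<in> space M. \<epsilon> < norm (f m x - f n x)} \<le> \<epsilon>"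
  shows "\<exists>r g. strict_mono (r :: nat \<Rightarrow> nat) \<and> g \<in> borel_measurable M \<and> (AE x in M. (\<lambda>n. f (r n) x) \<longlonglongrightarrow> g x)"
proof -
  have "\<forall>k. \<exists>N. \<forall>m\<ge>N. \<forall>n\<ge>N. measure M {x \<in> space M. (1/2)^k < norm (f m x - f n x)} \<le> (1/2)^k"
    using cauchy by simp
  then obtain N where N: "\<And>k m n. N k \<le> m \<Longrightarrow> N k \<le> n \<Longrightarrow> measure M {x \<in> space M. (1/2)^k < norm (f m x - f n x)} \<le> (1/2)^k"
    by metis
  \<comment> \<open>The running sum dominates every \<open>N i\<close> with
    \<open>i \<le> k\<close>, and the summand \<open>k\<close> makes \<open>r\<close> strictly
    increasing.\<close>
  define r where "r k = k + (\<Sum>i\<le>k. N i)" for k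
  have r: "strict_mono r" by (simp add: strict_mono_Suc_iff r_def)
  have Nr: "N k \<le> r k" "N k \<le> r (Suc k)" for k
    using member_le_sum[of k "{..k}" N] by (auto simp: r_def)
  define A where "A k = {x \<in> space M. (1/2)^k < norm (f (r (Suc k)) x - f (r k) x)}" for k
  have [measurable]: "A k \<in> sets M" for k unfolding A_def by measurable
  have "summable (\<lambda>k. measure M (A k))"
  proof (rule summable_comparison_test')
    show "summable (\<lambda>k. (1/2::real)^k)" by (simp add: summable_geometric)
    show "norm (measure M (A k)) \<le> (1/2)^k" for k using N[OF Nr(2,1)] by (simp add: A_def)
  qed
  then have "AE x in M. eventually (\<lambda>k. x \<in> space M - A k) sequentially"
    by (intro borel_cantelli_AE1) (auto simp: less_top[symmetric])
  then have conv: "AE x in M. convergent (\<lambda>n. f (r n) x)"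
  proof eventually_elim
    case (elim x)
    have "eventually (\<lambda>k. norm (f (r (Suc k)) x - f (r k) x) \<le> (1/2)^k) sequentially"
      using elim by eventually_elim (auto simp: A_def)
    then have "summable (\<lambda>k. f (r (Suc k)) x - f (r k) x)"
      by (rule summable_comparison_test_ev) (simp add: summable_geometric)
    then have "convergent (\<lambda>n. \<Sum>k<n. f (r (Suc k)) x - f (r k) x)" by (simp add: summable_iff_convergent)
    then have "convergent (\<lambda>n. f (r n) x - f (r 0) x)" by (simp add: sum_lessThan_telescope[of "\<lambda>k. f (r k) x"])
    then have "convergent (\<lambda>n. (f (r n) x - f (r 0) x) + f (r 0) x)" by (rule convergent_add) (rule convergent_const)
    then show ?case by simp
  qed
  define g where "g x = lim (\<lambda>n. f (r n) x)" for x
  have "g \<in> borel_measurable M" unfolding g_def by measurable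
  moreover have "AE x in M. (\<lambda>n. f (r n) x) \<longlonglongrightarrow> g x"
    using conv by eventually_elim (simp add: g_def convergent_LIMSEQ_iff)
  ultimately show ?thesis using r by blast
qed

text \<open>The laws are compared on closed sets, which generate the Borel sets: if \<open>U\<close>
  lies in \<open>S\<close> and \<open>V\<close> is close to \<open>U\<close>, then \<open>V\<close>
  lies in a thin closed neighbourhood of \<open>S\<close>, and these decrease to \<open>S\<close>.
  The realising space may vary with \<epsilon>, so approximately optimal couplings are enough to
  apply it.\<close>

lemma distr_eq_of_close:
  fixes \<alpha> \<beta> :: "'a::euclidean_space measure"
  assumes \<alpha>: "prob_space \<alpha>" "sets \<alpha> = sets borel" and \<beta>: "prob_space \<beta>" "sets \<beta> = sets borel"
    and close: "\<And>\<epsilon>. 0 < \<epsilon> \<Longrightarrow> \<exists>(M :: 'b measure) U V. prob_space M \<and> U \<in> borel_measurable M \<and> V \<in> borel_measurable M \<and>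
      distr M borel U = \<alpha> \<and> distr M borel V = \<beta> \<and> measure M {x \<in> space M. \<epsilon> < norm (U x - V x)} \<le> \<epsilon>"
  shows "\<alpha> = \<beta>"
proof -
  have le: "measure \<gamma> S \<le> measure \<gamma>' S"
    if "closed S" "S \<noteq> {}" and \<gamma>': "prob_space \<gamma>'" "sets \<gamma>' = sets borel"
      and cl: "\<And>\<epsilon>. 0 < \<epsilon> \<Longrightarrow> \<exists>(M :: 'b measure) U V. prob_space M \<and> U \<in> borel_measurable M \<and> V \<in> borel_measurable M \<and>
      distr M borel U = \<gamma> \<and> distr M borel V = \<gamma>' \<and> measure M {x \<in> space M. \<epsilon> < norm (U x - V x)} \<le> \<epsilon>"
    for S and \<gamma> \<gamma>' :: "'a measure"
  proof -
    interpret \<gamma>': prob_space \<gamma>' by fact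
    define e where "e n = inverse (real (Suc n))" for n
    have "e = (\<lambda>n. inverse (real (Suc n)))" by (simp add: e_def fun_eq_iff)
    then have e: "0 < e n" "e \<longlonglongrightarrow> 0" for n using LIMSEQ_inverse_real_of_nat by simp_all
    define S' where "S' n = {z. infdist z S \<le> e n}" for n
    have cS': "closed (S' n)" for n unfolding S'_def by (intro closed_Collect_le continuous_intros)
    have "measure \<gamma> S \<le> measure \<gamma>' (S' n) + e n" for n
    proof -
      obtain M :: "'b measure" and U V where M: "prob_space M" and [measurable]: "U \<in> borel_measurable M" "V \<in> borel_measurable M"
        and d: "distr M borel U = \<gamma>" "distr M borel V = \<gamma>'" and p: "measure M {x \<in> space M. e n < norm (U x - V x)} \<le> e n"
        using cl[OF e(1)] by blast
      interpret prob_space M by fact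
      have [measurable]: "S \<in> sets borel" "S' n \<in> sets borel" using \<open>closed S\<close> cS' by auto
      have "measure \<gamma> S = measure M {x \<in> space M. U x \<in> S}" unfolding d[symmetric] by (subst measure_distr) (auto intro!: arg_cong2[where f=measure])
      also have "\<dots> \<le> measure M ({x \<in> space M. V x \<in> S' n} \<union> {x \<in> space M. e n < norm (U x - V x)})"
      proof (rule finite_measure_mono)
        show "{x \<in> space M. U x \<in> S} \<subseteq> {x \<in> space M. V x \<in> S' n} \<union> {x \<in> space M. e n < norm (U x - V x)}"
        proof
          fix x assume x: "x \<in> {x \<in> space M. U x \<in> S}"
          then have "infdist (V x) S \<le> norm (U x - V x)"
            using infdist_le[of "U x" S "V x"] by (simp add: dist_norm norm_minus_commute)
          then show "x \<in> {x \<in> space M. V x \<in> S' n} \<union> {x \<in> space M. e n < norm (U x - V x)}"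
            using x by (auto simp: S'_def)
        qed
      qed measurable
      also have "\<dots> \<le> measure M {x \<in> space M. V x \<in> S' n} + measure M {x \<in> space M. e n < norm (U x - V x)}"
        by (rule measure_Un_le) measurable
      also have "measure M {x \<in> space M. V x \<in> S' n} = measure \<gamma>' (S' n)"
        unfolding d[symmetric] by (subst measure_distr) (auto intro!: arg_cong2[where f=measure])
      finally show ?thesis using p by linarith
    qed
    moreover have "(\<lambda>n. measure \<gamma>' (S' n) + e n) \<longlonglongrightarrow> measure \<gamma>' (\<Inter>n. S' n) + 0"
    proof (intro tendsto_add e(2) \<gamma>'.finite_Lim_measure_decseq)
      show "range S' \<subseteq> sets \<gamma>'" using cS' \<gamma>'(2) by auto
      show "decseq S'" unfolding decseq_def S'_def e_def
        by (auto intro: order_trans[OF _ le_imp_inverse_le])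
    qed
    moreover have "(\<Inter>n. S' n) = S"
    proof
      show "S \<subseteq> (\<Inter>n. S' n)" using e(1) by (auto simp: S'_def less_imp_le)
      show "(\<Inter>n. S' n) \<subseteq> S"
      proof
        fix z assume "z \<in> (\<Inter>n. S' n)"
        then have "infdist z S \<le> e n" for n by (auto simp: S'_def)
        then have "infdist z S \<le> 0" using LIMSEQ_le_const[OF e(2)] by blast
        then show "z \<in> S" using in_closed_iff_infdist_zero[OF \<open>closed S\<close> \<open>S \<noteq> {}\<close>] infdist_nonneg[of z S] by simp
      qed
    qed
    ultimately show ?thesis using LIMSEQ_le_const[of _ "measure \<gamma>' S" "measure \<gamma> S"] by fastforce
  qed
  have close': "\<exists>(M :: 'b measure) U V. prob_space M \<and> U \<in> borel_measurable M \<and> V \<in> borel_measurable M \<and>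
      distr M borel U = \<beta> \<and> distr M borel V = \<alpha> \<and> measure M {x \<in> space M. \<epsilon> < norm (U x - V x)} \<le> \<epsilon>" if "0 < \<epsilon>" for \<epsilon>
    using close[OF that] by (metis (no_types, lifting) Collect_cong norm_minus_commute)
  interpret \<alpha>: prob_space \<alpha> by fact
  interpret \<beta>: prob_space \<beta> by fact
  show ?thesis
  proof (rule measure_eqI_generator_eq[where E="Collect closed" and \<Omega>=UNIV and A="\<lambda>_. UNIV"])
    show "Int_stable (Collect closed :: 'a set set)" by (auto simp: Int_stable_def)
    show "emeasure \<alpha> S = emeasure \<beta> S" if "S \<in> Collect closed" for S
    proof (cases "S = {}")
      case False
      then have "measure \<alpha> S = measure \<beta> S"
        using that le[of S \<beta> \<alpha>] le[of S \<alpha> \<beta>] \<alpha> \<beta> close close' by (intro antisym) auto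
      then show ?thesis by (simp add: \<alpha>.emeasure_eq_measure \<beta>.emeasure_eq_measure)
    qed simp
    show "sets \<alpha> = sigma_sets UNIV (Collect closed)" "sets \<beta> = sigma_sets UNIV (Collect closed)"
      using \<alpha>(2) \<beta>(2) by (simp_all add: borel_eq_closed)
  qed (auto simp: \<alpha>.emeasure_eq_measure)
qed

lemma couplings_swap:
  fixes \<pi> :: "('a::euclidean_space \<times> 'a) measure"
  assumes "\<pi> \<in> couplings \<mu> \<eta>"
  shows "distr \<pi> borel (\<lambda>p. (snd p, fst p)) \<in> couplings \<eta> \<mu>"
    and "(\<integral>p. norm (fst p - snd p) powr \<rho> \<partial>distr \<pi> borel (\<lambda>p. (snd p, fst p))) = (\<integral>p. norm (fst p - snd p) powr \<rho> \<partial>\<pi>)"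
proof -
  have [measurable]: "fst \<in> borel_measurable \<pi>" "snd \<in> borel_measurable \<pi>"
    "fst \<in> borel_measurable (borel :: ('a \<times> 'a) measure)" "snd \<in> borel_measurable (borel :: ('a \<times> 'a) measure)"
    using couplingD[OF assms] by (auto intro!: borel_measurable_continuous_onI continuous_intros)
  show "distr \<pi> borel (\<lambda>p. (snd p, fst p)) \<in> couplings \<eta> \<mu>"
    using couplingD(4,5)[OF assms] unfolding couplings_def by (auto simp: distr_distr comp_def)
  show "(\<integral>p. norm (fst p - snd p) powr \<rho> \<partial>distr \<pi> borel (\<lambda>p. (snd p, fst p))) = (\<integral>p. norm (fst p - snd p) powr \<rho> \<partial>\<pi>)"
    by (subst integral_distr) (auto simp: norm_minus_commute)
qed

lemma couplings_diagonal:
  fixes \<mu> :: "'a::euclidean_space measure"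
  assumes [measurable_cong]: "sets \<mu> = sets borel"
  shows "distr \<mu> borel (\<lambda>x. (x, x)) \<in> couplings \<mu> \<mu>"
proof -
  have [measurable]: "fst \<in> borel_measurable (borel :: ('a \<times> 'a) measure)" "snd \<in> borel_measurable (borel :: ('a \<times> 'a) measure)"
    by (auto intro!: borel_measurable_continuous_onI continuous_intros)
  show ?thesis
    unfolding couplings_def by (auto simp: distr_distr comp_def assms intro!: distr_id2)
qed

lemma couplings_product:
  fixes \<alpha> \<beta> :: "'a::euclidean_space measure"
  assumes "prob_space \<alpha>" "prob_space \<beta>" and s: "sets \<alpha> = sets borel" "sets \<beta> = sets borel"
  shows "\<alpha> \<Otimes>\<^sub>M \<beta> \<in> couplings \<alpha> \<beta>"
proof -
  interpret \<alpha>: prob_space \<alpha> by fact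
  interpret \<beta>: prob_space \<beta> by fact
  have "distr (\<alpha> \<Otimes>\<^sub>M \<beta>) borel snd = distr (\<alpha> \<Otimes>\<^sub>M \<beta>) \<beta> snd" using s by (intro distr_cong) auto
  also have "\<dots> = \<beta>"
  proof (intro measure_eqI)
    fix A assume A: "A \<in> sets (distr (\<alpha> \<Otimes>\<^sub>M \<beta>) \<beta> snd)"
    from A have "emeasure (distr (\<alpha> \<Otimes>\<^sub>M \<beta>) \<beta> snd) A = emeasure (\<alpha> \<Otimes>\<^sub>M \<beta>) (space \<alpha> \<times> A)"
      by (auto simp add: emeasure_distr space_pair_measure dest: sets.sets_into_space intro!: arg_cong2[where f=emeasure])
    with A show "emeasure (distr (\<alpha> \<Otimes>\<^sub>M \<beta>) \<beta> snd) A = emeasure \<beta> A"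
      by (simp add: \<beta>.emeasure_pair_measure_Times \<alpha>.emeasure_space_1)
  qed simp
  finally have 2: "distr (\<alpha> \<Otimes>\<^sub>M \<beta>) borel snd = \<beta>" .
  have "distr (\<alpha> \<Otimes>\<^sub>M \<beta>) borel fst = distr (\<alpha> \<Otimes>\<^sub>M \<beta>) \<alpha> fst" using s by (intro distr_cong) auto
  then have 1: "distr (\<alpha> \<Otimes>\<^sub>M \<beta>) borel fst = \<alpha>" by (simp add: \<beta>.distr_pair_fst)
  have "sets (\<alpha> \<Otimes>\<^sub>M \<beta>) = sets (borel \<Otimes>\<^sub>M borel)" using s by (rule sets_pair_measure_cong)
  also have "\<dots> = sets (borel :: ('a \<times> 'a) measure)" by (simp only: borel_prod)
  finally show ?thesis using 1 2 by (simp add: couplings_def)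
qed

text \<open>Passage between the distance and actual couplings. The product coupling keeps the
  infimum finite, so \<open>real_of_ereal\<close> is faithful.\<close>

lemma
  assumes \<alpha>: "\<alpha> \<in> prob_moment \<rho>" and \<beta>: "\<beta> \<in> prob_moment \<rho>" and \<rho>: "1 \<le> \<rho>"
  shows wasserstein_dist_less: "wasserstein_dist \<rho> \<alpha> \<beta> < d \<Longrightarrow>
      \<exists>\<pi> \<in> couplings \<alpha> \<beta>. (\<integral>p. norm (fst p - snd p) powr \<rho> \<partial>\<pi>) < d powr \<rho>"
    and wasserstein_dist_le: "\<pi> \<in> couplings \<alpha> \<beta> \<Longrightarrow>
      wasserstein_dist \<rho> \<alpha> \<beta> \<le> (\<integral>p. norm (fst p - snd p) powr \<rho> \<partial>\<pi>) powr (1 / \<rho>)"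
proof -
  define I where "I \<pi> = (\<integral>p. norm (fst p - snd p) powr \<rho> \<partial>\<pi>)" for \<pi> :: "('a \<times> 'a) measure"
  have eq: "ext_integral \<pi> (\<lambda>(x, y). norm (x - y) powr \<rho>) = ereal (I \<pi>)" if "\<pi> \<in> couplings \<alpha> \<beta>" for \<pi>
    using ext_integral_integrable[OF coupling_powr_integrable[OF that \<alpha> \<beta>]] \<rho> by (simp add: case_prod_beta' I_def)
  define W where "W = transport_cost (\<lambda>z. norm z powr \<rho>) \<alpha> \<beta>"
  have W: "W = (INF \<pi> \<in> couplings \<alpha> \<beta>. ereal (I \<pi>))"
    unfolding W_def transport_cost_def using eq by (intro INF_cong) auto
  have "\<alpha> \<Otimes>\<^sub>M \<beta> \<in> couplings \<alpha> \<beta>" using \<alpha> \<beta> by (intro couplings_product) (auto simp: prob_moment_def)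
  then have "W \<le> ereal (I (\<alpha> \<Otimes>\<^sub>M \<beta>))" unfolding W by (rule INF_lower)
  moreover have "0 \<le> W" unfolding W by (intro INF_greatest) (simp add: I_def)
  ultimately obtain w where w: "W = ereal w" "0 \<le> w" by (cases W) auto
  have wd: "wasserstein_dist \<rho> \<alpha> \<beta> = w powr (1 / \<rho>)" using w by (simp add: wasserstein_dist_def W_def[symmetric])
  show "wasserstein_dist \<rho> \<alpha> \<beta> \<le> (\<integral>p. norm (fst p - snd p) powr \<rho> \<partial>\<pi>) powr (1 / \<rho>)" if "\<pi> \<in> couplings \<alpha> \<beta>"
  proof -
    have "W \<le> ereal (I \<pi>)" unfolding W using that by (rule INF_lower)
    then show ?thesis using w \<rho> unfolding wd I_def[symmetric] by (intro powr_mono2) auto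
  qed
  show "\<exists>\<pi> \<in> couplings \<alpha> \<beta>. (\<integral>p. norm (fst p - snd p) powr \<rho> \<partial>\<pi>) < d powr \<rho>" if "wasserstein_dist \<rho> \<alpha> \<beta> < d"
  proof -
    have "(w powr (1 / \<rho>)) powr \<rho> < d powr \<rho>" using that \<rho> unfolding wd by (intro powr_less_mono2) auto
    then have "W < ereal (d powr \<rho>)" using w \<rho> by (simp add: powr_powr)
    then show ?thesis unfolding W INF_less_iff by (auto simp: I_def)
  qed
qed

lemma wasserstein_tendsto_couplings:
  assumes "wasserstein_tendsto \<rho> \<mu>s \<mu>" "1 \<le> \<rho>" "0 < \<delta>"
  shows "\<forall>\<^sub>F k in sequentially. \<exists>\<pi> \<in> couplings (\<mu>s k) \<mu>. (\<integral>p. norm (fst p - snd p) powr \<rho> \<partial>\<pi>) \<le> \<delta>"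
proof -
  have m: "\<And>k. \<mu>s k \<in> prob_moment \<rho>" "\<mu> \<in> prob_moment \<rho>" and lim: "(\<lambda>k. wasserstein_dist \<rho> (\<mu>s k) \<mu>) \<longlonglongrightarrow> 0"
    using assms by (auto simp: wasserstein_tendsto_def)
  have "0 < \<delta> powr (1 / \<rho>)" using assms by simp
  from order_tendstoD(2)[OF lim this] show ?thesis
  proof eventually_elim
    case (elim k)
    obtain \<pi> where "\<pi> \<in> couplings (\<mu>s k) \<mu>" "(\<integral>p. norm (fst p - snd p) powr \<rho> \<partial>\<pi>) < (\<delta> powr (1 / \<rho>)) powr \<rho>"
      using wasserstein_dist_less[OF m(1,2) \<open>1 \<le> \<rho>\<close> elim] by blast
    then show ?case using assms by (intro bexI[of _ \<pi>]) (auto simp: powr_powr)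
  qed
qed

text \<open>All larger levels are included so that finitely many levels can be merged into
  one.\<close>

lemma excess_eventually_small:
  fixes f :: "'b \<Rightarrow> real"
  assumes f: "integrable M f" and "0 < e"
  obtains B where "0 \<le> B" "\<And>B'. B \<le> B' \<Longrightarrow> (\<integral>x. max 0 (f x - B') \<partial>M) \<le> e"
proof -
  have [measurable]: "f \<in> borel_measurable M" using f by auto
  have "(\<lambda>n. \<integral>x. max 0 (f x - real n) \<partial>M) \<longlonglongrightarrow> (\<integral>x. 0 \<partial>M)"
  proof (rule integral_dominated_convergence[where w="\<lambda>x. \<bar>f x\<bar>"])
    show "AE x in M. (\<lambda>n. max 0 (f x - real n)) \<longlonglongrightarrow> 0"
    proof (intro AE_I2 tendsto_eventually)
      fix x
      obtain N where "f x \<le> real N" using real_arch_simple by blast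
      then show "\<forall>\<^sub>F n in sequentially. max 0 (f x - real n) = 0"
        by (intro eventually_sequentiallyI[of N]) auto
    qed
  qed (use f in auto)
  then have "\<forall>\<^sub>F n in sequentially. (\<integral>x. max 0 (f x - real n) \<partial>M) < e"
    using \<open>0 < e\<close> by (intro order_tendstoD(2)) auto
  then obtain n where n: "(\<integral>x. max 0 (f x - real n) \<partial>M) < e" by (auto simp: eventually_sequentially)
  show ?thesis
  proof (rule that[of "real n"])
    fix B' assume "real n \<le> B'"
    then have "(\<integral>x. max 0 (f x - B') \<partial>M) \<le> (\<integral>x. max 0 (f x - real n) \<partial>M)"
    proof (intro integral_mono)
      show "integrable M (\<lambda>x. max 0 (f x - B'))" "integrable M (\<lambda>x. max 0 (f x - real n))"
        using \<open>real n \<le> B'\<close> of_nat_0_le_iff[of n]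
        by (auto intro!: Bochner_Integration.integrable_bound[OF f] AE_I2 simp: abs_if)
    qed auto
    then show "(\<integral>x. max 0 (f x - B') \<partial>M) \<le> e" using n by linarith
  qed simp
qed

section \<open>Optimal maps and their stability\<close>

text \<open>Along a coupling, \<open>norm x powr \<rho>\<close> is at most
  \<open>2 powr \<rho>\<close> times the sum of the powers of the second point and of the
  displacement. The excess is thus inherited from the limit up to a small transport cost; the
  finitely many remaining indices are treated one by one.\<close>

lemma ui_bound_family:
  assumes W: "wasserstein_tendsto \<rho> \<mu>s \<mu>" and \<rho>: "1 \<le> \<rho>"
  obtains B where "\<And>e. 0 \<le> B e" "ui_bound \<mu> (\<lambda>x. norm x powr \<rho>) B" "\<And>k. ui_bound (\<mu>s k) (\<lambda>x. norm x powr \<rho>) B"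
proof -
  have m: "\<mu>s k \<in> prob_moment \<rho>" "\<mu> \<in> prob_moment \<rho>" for k using W by (auto simp: wasserstein_tendsto_def)
  have i: "integrable (\<mu>s k) (\<lambda>x. norm x powr \<rho>)" "integrable \<mu> (\<lambda>x. norm x powr \<rho>)" for k
    using m by (auto simp: prob_moment_def)
  have "\<exists>b\<ge>0. (\<integral>x. max 0 (norm x powr \<rho> - b) \<partial>\<mu>) \<le> e \<and> (\<forall>k. (\<integral>x. max 0 (norm x powr \<rho> - b) \<partial>\<mu>s k) \<le> e)"
    if e: "0 < e" for e
  proof -
    define \<delta> where "\<delta> = e / (2 * 2 powr \<rho>)"
    have \<delta>: "0 < \<delta>" "2 powr \<rho> * \<delta> = e / 2" using e by (auto simp: \<delta>_def)
    obtain N where N: "\<And>k. N \<le> k \<Longrightarrow> \<exists>\<pi> \<in> couplings (\<mu>s k) \<mu>. (\<integral>p. norm (fst p - snd p) powr \<rho> \<partial>\<pi>) \<le> \<delta>"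
      using wasserstein_tendsto_couplings[OF W \<rho> \<delta>(1)] by (auto simp: eventually_sequentially)
    obtain b0 where b0: "0 \<le> b0" "\<And>b. b0 \<le> b \<Longrightarrow> (\<integral>x. max 0 (norm x powr \<rho> - b) \<partial>\<mu>) \<le> e"
      using excess_eventually_small[OF i(2) e] by metis
    obtain b1 where b1: "0 \<le> b1" "\<And>b. b1 \<le> b \<Longrightarrow> (\<integral>x. max 0 (2 powr \<rho> * norm x powr \<rho> - b) \<partial>\<mu>) \<le> e / 2"
      using excess_eventually_small[of \<mu> "\<lambda>x. 2 powr \<rho> * norm x powr \<rho>" "e / 2"] i(2) e by auto
    have "\<exists>c\<ge>0. \<forall>b\<ge>c. (\<integral>x. max 0 (norm x powr \<rho> - b) \<partial>\<mu>s k) \<le> e" for k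
      using excess_eventually_small[OF i(1) e, of k] by metis
    then obtain c where c: "\<And>k. 0 \<le> c k" "\<And>k b. c k \<le> b \<Longrightarrow> (\<integral>x. max 0 (norm x powr \<rho> - b) \<partial>\<mu>s k) \<le> e"
      by metis
    \<comment> \<open>A sum of nonnegative levels replaces their maximum, as every larger level
      works too.\<close>
    define b where "b = b0 + b1 + (\<Sum>k<N. c k)"
    have cs: "0 \<le> (\<Sum>k<N. c k)" using c(1) by (simp add: sum_nonneg)
    have b: "0 \<le> b" "b0 \<le> b" "b1 \<le> b" using b0 b1 cs by (auto simp: b_def)
    have ck: "c k \<le> b" if "k < N" for k
      using member_le_sum[of k "{..<N}" c] that c(1) b0(1) b1(1) by (simp add: b_def)
    have "(\<integral>x. max 0 (norm x powr \<rho> - b) \<partial>\<mu>s k) \<le> e" for k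
    proof (cases "k < N")
      case True
      then show ?thesis using c(2)[OF ck] by simp
    next
      case False
      then obtain \<pi> where \<pi>: "\<pi> \<in> couplings (\<mu>s k) \<mu>" "(\<integral>p. norm (fst p - snd p) powr \<rho> \<partial>\<pi>) \<le> \<delta>" using N[of k] by auto
      have iW: "integrable \<pi> (\<lambda>p. norm (fst p - snd p) powr \<rho>)"
        using coupling_powr_integrable[OF \<pi>(1) m(1,2)] \<rho> by simp
      have "prob_space \<mu>" using m(2) by (simp add: prob_moment_def)
      interpret prob_space \<mu> by fact
      have "prob_space (\<mu>s k)" using m(1) by (simp add: prob_moment_def)
      interpret k: prob_space "\<mu>s k" by fact
      have i1: "integrable \<pi> (\<lambda>p. max 0 (2 powr \<rho> * norm (snd p) powr \<rho> - b))"
        using coupling_snd(1)[OF \<pi>(1), of "\<lambda>x. max 0 (2 powr \<rho> * norm x powr \<rho> - b)"] i(2) by auto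
      have i2: "integrable \<pi> (\<lambda>p. max 0 (norm (fst p) powr \<rho> - b))"
        using coupling_fst(1)[OF \<pi>(1), of "\<lambda>x. max 0 (norm x powr \<rho> - b)"] i(1) by auto
      have "(\<integral>x. max 0 (norm x powr \<rho> - b) \<partial>\<mu>s k) = (\<integral>p. max 0 (norm (fst p) powr \<rho> - b) \<partial>\<pi>)"
        using coupling_fst(2)[OF \<pi>(1), of "\<lambda>x. max 0 (norm x powr \<rho> - b)"] by simp
      also have "\<dots> \<le> (\<integral>p. max 0 (2 powr \<rho> * norm (snd p) powr \<rho> - b) + 2 powr \<rho> * norm (fst p - snd p) powr \<rho> \<partial>\<pi>)"
      proof (rule integral_mono[OF i2])
        show "integrable \<pi> (\<lambda>p. max 0 (2 powr \<rho> * norm (snd p) powr \<rho> - b) + 2 powr \<rho> * norm (fst p - snd p) powr \<rho>)"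
          using i1 iW by auto
        show "max 0 (norm (fst p) powr \<rho> - b) \<le> max 0 (2 powr \<rho> * norm (snd p) powr \<rho> - b) + 2 powr \<rho> * norm (fst p - snd p) powr \<rho>" for p
        proof -
          have "norm (fst p) powr \<rho> \<le> 2 powr \<rho> * (norm (snd p) powr \<rho> + norm (fst p - snd p) powr \<rho>)"
            using norm_add_powr_le[of \<rho> "snd p" "fst p - snd p"] \<rho> by simp
          moreover have "0 \<le> 2 powr \<rho> * norm (fst p - snd p) powr \<rho>" by simp
          ultimately show ?thesis by (simp add: distrib_left max_def)
        qed
      qed
      also have "\<dots> = (\<integral>x. max 0 (2 powr \<rho> * norm x powr \<rho> - b) \<partial>\<mu>) + 2 powr \<rho> * (\<integral>p. norm (fst p - snd p) powr \<rho> \<partial>\<pi>)"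
        using i1 iW coupling_snd(2)[OF \<pi>(1), of "\<lambda>x. max 0 (2 powr \<rho> * norm x powr \<rho> - b)"] by simp
      also have "\<dots> \<le> e / 2 + 2 powr \<rho> * \<delta>" using b1(2)[OF b(3)] \<pi>(2) by (intro add_mono mult_left_mono) auto
      finally show ?thesis using \<delta>(2) by simp
    qed
    then show ?thesis using b0(2)[OF b(2)] b(1) by blast
  qed
  then obtain b where b: "\<And>e. 0 < e \<Longrightarrow> 0 \<le> b e" "\<And>e. 0 < e \<Longrightarrow> (\<integral>x. max 0 (norm x powr \<rho> - b e) \<partial>\<mu>) \<le> e"
    "\<And>e k. 0 < e \<Longrightarrow> (\<integral>x. max 0 (norm x powr \<rho> - b e) \<partial>\<mu>s k) \<le> e"
    by metis
  \<comment> \<open>The default 0 for \<open>e \<le> 0\<close> makes the modulus nonnegative at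
    every argument.\<close>
  show ?thesis
    by (rule that[of "\<lambda>e. if 0 < e then b e else 0"]) (use b i in \<open>auto simp: ui_bound_def\<close>)
qed

lemma (in prob_space) AE_eq_of_close:
  fixes f g :: "'a \<Rightarrow> 'b::euclidean_space"
  assumes [measurable]: "f \<in> borel_measurable M" "g \<in> borel_measurable M"
    and close: "\<And>\<epsilon>. 0 < \<epsilon> \<Longrightarrow> measure M {x \<in> space M. \<epsilon> < norm (f x - g x)} \<le> \<epsilon>"
  shows "AE x in M. f x = g x"
proof -
  have "AE x in M. norm (f x - g x) \<le> inverse (real (Suc n))" for n
  proof -
    define A where "A = {x \<in> space M. inverse (real (Suc n)) < norm (f x - g x)}"
    have [measurable]: "A \<in> sets M" unfolding A_def by measurable
    have "measure M A \<le> e" if "0 < e" for e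
    proof -
      \<comment> \<open>One number serves as distance and as probability, so the event at the fixed
        threshold is enlarged to the one at \<open>e'\<close>.\<close>
      define e' where "e' = min e (inverse (real (Suc n)))"
      have e': "0 < e'" "e' \<le> e" "e' \<le> inverse (real (Suc n))" using that by (auto simp: e'_def)
      have "measure M A \<le> measure M {x \<in> space M. e' < norm (f x - g x)}"
        using e' by (intro finite_measure_mono) (auto simp: A_def)
      then show ?thesis using close[OF e'(1)] e'(2) by linarith
    qed
    then have "measure M A \<le> 0 + e" if "0 < e" for e using that by simp
    then have "measure M A \<le> 0" by (rule field_le_epsilon)
    then have "measure M A = 0" using measure_nonneg[of M A] by linarith
    then have "emeasure M A = 0" by (simp add: emeasure_eq_measure)
    then have "AE x in M. x \<notin> A" by (intro AE_not_in) (auto simp: null_sets_def)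
    then show ?thesis by (rule AE_mp) (auto intro!: AE_I2 simp: A_def)
  qed
  then have "AE x in M. \<forall>n. norm (f x - g x) \<le> inverse (real (Suc n))" by (simp add: AE_all_countable)
  then show ?thesis
  proof eventually_elim
    case (elim x)
    then have "norm (f x - g x) \<le> 0" using LIMSEQ_le_const[OF LIMSEQ_inverse_real_of_nat] by blast
    then show ?case by simp
  qed
qed

section \<open>Existence and uniqueness of optimal maps and minimizers\<close>

context convex_cost
begin

text \<open>One inequality suffices: the other follows by exchanging the roles of two data with the
  same moduli.\<close>

lemma value_perturb:
  fixes B1 B2 :: "real \<Rightarrow> real"
  assumes B: "\<And>e. 0 \<le> B1 e" "\<And>e. 0 \<le> B2 e" and \<epsilon>: "0 < \<epsilon>"
  shows "\<exists>\<delta>>0. \<forall>\<mu> \<nu> \<mu>' \<nu>' \<kappa>. bounded_data B1 B2 \<mu> \<nu> \<longrightarrow> near_data \<delta> \<mu> \<nu> \<mu>' \<nu>' \<kappa> \<longrightarrow>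
    value_of \<mu>' \<nu>' \<le> value_of \<mu> \<nu> + \<epsilon>"
proof -
  have "0 < \<epsilon> / 2" using \<epsilon> by simp
  from perturb[of B1 B2, OF B this] obtain \<delta> where \<delta>: "0 < \<delta>"
    and P: "\<forall>\<mu> \<nu> T \<mu>' \<nu>' \<kappa>. bounded_data B1 B2 \<mu> \<nu> \<longrightarrow> near_data \<delta> \<mu> \<nu> \<mu>' \<nu>' \<kappa> \<longrightarrow> competitor \<mu> (\<lambda>x. x) T \<mu> \<nu> \<longrightarrow>
      (\<exists>S. competitor \<kappa> snd (\<lambda>p. S (fst p)) \<mu>' \<nu>' \<and> (\<integral>p. norm (S (fst p) - T (fst p)) \<partial>\<kappa>) \<le> \<epsilon> / 2 \<and>
        (\<integral>p. \<theta> (snd p - S (fst p)) \<partial>\<kappa>) \<le> (\<integral>x. \<theta> (x - T x) \<partial>\<mu>) + \<epsilon> / 2)"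
    by (elim exE conjE) (rule that)
  have "value_of \<mu>' \<nu>' \<le> value_of \<mu> \<nu> + \<epsilon>"
    if bd: "bounded_data B1 B2 \<mu> \<nu>" and near: "near_data \<delta> \<mu> \<nu> \<mu>' \<nu>' \<kappa>" for \<mu> \<nu> \<mu>' \<nu>' \<kappa>
  proof -
    have \<mu>: "\<mu> \<in> prob_moment \<rho>" and \<nu>: "\<nu> \<in> prob_moment 1" using bd by (auto simp: bounded_data_def)
    have \<mu>': "\<mu>' \<in> prob_moment \<rho>" and \<nu>': "\<nu>' \<in> prob_moment 1" using near by (auto simp: near_data_def)
    obtain T where T: "competitor \<mu> (\<lambda>x. x) T \<mu> \<nu>" "(\<integral>x. \<theta> (x - T x) \<partial>\<mu>) \<le> value_of \<mu> \<nu> + \<epsilon> / 2"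
      using near_optimal_map[OF \<mu> \<nu> \<open>0 < \<epsilon> / 2\<close>] by blast
    obtain S where S: "competitor \<kappa> snd (\<lambda>p. S (fst p)) \<mu>' \<nu>'"
      "(\<integral>p. \<theta> (snd p - S (fst p)) \<partial>\<kappa>) \<le> (\<integral>x. \<theta> (x - T x) \<partial>\<mu>) + \<epsilon> / 2"
      using P[rule_format, OF bd near T(1)] by blast
    show ?thesis using value_le[OF \<mu>' \<nu>' S(1)] S(2) T(2) by linarith
  qed
  then show ?thesis using \<delta> by blast
qed

lemma near_optimal_close_fixed:
  assumes strict: "strictly_convex \<theta>" and \<epsilon>: "0 < \<epsilon>" and \<mu>: "\<mu> \<in> prob_moment \<rho>" and \<nu>: "\<nu> \<in> prob_moment 1"
  shows "\<exists>\<delta>>0. \<forall>(M :: 'b measure) X Y Y'. competitor M X Y \<mu> \<nu> \<longrightarrow> competitor M X Y' \<mu> \<nu> \<longrightarrow>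
    (\<integral>x. \<theta> (X x - Y x) \<partial>M) \<le> value_of \<mu> \<nu> + \<delta> \<longrightarrow> (\<integral>x. \<theta> (X x - Y' x) \<partial>M) \<le> value_of \<mu> \<nu> + \<delta> \<longrightarrow>
    measure M {x \<in> space M. \<epsilon> < norm (Y x - Y' x)} \<le> \<epsilon>"
proof -
  have "0 \<le> (\<integral>x. norm x \<partial>\<mu>) + (\<integral>z. norm z \<partial>\<nu>)" by simp
  from near_optimal_close[OF strict \<epsilon> this, where 'b='b] show ?thesis using \<mu> \<nu> by (meson order_refl)
qed

text \<open>The transport cost of the image law lies between the value and the cost of the map, so
  both equalities in \<open>optimal_map\<close> follow from one inequality between the outer
  terms.\<close>

lemma optimal_map_iff:
  assumes \<mu>: "\<mu> \<in> prob_moment \<rho>" and \<nu>: "\<nu> \<in> prob_moment 1"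
  shows "optimal_map \<theta> \<mu> \<nu> T \<longleftrightarrow> competitor \<mu> (\<lambda>x. x) T \<mu> \<nu> \<and> (\<integral>x. \<theta> (x - T x) \<partial>\<mu>) \<le> value_of \<mu> \<nu>"
    (is "?L \<longleftrightarrow> ?R")
proof -
  have [measurable_cong]: "sets \<mu> = sets borel" using \<mu> by (simp add: prob_moment_def)
  interpret prob_space \<mu> using \<mu> by (simp add: prob_moment_def)
  note V = weak_transport_cost_finite[OF \<mu> \<nu>]
  have id: "distr \<mu> borel (\<lambda>x. x) = \<mu>" by (rule distr_id2) (use \<mu> in \<open>simp add: prob_moment_def\<close>)
  have ix: "integrable \<mu> (\<lambda>x. x)" using prob_moment_1[OF \<mu> \<rho>] by (simp add: prob_moment_1_iff)
  show ?thesis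
  proof
    assume L: ?L
    then have T[measurable]: "T \<in> borel_measurable borel" and le: "distr \<mu> borel T \<le>\<^sub>c \<nu>"
      and eq: "ext_integral \<mu> (\<lambda>x. \<theta> (x - T x)) = ereal (value_of \<mu> \<nu>)"
      by (auto simp: optimal_map_def V)
    have Tm: "T \<in> borel_measurable \<mu>" by measurable
    have neg: "(\<integral>\<^sup>+x. ennreal (- \<theta> (x - T x)) \<partial>\<mu>) < \<infinity>"
      using ix convex_order_distrD(2)[OF le Tm] by (intro convex_neg_part_finite[OF convex finite_measure_axioms]) auto
    have m: "(\<lambda>x. \<theta> (x - T x)) \<in> borel_measurable \<mu>" by measurable
    have i: "integrable \<mu> (\<lambda>x. \<theta> (x - T x))"
      using ext_integral_not_integrable[OF m neg] eq by auto
    then show ?R using T le eq ext_integral_integrable[OF i] by (simp add: competitor_self[OF \<mu>])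
  next
    assume R: ?R
    then have T[measurable]: "T \<in> borel_measurable borel" and le: "distr \<mu> borel T \<le>\<^sub>c \<nu>"
      and i: "integrable \<mu> (\<lambda>x. \<theta> (x - T x))" by (auto simp: competitor_self[OF \<mu>])
    have 1: "transport_cost \<theta> \<mu> (distr \<mu> borel T) \<le> ereal (\<integral>x. \<theta> (x - T x) \<partial>\<mu>)"
      using transport_cost_le[of "\<lambda>x. x" \<mu> T] i by (simp add: id)
    have 2: "weak_transport_cost \<theta> \<mu> \<nu> \<le> transport_cost \<theta> \<mu> (distr \<mu> borel T)"
      unfolding weak_transport_cost_def using le by (intro INF_lower) auto
    have 3: "ereal (\<integral>x. \<theta> (x - T x) \<partial>\<mu>) \<le> weak_transport_cost \<theta> \<mu> \<nu>" using R by (simp add: V)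
    show ?L
      using T le antisym[OF 1 order_trans[OF 3 2]] antisym[OF 2 order_trans[OF 1 3]]
      by (simp add: optimal_map_def ext_integral_integrable[OF i])
  qed
qed

text \<open>Strict convexity makes nearly optimal maps Cauchy in probability, which replaces weak
  compactness; the order constraint and the cost bound pass to an almost sure limit by
  Fatou.\<close>

lemma optimal_map_exists:
  assumes strict: "strictly_convex \<theta>" and \<mu>: "\<mu> \<in> prob_moment \<rho>" and \<nu>: "\<nu> \<in> prob_moment 1"
  shows "\<exists>T. optimal_map \<theta> \<mu> \<nu> T"
proof -
  have sets_\<mu>[measurable_cong]: "sets \<mu> = sets borel" using \<mu> by (simp add: prob_moment_def)
  interpret prob_space \<mu> using \<mu> by (simp add: prob_moment_def)
  have ix: "integrable \<mu> (\<lambda>x. x)" using prob_moment_1[OF \<mu> \<rho>] by (simp add: prob_moment_1_iff)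
  define e where "e n = inverse (real (Suc n))" for n
  have e_eq: "e = (\<lambda>n. inverse (real (Suc n)))" by (simp add: e_def fun_eq_iff)
  have e: "0 < e n" "e \<longlonglongrightarrow> 0" for n using LIMSEQ_inverse_real_of_nat by (simp_all add: e_eq)
  have "\<forall>n. \<exists>T. competitor \<mu> (\<lambda>x. x) T \<mu> \<nu> \<and> (\<integral>x. \<theta> (x - T x) \<partial>\<mu>) \<le> value_of \<mu> \<nu> + e n"
    using near_optimal_map[OF \<mu> \<nu> e(1)] by blast
  then obtain F where comp: "\<And>n. competitor \<mu> (\<lambda>x. x) (F n) \<mu> \<nu>"
    and F4: "\<And>n. (\<integral>x. \<theta> (x - F n x) \<partial>\<mu>) \<le> value_of \<mu> \<nu> + e n" by metis
  have F: "F n \<in> borel_measurable borel" "distr \<mu> borel (F n) \<le>\<^sub>c \<nu>" "integrable \<mu> (\<lambda>x. \<theta> (x - F n x))" for n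
    using comp[of n] by (auto simp: competitor_self[OF \<mu>])
  note [measurable] = F(1)
  have Fm: "F n \<in> borel_measurable \<mu>" for n by measurable
  have cauchy: "\<exists>N. \<forall>m\<ge>N. \<forall>n\<ge>N. measure \<mu> {x \<in> space \<mu>. \<epsilon> < norm (F m x - F n x)} \<le> \<epsilon>" if \<epsilon>: "0 < \<epsilon>" for \<epsilon>
  proof -
    obtain \<delta> where \<delta>: "0 < \<delta>" and close: "\<And>S T. competitor \<mu> (\<lambda>x. x) S \<mu> \<nu> \<Longrightarrow> competitor \<mu> (\<lambda>x. x) T \<mu> \<nu> \<Longrightarrow>
      (\<integral>x. \<theta> (x - S x) \<partial>\<mu>) \<le> value_of \<mu> \<nu> + \<delta> \<Longrightarrow> (\<integral>x. \<theta> (x - T x) \<partial>\<mu>) \<le> value_of \<mu> \<nu> + \<delta> \<Longrightarrow>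
      measure \<mu> {x \<in> space \<mu>. \<epsilon> < norm (S x - T x)} \<le> \<epsilon>"
      using near_optimal_close_fixed[OF strict \<epsilon> \<mu> \<nu>, where 'b='a] by blast
    obtain N where N: "\<And>n. N \<le> n \<Longrightarrow> e n < \<delta>"
      using order_tendstoD(2)[OF e(2) \<delta>] by (auto simp: eventually_sequentially)
    have "measure \<mu> {x \<in> space \<mu>. \<epsilon> < norm (F m x - F n x)} \<le> \<epsilon>" if "N \<le> m" "N \<le> n" for m n
      using close[OF comp comp, of m n] F4[of m] F4[of n] N[OF that(1)] N[OF that(2)] by linarith
    then show ?thesis by blast
  qed
  obtain r T where r: "strict_mono (r :: nat \<Rightarrow> nat)" and T\<mu>[measurable]: "T \<in> borel_measurable \<mu>"
    and lim: "AE x in \<mu>. (\<lambda>n. F (r n) x) \<longlonglongrightarrow> T x"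
    using cauchy_in_prob_subseq[of F, OF Fm cauchy] by blast
  have T: "T \<in> borel_measurable borel" using T\<mu> measurable_cong_sets[OF sets_\<mu> refl] by blast
  have le: "distr \<mu> borel T \<le>\<^sub>c \<nu>" 
    by (rule convex_order_distr_limit[where Y="\<lambda>n. F (r n)", OF F(2) Fm T\<mu> lim])
  \<comment> \<open>Fatou's lemma is used for a nonnegative integrand: an affine minorant is
    subtracted, and its integral \<open>c0\<close> is common to all competitors because means agree
    along the convex order.\<close>
  obtain \<alpha> \<beta> where ab: "\<And>y. \<alpha> + \<beta> \<bullet> y \<le> \<theta> y" using convex_affine_minorant[OF convex] by blast
  define \<psi> where "\<psi> y = \<theta> y - (\<alpha> + \<beta> \<bullet> y)" for y
  have \<psi>0: "0 \<le> \<psi> y" for y using ab by (simp add: \<psi>_def)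
  have c\<psi>: "continuous_on UNIV \<psi>" unfolding \<psi>_def using convex_continuous_UNIV[OF convex] by (intro continuous_intros)
  have [measurable]: "\<psi> \<in> borel_measurable borel" using c\<psi> by (rule borel_measurable_continuous_onI)
  define c0 where "c0 = \<alpha> + \<beta> \<bullet> ((\<integral>x. x \<partial>\<mu>) - (\<integral>z. z \<partial>\<nu>))"
  have aff: "integrable \<mu> (\<lambda>x. \<alpha> + \<beta> \<bullet> (x - S x))" "(\<integral>x. \<alpha> + \<beta> \<bullet> (x - S x) \<partial>\<mu>) = c0"
    if "distr \<mu> borel S \<le>\<^sub>c \<nu>" "S \<in> borel_measurable \<mu>" for S
    using ix convex_order_distrD(2)[OF that] convex_order_distr_mean[OF that]
    by (simp_all add: c0_def prob_space)
  have i\<psi>: "integrable \<mu> (\<lambda>x. \<psi> (x - F n x))" "(\<integral>x. \<psi> (x - F n x) \<partial>\<mu>) \<le> value_of \<mu> \<nu> + e n - c0" for n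
    using F(3)[of n] F4[of n] aff[OF F(2) Fm, of n] by (simp_all add: \<psi>_def)
  \<comment> \<open>As \<open>ennreal\<close> sends negative numbers to 0, this sign is what allows
    the final inequality to be read between reals.\<close>
  have v: "0 \<le> value_of \<mu> \<nu> - c0"
  proof (rule field_le_epsilon)
    fix x :: real assume "0 < x"
    obtain n where "e n < x" using order_tendstoD(2)[OF e(2) \<open>0 < x\<close>] by (auto simp: eventually_sequentially)
    moreover have "0 \<le> (\<integral>x. \<psi> (x - F n x) \<partial>\<mu>)" using \<psi>0 by simp
    ultimately show "0 \<le> value_of \<mu> \<nu> - c0 + x" using i\<psi>(2)[of n] by linarith
  qed
  have "(\<integral>\<^sup>+x. ennreal (\<psi> (x - T x)) \<partial>\<mu>) = (\<integral>\<^sup>+x. liminf (\<lambda>n. ennreal (\<psi> (x - F (r n) x))) \<partial>\<mu>)"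
  proof (rule nn_integral_cong_AE)
    show "AE x in \<mu>. ennreal (\<psi> (x - T x)) = liminf (\<lambda>n. ennreal (\<psi> (x - F (r n) x)))"
      using lim
    proof eventually_elim
      case (elim x)
      have "(\<lambda>n. x - F (r n) x) \<longlonglongrightarrow> x - T x" using elim by (intro tendsto_intros)
      then have "(\<lambda>n. \<psi> (x - F (r n) x)) \<longlonglongrightarrow> \<psi> (x - T x)"
        by (rule continuous_on_tendsto_compose[OF c\<psi>]) auto
      then have "(\<lambda>n. ennreal (\<psi> (x - F (r n) x))) \<longlonglongrightarrow> ennreal (\<psi> (x - T x))" by (rule tendsto_ennrealI)
      then show ?case using lim_imp_Liminf[OF sequentially_bot] by metis
    qed
  qed
  also have "\<dots> \<le> liminf (\<lambda>n. \<integral>\<^sup>+x. ennreal (\<psi> (x - F (r n) x)) \<partial>\<mu>)" by (rule nn_integral_liminf) measurable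
  also have "\<dots> \<le> liminf (\<lambda>n. ennreal (value_of \<mu> \<nu> + e (r n) - c0))"
  proof (intro Liminf_mono always_eventually allI)
    fix n
    show "(\<integral>\<^sup>+x. ennreal (\<psi> (x - F (r n) x)) \<partial>\<mu>) \<le> ennreal (value_of \<mu> \<nu> + e (r n) - c0)"
      using nn_integral_eq_integral[OF i\<psi>(1)[of "r n"]] i\<psi>(2)[of "r n"] \<psi>0 by (simp add: ennreal_leI)
  qed
  also have "\<dots> = ennreal (value_of \<mu> \<nu> - c0)"
  proof (intro lim_imp_Liminf tendsto_ennrealI sequentially_bot)
    have "(\<lambda>n. e (r n)) \<longlonglongrightarrow> 0" using LIMSEQ_subseq_LIMSEQ[OF e(2) r] by (simp add: comp_def)
    then have "(\<lambda>n. value_of \<mu> \<nu> + e (r n) - c0) \<longlonglongrightarrow> value_of \<mu> \<nu> + 0 - c0" by (intro tendsto_intros)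
    then show "(\<lambda>n. value_of \<mu> \<nu> + e (r n) - c0) \<longlonglongrightarrow> value_of \<mu> \<nu> - c0" by simp
  qed
  finally have fat: "(\<integral>\<^sup>+x. ennreal (\<psi> (x - T x)) \<partial>\<mu>) \<le> ennreal (value_of \<mu> \<nu> - c0)" .
  have i1: "integrable \<mu> (\<lambda>x. \<psi> (x - T x))"
  proof (rule integrableI_nonneg)
    show "(\<integral>\<^sup>+x. ennreal (\<psi> (x - T x)) \<partial>\<mu>) < \<infinity>" using fat by (rule le_less_trans) simp
  qed (use \<psi>0 in auto)
  have "ennreal (\<integral>x. \<psi> (x - T x) \<partial>\<mu>) \<le> ennreal (value_of \<mu> \<nu> - c0)"
    using fat nn_integral_eq_integral[OF i1] \<psi>0 by simp
  then have b: "(\<integral>x. \<psi> (x - T x) \<partial>\<mu>) \<le> value_of \<mu> \<nu> - c0" using v by (simp add: ennreal_le_iff)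
  have "integrable \<mu> (\<lambda>x. \<psi> (x - T x) + (\<alpha> + \<beta> \<bullet> (x - T x)))"
    using i1 aff(1)[OF le T\<mu>] by (rule Bochner_Integration.integrable_add)
  moreover have "(\<integral>x. \<psi> (x - T x) + (\<alpha> + \<beta> \<bullet> (x - T x)) \<partial>\<mu>) = (\<integral>x. \<psi> (x - T x) \<partial>\<mu>) + c0"
    using i1 aff[OF le T\<mu>] by (subst Bochner_Integration.integral_add) auto
  moreover have "\<psi> y + (\<alpha> + \<beta> \<bullet> y) = \<theta> y" for y by (simp add: \<psi>_def)
  ultimately have "integrable \<mu> (\<lambda>x. \<theta> (x - T x))" "(\<integral>x. \<theta> (x - T x) \<partial>\<mu>) \<le> value_of \<mu> \<nu>" using b by simp_all
  then show ?thesis using T le unfolding optimal_map_iff[OF \<mu> \<nu>] competitor_self[OF \<mu>] by blast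
qed

lemma optimal_map_AE_unique:
  assumes strict: "strictly_convex \<theta>" and \<mu>: "\<mu> \<in> prob_moment \<rho>" and \<nu>: "\<nu> \<in> prob_moment 1"
    and o: "optimal_map \<theta> \<mu> \<nu> T" "optimal_map \<theta> \<mu> \<nu> T'"
  shows "AE x in \<mu>. T x = T' x"
proof -
  interpret prob_space \<mu> using \<mu> by (simp add: prob_moment_def)
  have c: "competitor \<mu> (\<lambda>x. x) T \<mu> \<nu>" "competitor \<mu> (\<lambda>x. x) T' \<mu> \<nu>"
    and v: "(\<integral>x. \<theta> (x - T x) \<partial>\<mu>) \<le> value_of \<mu> \<nu>" "(\<integral>x. \<theta> (x - T' x) \<partial>\<mu>) \<le> value_of \<mu> \<nu>"
    using o by (auto simp: optimal_map_iff[OF \<mu> \<nu>])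
  show ?thesis
  proof (rule AE_eq_of_close)
    show "T \<in> borel_measurable \<mu>" "T' \<in> borel_measurable \<mu>" using c by (auto simp: competitor_def)
    fix \<epsilon> :: real assume "0 < \<epsilon>"
    then show "measure \<mu> {x \<in> space \<mu>. \<epsilon> < norm (T x - T' x)} \<le> \<epsilon>"
      using near_optimal_close_fixed[OF strict _ \<mu> \<nu>, of \<epsilon>, where 'b='a] c v
      by (meson add_increasing2 less_imp_le order_trans)
  qed
qed

text \<open>No optimal coupling for \<eta> is presupposed. On a nearly optimal one, the second
  coordinate and \<open>T (fst p)\<close> are both nearly optimal competitors, hence close in
  probability; letting the coupling improve identifies the two laws.\<close>

lemma minimizer_iff:
  assumes strict: "strictly_convex \<theta>" and \<mu>: "\<mu> \<in> prob_moment \<rho>" and \<nu>: "\<nu> \<in> prob_moment 1"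
    and o: "optimal_map \<theta> \<mu> \<nu> T"
  shows "is_arg_min (transport_cost \<theta> \<mu>) (\<lambda>\<eta>. \<eta> \<le>\<^sub>c \<nu>) \<eta> \<longleftrightarrow> \<eta> = distr \<mu> borel T" (is "?L \<longleftrightarrow> ?R")
proof -
  note V = weak_transport_cost_finite[OF \<mu> \<nu>]
  have comp: "competitor \<mu> (\<lambda>x. x) T \<mu> \<nu>" and cT: "(\<integral>x. \<theta> (x - T x) \<partial>\<mu>) \<le> value_of \<mu> \<nu>"
    using o by (auto simp: optimal_map_iff[OF \<mu> \<nu>])
  then have T[measurable]: "T \<in> borel_measurable borel" and le: "distr \<mu> borel T \<le>\<^sub>c \<nu>"
    by (auto simp: competitor_self[OF \<mu>])
  have TV: "transport_cost \<theta> \<mu> (distr \<mu> borel T) = ereal (value_of \<mu> \<nu>)"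
    using o by (simp add: optimal_map_def V)
  show ?thesis
  proof
    assume ?R
    have "ereal (value_of \<mu> \<nu>) \<le> transport_cost \<theta> \<mu> \<zeta>" if "\<zeta> \<le>\<^sub>c \<nu>" for \<zeta>
      unfolding V[symmetric] weak_transport_cost_def using that by (intro INF_lower) auto
    then show ?L using le TV \<open>?R\<close> by (auto simp: is_arg_min_def not_less)
  next
    assume ?L
    then have \<eta>: "\<eta> \<le>\<^sub>c \<nu>" and "\<not> transport_cost \<theta> \<mu> (distr \<mu> borel T) < transport_cost \<theta> \<mu> \<eta>"
      using le by (auto simp: is_arg_min_def)
    then have c\<eta>: "transport_cost \<theta> \<mu> \<eta> \<le> ereal (value_of \<mu> \<nu>)" using TV by (simp add: not_less)
    have "\<eta> \<in> prob_moment 1" "distr \<mu> borel T \<in> prob_moment 1" using \<eta> le by (auto simp: convex_order_def)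
    then have p: "prob_space \<eta>" "sets \<eta> = sets borel" "prob_space (distr \<mu> borel T)" "sets (distr \<mu> borel T) = sets borel"
      by (auto simp: prob_moment_1_iff)
    show ?R
    proof (rule distr_eq_of_close[OF p, where 'b="'a \<times> 'a"])
      fix \<epsilon> :: real assume \<epsilon>: "0 < \<epsilon>"
      obtain \<delta> where \<delta>: "0 < \<delta>" and close: "\<And>(M :: ('a \<times> 'a) measure) X Y Y'. competitor M X Y \<mu> \<nu> \<Longrightarrow> competitor M X Y' \<mu> \<nu> \<Longrightarrow>
        (\<integral>x. \<theta> (X x - Y x) \<partial>M) \<le> value_of \<mu> \<nu> + \<delta> \<Longrightarrow> (\<integral>x. \<theta> (X x - Y' x) \<partial>M) \<le> value_of \<mu> \<nu> + \<delta> \<Longrightarrow>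
        measure M {x \<in> space M. \<epsilon> < norm (Y x - Y' x)} \<le> \<epsilon>"
        using near_optimal_close_fixed[OF strict \<epsilon> \<mu> \<nu>, where 'b="'a \<times> 'a"] by blast
      have "transport_cost \<theta> \<mu> \<eta> < ereal (value_of \<mu> \<nu> + \<delta>)" using c\<eta> \<delta> by (auto intro: le_less_trans)
      then obtain \<pi> where \<pi>: "\<pi> \<in> couplings \<mu> \<eta>" "ext_integral \<pi> (\<lambda>(x, y). \<theta> (x - y)) < ereal (value_of \<mu> \<nu> + \<delta>)"
        unfolding transport_cost_def by (auto simp: INF_less_iff)
      have c: "integrable \<pi> (\<lambda>p. \<theta> (fst p - snd p))" "(\<integral>p. \<theta> (fst p - snd p) \<partial>\<pi>) \<le> value_of \<mu> \<nu> + \<delta>"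
        using coupling_cost(1)[OF \<mu> \<eta> \<pi>(1)] \<pi>(2) by (auto split: if_splits)
      note cd = couplingD[OF \<pi>(1)]
      note [measurable] = cd(2,3)
      have m: "(\<lambda>p. T (fst p)) \<in> borel_measurable \<pi>" by measurable
      have d: "distr \<pi> borel (\<lambda>p. T (fst p)) = distr \<mu> borel T"
        unfolding cd(4)[symmetric] by (simp add: distr_distr comp_def)
      have "competitor \<pi> fst snd \<mu> \<nu>" using cd c(1) \<eta> by (simp add: competitor_def)
      moreover have "competitor \<pi> fst (\<lambda>p. T (fst p)) \<mu> \<nu>" using competitor_coupling(1)[OF \<mu> comp \<pi>(1)] .
      moreover have "(\<integral>p. \<theta> (fst p - T (fst p)) \<partial>\<pi>) \<le> value_of \<mu> \<nu> + \<delta>"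
        using coupling_fst(2)[OF \<pi>(1), of "\<lambda>x. \<theta> (x - T x)"] cT \<delta> by simp
      ultimately have "measure \<pi> {p \<in> space \<pi>. \<epsilon> < norm (snd p - T (fst p))} \<le> \<epsilon>"
        using c(2) by (intro close) auto
      then show "\<exists>(M :: ('a \<times> 'a) measure) U V. prob_space M \<and> U \<in> borel_measurable M \<and> V \<in> borel_measurable M \<and>
          distr M borel U = \<eta> \<and> distr M borel V = distr \<mu> borel T \<and> measure M {x \<in> space M. \<epsilon> < norm (U x - V x)} \<le> \<epsilon>"
        using coupling_cost(5)[OF \<mu> \<eta> \<pi>(1)] cd m d
        by (intro exI[of _ \<pi>] exI[of _ snd] exI[of _ "\<lambda>p. T (fst p)"]) auto
    qed
  qed
qed

end

text \<open>Closeness in probability becomes closeness in mean: off the exceptional event the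
  difference is at most \<epsilon>, on it both variables are controlled by their common
  modulus.\<close>

lemma (in prob_space) integral_norm_diff_le:
  fixes Y Y' :: "'a \<Rightarrow> 'b::euclidean_space"
  assumes [measurable]: "Y \<in> borel_measurable M" "Y' \<in> borel_measurable M"
    and ui: "ui_bound M (\<lambda>x. norm (Y x)) B" "ui_bound M (\<lambda>x. norm (Y' x)) B" and B: "0 \<le> B e" "0 < e" "0 \<le> \<epsilon>"
    and p: "measure M {x \<in> space M. \<epsilon> < norm (Y x - Y' x)} \<le> \<epsilon>"
  shows "(\<integral>x. norm (Y x - Y' x) \<partial>M) \<le> \<epsilon> * (1 + 2 * B e) + 2 * e"
proof -
  define w where "w x = (indicator {x \<in> space M. \<epsilon> < norm (Y x - Y' x)} x :: real)" for x
  have wm[measurable]: "w \<in> borel_measurable M" unfolding w_def by measurable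
  have w: "0 \<le> w x" "w x \<le> 1" for x by (auto simp: w_def indicator_def)
  have wint: "(\<integral>x. w x \<partial>M) \<le> \<epsilon>" using p by (simp add: w_def)
  note 1 = ui_bound_weighted[OF ui(1) B(1,2) wm w] and 2 = ui_bound_weighted[OF ui(2) B(1,2) wm w]
  have i: "integrable M (\<lambda>x. norm (Y x))" "integrable M (\<lambda>x. norm (Y' x))" using ui by (auto simp: ui_bound_def)
  have iY: "integrable M Y" "integrable M Y'" by (rule integrable_norm_cancel[OF i(1)] integrable_norm_cancel[OF i(2)], measurable)+
  have "(\<integral>x. norm (Y x - Y' x) \<partial>M) \<le> (\<integral>x. \<epsilon> + w x * norm (Y x) + w x * norm (Y' x) \<partial>M)"
  proof (rule integral_mono)
    show "integrable M (\<lambda>x. norm (Y x - Y' x))" using iY by auto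
    show "integrable M (\<lambda>x. \<epsilon> + w x * norm (Y x) + w x * norm (Y' x))" using 1(1) 2(1) by auto
    show "norm (Y x - Y' x) \<le> \<epsilon> + w x * norm (Y x) + w x * norm (Y' x)" if "x \<in> space M" for x
      using norm_triangle_ineq4[of "Y x" "Y' x"] that B(3) by (auto simp: w_def indicator_def not_less)
  qed
  also have "\<dots> = \<epsilon> + (\<integral>x. w x * norm (Y x) \<partial>M) + (\<integral>x. w x * norm (Y' x) \<partial>M)"
    using 1(1) 2(1) by (simp add: prob_space)
  also have "\<dots> \<le> \<epsilon> + (B e * \<epsilon> + e) + (B e * \<epsilon> + e)"
    using 1(2) 2(2) mult_left_mono[OF wint B(1)] by linarith
  finally show ?thesis by (simp add: algebra_simps)
qed

text \<open>A competitor for the perturbed problem that is built from the optimal map of the unperturbed one is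
  nearly optimal, hence close to the optimal map of the perturbed problem.\<close>

lemma (in convex_cost) optimal_maps_close:
  fixes B1 B2 :: "real \<Rightarrow> real"
  assumes B: "\<And>e. 0 \<le> B1 e" "\<And>e. 0 \<le> B2 e" and strict: "strictly_convex \<theta>" and \<eta>: "0 < \<eta>"
    and bd: "bounded_data B1 B2 \<mu> \<nu>" and o: "optimal_map \<theta> \<mu> \<nu> T"
  shows "\<exists>\<delta>>0. \<forall>\<mu>' \<nu>' T' \<kappa>. bounded_data B1 B2 \<mu>' \<nu>' \<longrightarrow> optimal_map \<theta> \<mu>' \<nu>' T' \<longrightarrow>
    near_data \<delta> \<mu> \<nu> \<mu>' \<nu>' \<kappa> \<longrightarrow> value_of \<mu> \<nu> \<le> value_of \<mu>' \<nu>' + \<delta> \<longrightarrow>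
    (\<integral>p. norm (T' (snd p) - T (fst p)) \<partial>\<kappa>) \<le> \<eta>"
proof -
  have \<mu>: "\<mu> \<in> prob_moment \<rho>" and \<nu>: "\<nu> \<in> prob_moment 1" and ui: "ui_bound \<nu> norm B2"
    using bd by (auto simp: bounded_data_def)
  interpret prob_space \<mu> using \<mu> by (simp add: prob_moment_def)
  have comp: "competitor \<mu> (\<lambda>x. x) T \<mu> \<nu>" and cT: "(\<integral>x. \<theta> (x - T x) \<partial>\<mu>) \<le> value_of \<mu> \<nu>"
    using o by (auto simp: optimal_map_iff[OF \<mu> \<nu>])
  \<comment> \<open>The first moments are at most \<open>1 + (B1 1 + 1)\<close> for the first
    marginal, by \<open>t \<le> 1 + t powr \<rho>\<close>, and \<open>B2 1 + 1\<close> for the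
    second.\<close>
  define K where "K = 3 + B1 1 + B2 1"
  have K: "0 \<le> K" using B(1)[of 1] B(2)[of 1] by (simp add: K_def)
  \<comment> \<open>The final bound is \<open>2 * \<epsilon> * (1 + 2 * B2 e) + 2 * e\<close>, and
    each of its two terms equals \<open>\<eta> / 4\<close>.\<close>
  define e where "e = \<eta> / 8"
  define \<epsilon> where "\<epsilon> = \<eta> / (8 * (1 + 2 * B2 e))"
  have e: "0 < e" using \<eta> by (simp add: e_def)
  have \<epsilon>: "0 < \<epsilon>" "2 * \<epsilon> * (1 + 2 * B2 e) = \<eta> / 4"
  proof -
    define D where "D = 1 + 2 * B2 e"
    have "0 < D" using B(2)[of e] by (simp add: D_def)
    then show "0 < \<epsilon>" "2 * \<epsilon> * (1 + 2 * B2 e) = \<eta> / 4" using \<eta> by (simp_all add: \<epsilon>_def D_def[symmetric])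
  qed
  from near_optimal_close[OF strict \<epsilon>(1) K, where 'b="'a \<times> 'a"] obtain \<delta>1 where \<delta>1: "0 < \<delta>1"
    and N: "\<forall>(M :: ('a \<times> 'a) measure) X Y Y' \<mu> \<nu>. \<mu> \<in> prob_moment \<rho> \<longrightarrow> \<nu> \<in> prob_moment 1 \<longrightarrow>
      (\<integral>x. norm x \<partial>\<mu>) + (\<integral>z. norm z \<partial>\<nu>) \<le> K \<longrightarrow> competitor M X Y \<mu> \<nu> \<longrightarrow> competitor M X Y' \<mu> \<nu> \<longrightarrow>
      (\<integral>x. \<theta> (X x - Y x) \<partial>M) \<le> value_of \<mu> \<nu> + \<delta>1 \<longrightarrow> (\<integral>x. \<theta> (X x - Y' x) \<partial>M) \<le> value_of \<mu> \<nu> + \<delta>1 \<longrightarrow>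
      measure M {x \<in> space M. \<epsilon> < norm (Y x - Y' x)} \<le> \<epsilon>"
    by (elim exE conjE) (rule that)
  \<comment> \<open>The square lets Markov's inequality turn a mean distance into a probability of
    at most \<epsilon>; the half of \<open>\<delta>1\<close> is joined by the half reserved in
    \<delta> for the change of value.\<close>
  define \<epsilon>' where "\<epsilon>' = min (\<delta>1 / 2) (\<epsilon> * \<epsilon>)"
  have \<epsilon>': "0 < \<epsilon>'" "\<epsilon>' \<le> \<delta>1 / 2" "\<epsilon>' \<le> \<epsilon> * \<epsilon>" using \<delta>1 \<epsilon>(1) by (simp_all add: \<epsilon>'_def)
  from perturb[of B1 B2, OF B \<epsilon>'(1)] obtain \<delta>2 where \<delta>2: "0 < \<delta>2"
    and P: "\<forall>\<mu> \<nu> T \<mu>' \<nu>' \<kappa>. bounded_data B1 B2 \<mu> \<nu> \<longrightarrow> near_data \<delta>2 \<mu> \<nu> \<mu>' \<nu>' \<kappa> \<longrightarrow> competitor \<mu> (\<lambda>x. x) T \<mu> \<nu> \<longrightarrow>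
      (\<exists>S. competitor \<kappa> snd (\<lambda>p. S (fst p)) \<mu>' \<nu>' \<and> (\<integral>p. norm (S (fst p) - T (fst p)) \<partial>\<kappa>) \<le> \<epsilon>' \<and>
        (\<integral>p. \<theta> (snd p - S (fst p)) \<partial>\<kappa>) \<le> (\<integral>x. \<theta> (x - T x) \<partial>\<mu>) + \<epsilon>')"
    by (elim exE conjE) (rule that)
  define \<delta> where "\<delta> = min \<delta>2 (\<delta>1 / 2)"
  have \<delta>: "0 < \<delta>" "\<delta> \<le> \<delta>2" "\<delta> \<le> \<delta>1 / 2" using \<delta>1 \<delta>2 by (simp_all add: \<delta>_def)
  have "(\<integral>p. norm (T' (snd p) - T (fst p)) \<partial>\<kappa>) \<le> \<eta>"
    if bd': "bounded_data B1 B2 \<mu>' \<nu>'" and o': "optimal_map \<theta> \<mu>' \<nu>' T'"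
      and near: "near_data \<delta> \<mu> \<nu> \<mu>' \<nu>' \<kappa>" and v: "value_of \<mu> \<nu> \<le> value_of \<mu>' \<nu>' + \<delta>"
    for \<mu>' \<nu>' T' \<kappa>
  proof -
    have \<mu>': "\<mu>' \<in> prob_moment \<rho>" and \<nu>': "\<nu>' \<in> prob_moment 1"
      and ui': "ui_bound \<mu>' (\<lambda>x. norm x powr \<rho>) B1" "ui_bound \<nu>' norm B2" using bd' by (auto simp: bounded_data_def)
    have \<kappa>: "\<kappa> \<in> couplings \<mu> \<mu>'" and near2: "near_data \<delta>2 \<mu> \<nu> \<mu>' \<nu>' \<kappa>"
      using near \<delta>(2) by (auto simp: near_data_def intro: order_trans)
    interpret \<mu>': prob_space \<mu>' using \<mu>' by (simp add: prob_moment_def)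
    interpret \<nu>': prob_space \<nu>' using \<nu>' by (simp add: prob_moment_1_iff)
    interpret \<kappa>: prob_space \<kappa> using coupling_prob_space[OF \<kappa> prob_space_axioms] .
    have comp': "competitor \<mu>' (\<lambda>x. x) T' \<mu>' \<nu>'" and cT': "(\<integral>x. \<theta> (x - T' x) \<partial>\<mu>') \<le> value_of \<mu>' \<nu>'"
      using o' by (auto simp: optimal_map_iff[OF \<mu>' \<nu>'])
    then have [measurable]: "T' \<in> borel_measurable borel" by (simp add: competitor_self[OF \<mu>'])
    have c\<kappa>: "competitor \<kappa> fst (\<lambda>p. T (fst p)) \<mu> \<nu>" "competitor \<kappa> snd (\<lambda>p. T' (snd p)) \<mu>' \<nu>'"
      using competitor_coupling(1)[OF \<mu> comp \<kappa>] competitor_coupling(2)[OF \<mu>' comp' \<kappa>] .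
    obtain S where cS: "competitor \<kappa> snd (\<lambda>p. S (fst p)) \<mu>' \<nu>'"
      and ST: "(\<integral>p. norm (S (fst p) - T (fst p)) \<partial>\<kappa>) \<le> \<epsilon>'"
      and vS: "(\<integral>p. \<theta> (snd p - S (fst p)) \<partial>\<kappa>) \<le> (\<integral>x. \<theta> (x - T x) \<partial>\<mu>) + \<epsilon>'"
      using P[rule_format, OF bd near2 comp] by blast
    have m[measurable]: "(\<lambda>p. T' (snd p)) \<in> borel_measurable \<kappa>" "(\<lambda>p. S (fst p)) \<in> borel_measurable \<kappa>" "(\<lambda>p. T (fst p)) \<in> borel_measurable \<kappa>"
      and d: "distr \<kappa> borel (\<lambda>p. T' (snd p)) \<le>\<^sub>c \<nu>'" "distr \<kappa> borel (\<lambda>p. S (fst p)) \<le>\<^sub>c \<nu>'" "distr \<kappa> borel (\<lambda>p. T (fst p)) \<le>\<^sub>c \<nu>"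
      using c\<kappa> cS by (auto simp: competitor_def)
    have vT': "(\<integral>p. \<theta> (snd p - T' (snd p)) \<partial>\<kappa>) \<le> value_of \<mu>' \<nu>' + \<delta>1"
      using coupling_snd(2)[OF \<kappa>, of "\<lambda>x. \<theta> (x - T' x)"] cT' \<delta>1 by simp
    \<comment> \<open>The cost of \<open>S\<close> is compared first with the value at the
      unperturbed data and then, through \<open>v\<close>, with the value at the perturbed
      data.\<close>
    have vS': "(\<integral>p. \<theta> (snd p - S (fst p)) \<partial>\<kappa>) \<le> value_of \<mu>' \<nu>' + \<delta>1"
      using vS cT v \<delta>(3) \<epsilon>'(2) by linarith
    have K': "(\<integral>x. norm x \<partial>\<mu>') + (\<integral>z. norm z \<partial>\<nu>') \<le> K"
    proof -
      have ix: "integrable \<mu>' (\<lambda>x. norm x powr \<rho>)" using \<mu>' by (simp add: prob_moment_def)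
      have ixn: "integrable \<mu>' (\<lambda>x. x)" using prob_moment_1[OF \<mu>' \<rho>] by (simp add: prob_moment_1_iff)
      have "(\<integral>x. norm x \<partial>\<mu>') \<le> (\<integral>x. 1 + norm x powr \<rho> \<partial>\<mu>')"
        using le_1_powr[OF norm_ge_zero \<rho>] ix ixn by (intro integral_mono) auto
      also have "\<dots> = 1 + (\<integral>x. norm x powr \<rho> \<partial>\<mu>')" using ix by (simp add: \<mu>'.prob_space)
      also have "\<dots> \<le> 1 + (B1 1 + 1)" using \<mu>'.ui_bound_mean[OF ui'(1) B(1)] by simp
      finally show ?thesis using \<nu>'.ui_bound_mean[OF ui'(2) B(2)] by (simp add: K_def)
    qed
    have p1: "measure \<kappa> {p \<in> space \<kappa>. \<epsilon> < norm (T' (snd p) - S (fst p))} \<le> \<epsilon>"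
      by (rule N[rule_format, OF \<mu>' \<nu>' K' c\<kappa>(2) cS vT' vS'])
    have p2: "measure \<kappa> {p \<in> space \<kappa>. \<epsilon> < norm (S (fst p) - T (fst p))} \<le> \<epsilon>"
    proof -
      have i\<kappa>: "integrable \<kappa> (\<lambda>p. norm (S (fst p) - T (fst p)))"
        using convex_order_distrD(2)[OF d(2) m(2)] convex_order_distrD(2)[OF d(3) m(3)] by auto
      have "measure \<kappa> {p \<in> space \<kappa>. \<epsilon> < norm (S (fst p) - T (fst p))} \<le> measure \<kappa> {p \<in> space \<kappa>. \<epsilon> \<le> norm (S (fst p) - T (fst p))}"
        by (intro \<kappa>.finite_measure_mono) auto
      also have "\<dots> \<le> (\<integral>p. norm (S (fst p) - T (fst p)) \<partial>\<kappa>) / \<epsilon>"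
        using i\<kappa> \<epsilon>(1) by (intro integral_Markov_inequality_measure[where A="{}"]) auto
      also have "\<dots> \<le> (\<epsilon> * \<epsilon>) / \<epsilon>" using ST \<epsilon>' \<epsilon>(1) by (intro divide_right_mono) auto
      finally show ?thesis using \<epsilon>(1) by simp
    qed
    have "measure \<kappa> {p \<in> space \<kappa>. 2 * \<epsilon> < norm (T' (snd p) - T (fst p))}
        \<le> measure \<kappa> ({p \<in> space \<kappa>. \<epsilon> < norm (T' (snd p) - S (fst p))} \<union> {p \<in> space \<kappa>. \<epsilon> < norm (S (fst p) - T (fst p))})"
    proof (rule \<kappa>.finite_measure_mono)
      show "{p \<in> space \<kappa>. 2 * \<epsilon> < norm (T' (snd p) - T (fst p))}
        \<subseteq> {p \<in> space \<kappa>. \<epsilon> < norm (T' (snd p) - S (fst p))} \<union> {p \<in> space \<kappa>. \<epsilon> < norm (S (fst p) - T (fst p))}"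
      proof
        fix p assume p: "p \<in> {p \<in> space \<kappa>. 2 * \<epsilon> < norm (T' (snd p) - T (fst p))}"
        have "norm (T' (snd p) - T (fst p)) \<le> norm (T' (snd p) - S (fst p)) + norm (S (fst p) - T (fst p))"
          using norm_triangle_ineq[of "T' (snd p) - S (fst p)" "S (fst p) - T (fst p)"] by simp
        then show "p \<in> {p \<in> space \<kappa>. \<epsilon> < norm (T' (snd p) - S (fst p))} \<union> {p \<in> space \<kappa>. \<epsilon> < norm (S (fst p) - T (fst p))}"
          using p by auto
      qed
    qed measurable
    also have "\<dots> \<le> measure \<kappa> {p \<in> space \<kappa>. \<epsilon> < norm (T' (snd p) - S (fst p))} + measure \<kappa> {p \<in> space \<kappa>. \<epsilon> < norm (S (fst p) - T (fst p))}"
      by (rule measure_Un_le) measurable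
    finally have p: "measure \<kappa> {p \<in> space \<kappa>. 2 * \<epsilon> < norm (T' (snd p) - T (fst p))} \<le> 2 * \<epsilon>" using p1 p2 by linarith
    note uT' = ui_bound_convex_order[OF d(1) m(1) ui'(2)] and uT = ui_bound_convex_order[OF d(3) m(3) ui]
    have "(\<integral>p. norm (T' (snd p) - T (fst p)) \<partial>\<kappa>) \<le> 2 * \<epsilon> * (1 + 2 * B2 e) + 2 * e"
      using \<epsilon>(1) by (intro \<kappa>.integral_norm_diff_le[OF m(1,3) uT' uT B(2) e _ p]) simp
    then show ?thesis using \<epsilon>(2) \<eta> by (simp add: e_def)
  qed
  then show ?thesis using \<delta>(1) by blast
qed

theorem theorem1p5:
  fixes \<rho> c :: real
    and \<theta> :: "'a::euclidean_space \<Rightarrow> real"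
    and \<mu>s \<nu>s :: "nat \<Rightarrow> 'a measure"
    and \<mu> \<nu> :: "'a measure"
  assumes "1 \<le> \<rho>"
    and "\<And>k. \<mu>s k \<in> prob_moment \<rho>"
    and "\<And>k. \<nu>s k \<in> prob_moment 1"
    and "convex_on UNIV \<theta>"
    and "c > 0"
    and "\<And>x. \<theta> x \<le> c * (1 + norm x powr \<rho>)"
    and "wasserstein_tendsto \<rho> \<mu>s \<mu>"
    and "wasserstein_tendsto 1 \<nu>s \<nu>"
  shows "(\<lambda>k. weak_transport_cost \<theta> (\<mu>s k) (\<nu>s k)) \<longlonglongrightarrow> weak_transport_cost \<theta> \<mu> \<nu> \<and>
    (strictly_convex \<theta> \<longrightarrow>
      ((\<forall>k. \<exists>!\<eta>. is_arg_min (transport_cost \<theta> (\<mu>s k)) (\<lambda>\<eta>. \<eta> \<le>\<^sub>c \<nu>s k) \<eta>) \<and>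
       (\<exists>!\<eta>. is_arg_min (transport_cost \<theta> \<mu>) (\<lambda>\<eta>. \<eta> \<le>\<^sub>c \<nu>) \<eta>) \<and>
       wasserstein_tendsto 1
         (\<lambda>k. arg_min (transport_cost \<theta> (\<mu>s k)) (\<lambda>\<eta>. \<eta> \<le>\<^sub>c \<nu>s k))
         (arg_min (transport_cost \<theta> \<mu>) (\<lambda>\<eta>. \<eta> \<le>\<^sub>c \<nu>))) \<and>
      ((\<forall>k. \<mu>s k = \<mu>) \<longrightarrow>
       (\<forall>k. ex_AE_unique \<mu> (optimal_map \<theta> \<mu> (\<nu>s k))) \<and>
       ex_AE_unique \<mu> (optimal_map \<theta> \<mu> \<nu>) \<and>
       (\<forall>Ts T. (\<forall>k. optimal_map \<theta> \<mu> (\<nu>s k) (Ts k)) \<longrightarrow> optimal_map \<theta> \<mu> \<nu> T \<longrightarrow>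
          tendsto_in_prob \<mu> Ts T)))"
proof -
  obtain a where "0 \<le> a" "\<And>y. - \<theta> y \<le> a * (1 + norm y)" using convex_lower_bound[OF assms(4)] by blast
  then interpret convex_cost \<theta> \<rho> c a using assms by unfold_locales auto
  have \<mu>: "\<mu> \<in> prob_moment \<rho>" and \<nu>: "\<nu> \<in> prob_moment 1" using assms(7,8) by (auto simp: wasserstein_tendsto_def)
  note \<mu>s = assms(2) and \<nu>s = assms(3)
  obtain B1 where B1: "\<And>e. 0 \<le> B1 e" and u1: "ui_bound \<mu> (\<lambda>x. norm x powr \<rho>) B1" "\<And>k. ui_bound (\<mu>s k) (\<lambda>x. norm x powr \<rho>) B1"
    using ui_bound_family[OF assms(7,1)] by metis
  have n1: "(\<lambda>x::'a. norm x powr 1) = norm" by (simp add: fun_eq_iff)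
  obtain B2 where B2: "\<And>e. 0 \<le> B2 e" and u2: "ui_bound \<nu> norm B2" "\<And>k. ui_bound (\<nu>s k) norm B2"
    using ui_bound_family[OF assms(8) order_refl] unfolding n1 by metis
  have bd: "bounded_data B1 B2 \<mu> \<nu>" "bounded_data B1 B2 (\<mu>s k) (\<nu>s k)" for k
    using \<mu> \<nu> \<mu>s \<nu>s u1 u2 by (simp_all add: bounded_data_def)
  \<comment> \<open>Both directions are recorded: swapping coordinates gives the reverse couplings
    at equal cost.\<close>
  have near: "\<forall>\<^sub>F k in sequentially.
      (\<exists>\<kappa>. near_data \<delta> (\<mu>s k) (\<nu>s k) \<mu> \<nu> \<kappa>) \<and> (\<exists>\<kappa>. near_data \<delta> \<mu> \<nu> (\<mu>s k) (\<nu>s k) \<kappa>)" if \<delta>: "0 < \<delta>" for \<delta>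
    using wasserstein_tendsto_couplings[OF assms(7,1) \<delta>] wasserstein_tendsto_couplings[OF assms(8) order_refl \<delta>]
  proof eventually_elim
    case (elim k)
    then obtain \<kappa> \<xi> where \<kappa>: "\<kappa> \<in> couplings (\<mu>s k) \<mu>" "(\<integral>p. norm (fst p - snd p) powr \<rho> \<partial>\<kappa>) \<le> \<delta>"
      and \<xi>: "\<xi> \<in> couplings (\<nu>s k) \<nu>" "(\<integral>p. norm (fst p - snd p) powr 1 \<partial>\<xi>) \<le> \<delta>" by blast
    have "near_data \<delta> (\<mu>s k) (\<nu>s k) \<mu> \<nu> \<kappa>" unfolding near_data_def using \<mu> \<nu> \<kappa> \<xi> by blast
    moreover have "near_data \<delta> \<mu> \<nu> (\<mu>s k) (\<nu>s k) (distr \<kappa> borel (\<lambda>p. (snd p, fst p)))"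
      unfolding near_data_def
      by (intro conjI \<mu>s \<nu>s couplings_swap(1)[OF \<kappa>(1)] bexI[OF _ couplings_swap(1)[OF \<xi>(1)]])
        (simp_all only: couplings_swap(2)[OF \<kappa>(1)] couplings_swap(2)[OF \<xi>(1)] \<kappa> \<xi>)
    ultimately show ?case by blast
  qed
  \<comment> \<open>The second bound perturbs from the k-th data to the limit, so it relies on
    \<delta> being common to all data with moduli \<open>B1\<close> and \<open>B2\<close>.\<close>
  have upper_v: "\<forall>\<^sub>F k in sequentially. value_of (\<mu>s k) (\<nu>s k) \<le> value_of \<mu> \<nu> + \<epsilon>"
    and lower_v: "\<forall>\<^sub>F k in sequentially. value_of \<mu> \<nu> \<le> value_of (\<mu>s k) (\<nu>s k) + \<epsilon>" if \<epsilon>: "0 < \<epsilon>" for \<epsilon>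
  proof -
    from value_perturb[of B1 B2, OF B1 B2 \<epsilon>] obtain \<delta> where \<delta>: "0 < \<delta>"
      and P: "\<forall>\<mu> \<nu> \<mu>' \<nu>' \<kappa>. bounded_data B1 B2 \<mu> \<nu> \<longrightarrow> near_data \<delta> \<mu> \<nu> \<mu>' \<nu>' \<kappa> \<longrightarrow> value_of \<mu>' \<nu>' \<le> value_of \<mu> \<nu> + \<epsilon>"
      by (elim exE conjE) (rule that)
    show "\<forall>\<^sub>F k in sequentially. value_of (\<mu>s k) (\<nu>s k) \<le> value_of \<mu> \<nu> + \<epsilon>"
      "\<forall>\<^sub>F k in sequentially. value_of \<mu> \<nu> \<le> value_of (\<mu>s k) (\<nu>s k) + \<epsilon>"
      using near[OF \<delta>] by (eventually_elim, use P bd in blast)+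
  qed
  have lim: "(\<lambda>k. value_of (\<mu>s k) (\<nu>s k)) \<longlonglongrightarrow> value_of \<mu> \<nu>"
  proof (rule tendstoI)
    fix \<epsilon> :: real assume "0 < \<epsilon>"
    then have "0 < \<epsilon> / 2" by simp
    from upper_v[OF this] lower_v[OF this]
    show "\<forall>\<^sub>F k in sequentially. dist (value_of (\<mu>s k) (\<nu>s k)) (value_of \<mu> \<nu>) < \<epsilon>"
      by eventually_elim (use \<open>0 < \<epsilon>\<close> in \<open>auto simp: dist_real_def abs_less_iff field_simps\<close>)
  qed
  have part0: "(\<lambda>k. weak_transport_cost \<theta> (\<mu>s k) (\<nu>s k)) \<longlonglongrightarrow> weak_transport_cost \<theta> \<mu> \<nu>"
    using lim by (simp add: weak_transport_cost_finite[OF \<mu>s \<nu>s] weak_transport_cost_finite[OF \<mu> \<nu>])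
  \<comment> \<open>The comparison of values demanded by \<open>optimal_maps_close\<close> holds for
    large \<open>k\<close> by \<open>lower_v\<close>. The coupling stays arbitrary, so that equal
    first marginals may use the diagonal.\<close>
  have close: "\<exists>d>0. \<forall>\<^sub>F k in sequentially. \<forall>\<kappa>. near_data d \<mu> \<nu> (\<mu>s k) (\<nu>s k) \<kappa> \<longrightarrow>
      (\<integral>p. norm (Ts k (snd p) - T (fst p)) \<partial>\<kappa>) \<le> \<eta>"
    if strict: "strictly_convex \<theta>" and Ts: "\<And>k. optimal_map \<theta> (\<mu>s k) (\<nu>s k) (Ts k)" and T: "optimal_map \<theta> \<mu> \<nu> T"
      and \<eta>: "0 < \<eta>" for Ts T \<eta>
  proof -
    from optimal_maps_close[of B1 B2, OF B1 B2 strict \<eta> bd(1) T] obtain d where d: "0 < d"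
      and P: "\<forall>\<mu>' \<nu>' T' \<kappa>. bounded_data B1 B2 \<mu>' \<nu>' \<longrightarrow> optimal_map \<theta> \<mu>' \<nu>' T' \<longrightarrow>
        near_data d \<mu> \<nu> \<mu>' \<nu>' \<kappa> \<longrightarrow> value_of \<mu> \<nu> \<le> value_of \<mu>' \<nu>' + d \<longrightarrow>
        (\<integral>p. norm (T' (snd p) - T (fst p)) \<partial>\<kappa>) \<le> \<eta>"
      by (elim exE conjE) (rule that)
    have "\<forall>\<^sub>F k in sequentially. \<forall>\<kappa>. near_data d \<mu> \<nu> (\<mu>s k) (\<nu>s k) \<kappa> \<longrightarrow>
      (\<integral>p. norm (Ts k (snd p) - T (fst p)) \<partial>\<kappa>) \<le> \<eta>"
      using lower_v[OF d] by eventually_elim (use P bd(2) Ts in blast)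
    then show ?thesis using d by blast
  qed
  have part1: "(\<forall>k. \<exists>!\<eta>. is_arg_min (transport_cost \<theta> (\<mu>s k)) (\<lambda>\<eta>. \<eta> \<le>\<^sub>c \<nu>s k) \<eta>) \<and>
       (\<exists>!\<eta>. is_arg_min (transport_cost \<theta> \<mu>) (\<lambda>\<eta>. \<eta> \<le>\<^sub>c \<nu>) \<eta>) \<and>
       wasserstein_tendsto 1
         (\<lambda>k. arg_min (transport_cost \<theta> (\<mu>s k)) (\<lambda>\<eta>. \<eta> \<le>\<^sub>c \<nu>s k))
         (arg_min (transport_cost \<theta> \<mu>) (\<lambda>\<eta>. \<eta> \<le>\<^sub>c \<nu>))" if strict: "strictly_convex \<theta>"
  proof -
    obtain T where T: "optimal_map \<theta> \<mu> \<nu> T" using optimal_map_exists[OF strict \<mu> \<nu>] by blast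
    have "\<forall>k. \<exists>T. optimal_map \<theta> (\<mu>s k) (\<nu>s k) T" using optimal_map_exists[OF strict \<mu>s \<nu>s] by blast
    then obtain Ts where Ts: "\<And>k. optimal_map \<theta> (\<mu>s k) (\<nu>s k) (Ts k)" by metis
    note mk = minimizer_iff[OF strict \<mu>s \<nu>s Ts] and m = minimizer_iff[OF strict \<mu> \<nu> T]
    define \<eta>s where "\<eta>s k = distr (\<mu>s k) borel (Ts k)" for k
    define \<eta> where "\<eta> = distr \<mu> borel T"
    \<comment> \<open>By \<open>minimizer_iff\<close> the minimizing predicate determines its
      element, so the choice operator behind \<open>arg_min\<close> returns the law of the optimal
      map.\<close>
    have arg: "arg_min (transport_cost \<theta> (\<mu>s k)) (\<lambda>\<eta>. \<eta> \<le>\<^sub>c \<nu>s k) = \<eta>s k"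
      "arg_min (transport_cost \<theta> \<mu>) (\<lambda>\<eta>. \<eta> \<le>\<^sub>c \<nu>) = \<eta>" for k
      by (simp_all add: arg_min_def mk m \<eta>s_def \<eta>_def)
    have \<eta>1: "\<eta>s k \<in> prob_moment 1" "\<eta> \<in> prob_moment 1" for k
      using Ts T by (auto simp: optimal_map_def convex_order_def \<eta>s_def \<eta>_def)
    have Tm[measurable]: "Ts k \<in> borel_measurable borel" "T \<in> borel_measurable borel" for k
      using Ts T by (auto simp: optimal_map_def)
    have "\<forall>\<^sub>F k in sequentially. wasserstein_dist 1 (\<eta>s k) \<eta> < \<epsilon>" if \<epsilon>: "0 < \<epsilon>" for \<epsilon>
    proof -
      have "0 < \<epsilon> / 2" using \<epsilon> by simp
      from close[OF strict Ts T this] obtain d where d: "0 < d"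
        and ev: "\<forall>\<^sub>F k in sequentially. \<forall>\<kappa>. near_data d \<mu> \<nu> (\<mu>s k) (\<nu>s k) \<kappa> \<longrightarrow>
          (\<integral>p. norm (Ts k (snd p) - T (fst p)) \<partial>\<kappa>) \<le> \<epsilon> / 2" by blast
      show ?thesis
        using near[OF d] ev
      proof eventually_elim
        case (elim k)
        then obtain \<kappa> where near: "near_data d \<mu> \<nu> (\<mu>s k) (\<nu>s k) \<kappa>"
          and small: "(\<integral>p. norm (Ts k (snd p) - T (fst p)) \<partial>\<kappa>) \<le> \<epsilon> / 2" by blast
        then have \<kappa>: "\<kappa> \<in> couplings \<mu> (\<mu>s k)" by (simp add: near_data_def)
        note cd = couplingD[OF \<kappa>]
        note [measurable] = cd(2,3)
        have [measurable]: "fst \<in> borel_measurable (borel :: ('a \<times> 'a) measure)" "snd \<in> borel_measurable (borel :: ('a \<times> 'a) measure)"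
          by (auto intro!: borel_measurable_continuous_onI continuous_intros)
        \<comment> \<open>The coupling of the first marginals is pushed forward to one of the two
          minimizers, whose cost bounds their distance.\<close>
        define \<pi> where "\<pi> = distr \<kappa> borel (\<lambda>p. (Ts k (snd p), T (fst p)))"
        have d: "distr \<kappa> borel (\<lambda>p. Ts k (snd p)) = \<eta>s k" "distr \<kappa> borel (\<lambda>p. T (fst p)) = \<eta>"
          unfolding \<eta>s_def \<eta>_def cd(4,5)[symmetric] by (simp_all add: distr_distr comp_def)
        have "\<pi> \<in> couplings (\<eta>s k) \<eta>"
          unfolding couplings_def \<pi>_def by (auto simp: distr_distr comp_def d)
        from wasserstein_dist_le[OF \<eta>1(1,2) order_refl this]
        have "wasserstein_dist 1 (\<eta>s k) \<eta> \<le> (\<integral>p. norm (fst p - snd p) \<partial>\<pi>)" by simp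
        also have "\<dots> = (\<integral>p. norm (Ts k (snd p) - T (fst p)) \<partial>\<kappa>)"
          unfolding \<pi>_def by (subst integral_distr) auto
        finally show ?case using small \<epsilon> by linarith
      qed
    qed
    moreover have "0 \<le> wasserstein_dist 1 (\<eta>s k) \<eta>" for k
      unfolding wasserstein_dist_def by (rule powr_ge_zero)
    ultimately have "(\<lambda>k. wasserstein_dist 1 (\<eta>s k) \<eta>) \<longlonglongrightarrow> 0"
      by (intro tendstoI) (simp add: dist_real_def)
    then have "wasserstein_tendsto 1 \<eta>s \<eta>" using \<eta>1 by (simp add: wasserstein_tendsto_def)
    then show ?thesis by (simp add: arg mk m)
  qed
  have part2: "(\<forall>k. ex_AE_unique \<mu> (optimal_map \<theta> \<mu> (\<nu>s k))) \<and>
       ex_AE_unique \<mu> (optimal_map \<theta> \<mu> \<nu>) \<and>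
       (\<forall>Ts T. (\<forall>k. optimal_map \<theta> \<mu> (\<nu>s k) (Ts k)) \<longrightarrow> optimal_map \<theta> \<mu> \<nu> T \<longrightarrow>
          tendsto_in_prob \<mu> Ts T)" if strict: "strictly_convex \<theta>" and eq: "\<forall>k. \<mu>s k = \<mu>"
  proof (intro conjI allI impI)
    show "ex_AE_unique \<mu> (optimal_map \<theta> \<mu> (\<nu>s k))" for k
      unfolding ex_AE_unique_def using optimal_map_exists[OF strict \<mu> \<nu>s] optimal_map_AE_unique[OF strict \<mu> \<nu>s] by blast
    show "ex_AE_unique \<mu> (optimal_map \<theta> \<mu> \<nu>)"
      unfolding ex_AE_unique_def using optimal_map_exists[OF strict \<mu> \<nu>] optimal_map_AE_unique[OF strict \<mu> \<nu>] by blast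
    fix Ts T assume Ts: "\<forall>k. optimal_map \<theta> \<mu> (\<nu>s k) (Ts k)" and T: "optimal_map \<theta> \<mu> \<nu> T"
    interpret prob_space \<mu> using \<mu> by (simp add: prob_moment_def)
    have s\<mu>[measurable_cong]: "sets \<mu> = sets borel" using \<mu> by (simp add: prob_moment_def)
    have Tm[measurable]: "Ts k \<in> borel_measurable borel" "T \<in> borel_measurable borel" for k
      using Ts T by (auto simp: optimal_map_def)
    have iT: "integrable \<mu> (Ts k)" "integrable \<mu> T" for k
    proof -
      have "Ts k \<in> borel_measurable \<mu>" "T \<in> borel_measurable \<mu>" by measurable
      moreover have "distr \<mu> borel (Ts k) \<le>\<^sub>c \<nu>s k" "distr \<mu> borel T \<le>\<^sub>c \<nu>" using Ts T by (auto simp: optimal_map_def)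
      ultimately show "integrable \<mu> (Ts k)" "integrable \<mu> T" by (auto dest: convex_order_distrD(2))
    qed
    \<comment> \<open>With equal first marginals the diagonal coupling is admissible at zero cost,
      and on it the coupling integral becomes the mean distance of the two maps at the same
      point.\<close>
    define \<kappa> where "\<kappa> = distr \<mu> borel (\<lambda>x. (x, x))"
    have \<kappa>: "\<kappa> \<in> couplings \<mu> \<mu>" unfolding \<kappa>_def using s\<mu> by (rule couplings_diagonal)
    have [measurable]: "fst \<in> borel_measurable (borel :: ('a \<times> 'a) measure)" "snd \<in> borel_measurable (borel :: ('a \<times> 'a) measure)"
      by (auto intro!: borel_measurable_continuous_onI continuous_intros)
    have zero: "(\<integral>p. norm (fst p - snd p) powr \<rho> \<partial>\<kappa>) = 0"
      unfolding \<kappa>_def by (subst integral_distr) auto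
    show "tendsto_in_prob \<mu> Ts T"
      unfolding tendsto_in_prob_def
    proof (intro allI impI tendstoI)
      fix \<epsilon> \<epsilon>' :: real assume \<epsilon>: "0 < \<epsilon>" "0 < \<epsilon>'"
      then have "0 < \<epsilon> * \<epsilon>' / 2" by simp
      from close[OF strict _ T this, of Ts] Ts eq obtain d where d: "0 < d"
        and ev: "\<forall>\<^sub>F k in sequentially. \<forall>\<kappa>. near_data d \<mu> \<nu> (\<mu>s k) (\<nu>s k) \<kappa> \<longrightarrow>
          (\<integral>p. norm (Ts k (snd p) - T (fst p)) \<partial>\<kappa>) \<le> \<epsilon> * \<epsilon>' / 2" by auto
      show "\<forall>\<^sub>F k in sequentially. dist (measure \<mu> {x \<in> space \<mu>. \<epsilon> < dist (Ts k x) (T x)}) 0 < \<epsilon>'"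
        using near[OF d] ev
      proof eventually_elim
        case (elim k)
        \<comment> \<open>Only the coupling of the second marginals is taken from
          \<open>near\<close>; the diagonal takes the place of the other one.\<close>
        then have "near_data d \<mu> \<nu> (\<mu>s k) (\<nu>s k) \<kappa>" using \<kappa> zero eq d by (auto simp: near_data_def)
        then have "(\<integral>p. norm (Ts k (snd p) - T (fst p)) \<partial>\<kappa>) \<le> \<epsilon> * \<epsilon>' / 2" using elim(2) by blast
        then have n: "(\<integral>x. norm (Ts k x - T x) \<partial>\<mu>) \<le> \<epsilon> * \<epsilon>' / 2" unfolding \<kappa>_def by (subst (asm) integral_distr) auto
        have "measure \<mu> {x \<in> space \<mu>. \<epsilon> < dist (Ts k x) (T x)} \<le> measure \<mu> {x \<in> space \<mu>. \<epsilon> \<le> norm (Ts k x - T x)}"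
          by (intro finite_measure_mono) (auto simp: dist_norm)
        also have "\<dots> \<le> (\<integral>x. norm (Ts k x - T x) \<partial>\<mu>) / \<epsilon>"
          using iT \<epsilon> by (intro integral_Markov_inequality_measure[where A="{}"]) auto
        also have "\<dots> \<le> (\<epsilon> * \<epsilon>' / 2) / \<epsilon>" using n \<epsilon> by (intro divide_right_mono) auto
        also have "\<dots> < \<epsilon>'" using \<epsilon> by simp
        finally show ?case by (simp add: dist_real_def)
      qed
    qed
  qed
  show ?thesis using part0 part1 part2 by blast
qed

end
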